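(* Let $S$ be a smooth oriented surface with Gaussian curvature $K$. Consider the small, rapidly-spinning disk on $S$, i.e. the mechanical system whose configuration space is the unit tangent bundle of $S$ and whose Lagrangian is the kinetic energy $$E=\tfrac12 m|\dot\gamma|^2+\tfrac12 I_a\omega_a^2,\qquad \omega_a=\langle D_tu,Ju\rangle ,$$ for a curve $(\gamma(t),u(t))$ in the unit tangent bundle. Then the center $\gamma$ of the disk moves according to $$m\,D_t\dot\gamma=L\,(J\dot\gamma)\,K,$$ where $L=I_a\omega_a$ is constant along the motion and $J$ denotes counterclockwise rotation by $\pi/2$ in the tangent plane.
   Context: A curve $(\gamma,u)$ in the unit tangent bundle of $S$ consists of a smooth curve $\gamma(t)$ on $S$ (the path of the disk's center) and a smooth field $u(t)$ of unit vectors with $u(t)$ in the tangent plane of $S$ at $\gamma(t)$ (pointing from the center of the disk to a distinguished point on its boundary). $\langle\cdot,\cdot\rangle$ and $|\cdot|$ denote the Riemannian metric of $S$ and its norm, $D_t$ denotes the covariant derivative (Levi-Civita connection) along $\gamma$, and $J$ is the rotation by $+\pi/2$ in each tangent plane with respect to the orientation of $S$. In the equation of motion, $K$ is evaluated at $\gamma(t)$. Since $u$ is a unit field, $D_tu=\omega_aJu$ and $\omega_a^2=|D_tu|^2$; $\omega_a$ is the axial component of the angular velocity of the disk, and $L=I_a\omega_a$ is its axial angular momentum. The constants $m>0$ and $I_a>0$ are the mass and the moment of inertia of the disk about its axis. There are no external forces: the motions of the system are the critical points $(\gamma,u)$ of the action $$\mathcal S(\gamma,u)=\frac12\int_a^b\left(m|\dot\gamma|^2+I_a|D_tu|^2\right)dt$$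 with respect to smooth variations $(\gamma_s,u_s)$ through curves in the unit tangent bundle with fixed endpoints, i.e. the solutions of the Euler–Lagrange equations of $E$. *)

theory Defs
  imports "HOL-Analysis.Analysis"
begin

section \<open>Smooth maps between normed spaces\<close>

text \<open>Meant for open \<open>X\<close>: all iterated directional derivatives exist and are continuous,
  which on an open subset of a Euclidean space is the same as being of class $C^\infty$.\<close>

primrec higher_differentiable_on ::
  "'a::real_normed_vector set \<Rightarrow> ('a \<Rightarrow> 'b::real_normed_vector) \<Rightarrow> nat \<Rightarrow> bool" where
  "higher_differentiable_on X f 0 \<longleftrightarrow> continuous_on X f"
| "higher_differentiable_on X f (Suc n) \<longleftrightarrow>
     (\<forall>x\<in>X. f differentiable (at x)) \<and>
     (\<forall>v. higher_differentiable_on X (\<lambda>x. frechet_derivative f (at x) v) n)"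

definition smooth_on :: "'a::real_normed_vector set \<Rightarrow> ('a \<Rightarrow> 'b::real_normed_vector) \<Rightarrow> bool" where
  "smooth_on X f \<longleftrightarrow> (\<forall>n. higher_differentiable_on X f n)"


section \<open>Oriented Riemannian surfaces\<close>

text \<open>A surface is given by a topology on its set of points and an atlas indexed by \<open>charts\<close>.
  Only the values of \<open>chart_map S i\<close> on \<open>chart_dom S i\<close> matter. The matrix
  \<open>metric S i x\<close>, for \<open>x\<close> in the image of the chart \<open>i\<close>, is the Gram matrix of the two
  coordinate vector fields of that chart at the point with coordinates \<open>x\<close>.\<close>

record ('p, 'i) surface =
  points :: "'p topology"
  charts :: "'i set"
  chart_dom :: "'i \<Rightarrow> 'p set"
  chart_map :: "'i \<Rightarrow> 'p \<Rightarrow> real^2"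
  metric :: "'i \<Rightarrow> real^2 \<Rightarrow> real^2^2"

definition charts_at :: "('p, 'i) surface \<Rightarrow> 'p \<Rightarrow> 'i set" where
  "charts_at S p = {i \<in> charts S. p \<in> chart_dom S i}"

definition chart_image :: "('p, 'i) surface \<Rightarrow> 'i \<Rightarrow> (real^2) set" where
  "chart_image S i = chart_map S i ` chart_dom S i"

definition transition :: "('p, 'i) surface \<Rightarrow> 'i \<Rightarrow> 'i \<Rightarrow> real^2 \<Rightarrow> real^2" where
  "transition S i j = chart_map S j \<circ> inv_into (chart_dom S i) (chart_map S i)"

definition second_countable_space :: "'p topology \<Rightarrow> bool" where
  "second_countable_space X \<longleftrightarrow>
     (\<exists>\<B>. countable \<B> \<and> (\<forall>B\<in>\<B>. openin X B) \<and>
          (\<forall>U. openin X U \<longrightarrow> (\<exists>\<D>\<subseteq>\<B>. U = \<Union>\<D>)))"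

definition smooth_oriented_surface :: "('p, 'i) surface \<Rightarrow> bool" where
  "smooth_oriented_surface S \<longleftrightarrow>
     Hausdorff_space (points S) \<and> second_countable_space (points S) \<and>
     topspace (points S) = (\<Union>i\<in>charts S. chart_dom S i) \<and>
     (\<forall>i\<in>charts S. openin (points S) (chart_dom S i) \<and> open (chart_image S i) \<and>
        homeomorphic_map (subtopology (points S) (chart_dom S i))
          (top_of_set (chart_image S i)) (chart_map S i)) \<and>
     (\<forall>i\<in>charts S. \<forall>j\<in>charts S.
        smooth_on (chart_map S i ` (chart_dom S i \<inter> chart_dom S j)) (transition S i j) \<and>
        (\<forall>x\<in>chart_map S i ` (chart_dom S i \<inter> chart_dom S j).
           0 < det (matrix (frechet_derivative (transition S i j) (at x)))))"

definition riemannian_metric :: "('p, 'i) surface \<Rightarrow> bool" where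
  "riemannian_metric S \<longleftrightarrow>
     (\<forall>i\<in>charts S. smooth_on (chart_image S i) (metric S i) \<and>
        (\<forall>x\<in>chart_image S i. transpose (metric S i x) = metric S i x \<and>
           (\<forall>v. v \<noteq> 0 \<longrightarrow> 0 < v \<bullet> (metric S i x *v v)))) \<and>
     (\<forall>i\<in>charts S. \<forall>j\<in>charts S.
        \<forall>x\<in>chart_map S i ` (chart_dom S i \<inter> chart_dom S j).
          (let D = matrix (frechet_derivative (transition S i j) (at x)) in
             metric S i x = transpose D ** metric S j (transition S i j x) ** D))"

definition oriented_riemannian_surface :: "('p, 'i) surface \<Rightarrow> bool" where
  "oriented_riemannian_surface S \<longleftrightarrow> smooth_oriented_surface S \<and> riemannian_metric S"


section \<open>Tangent vectors\<close>

text \<open>A tangent vector at \<open>p\<close> is the family of its component vectors with respect to all charts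
  at \<open>p\<close>, related by the Jacobians of the transition maps. The value \<open>0\<close> at the remaining
  indices makes equality of tangent vectors plain equality of functions.\<close>

type_synonym 'i tangent_vector = "'i \<Rightarrow> real^2"

definition tangent_space :: "('p, 'i) surface \<Rightarrow> 'p \<Rightarrow> 'i tangent_vector set" where
  "tangent_space S p =
     {v. (\<forall>i. i \<notin> charts_at S p \<longrightarrow> v i = 0) \<and>
         (\<forall>i\<in>charts_at S p. \<forall>j\<in>charts_at S p.
            v j = frechet_derivative (transition S i j) (at (chart_map S i p)) (v i))}"

definition tangent_scale :: "real \<Rightarrow> 'i tangent_vector \<Rightarrow> 'i tangent_vector" where
  "tangent_scale c v = (\<lambda>i. c *\<^sub>R v i)"

text \<open>Scalar quantities that do not depend on the chart are computed in a chosen one.\<close>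

definition some_chart :: "('p, 'i) surface \<Rightarrow> 'p \<Rightarrow> 'i" where
  "some_chart S p = (SOME i. i \<in> charts_at S p)"

definition riem_inner ::
  "('p, 'i) surface \<Rightarrow> 'p \<Rightarrow> 'i tangent_vector \<Rightarrow> 'i tangent_vector \<Rightarrow> real" where
  "riem_inner S p v w =
     (let i = some_chart S p in v i \<bullet> (metric S i (chart_map S i p) *v w i))"

definition riem_norm :: "('p, 'i) surface \<Rightarrow> 'p \<Rightarrow> 'i tangent_vector \<Rightarrow> real" where
  "riem_norm S p v = sqrt (riem_inner S p v v)"

definition unit_tangent_space :: "('p, 'i) surface \<Rightarrow> 'p \<Rightarrow> 'i tangent_vector set" where
  "unit_tangent_space S p = {v \<in> tangent_space S p. riem_norm S p v = 1}"

text \<open>In a positively oriented chart with Gram matrix \<open>G\<close>, the vector \<open>J v\<close> is the unique \<open>w\<close> with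
  \<open>w \<bullet> G v = 0\<close> and \<open>w \<bullet> G w = v \<bullet> G v\<close> for which \<open>(v, w)\<close> is positively oriented
  (unless \<open>v = 0\<close>); see the lemmas \<open>rot_coords_orthogonal\<close>, \<open>rot_coords_isometric\<close> and
  \<open>rot_coords_oriented\<close> below.\<close>

definition rot_coords :: "real^2^2 \<Rightarrow> real^2 \<Rightarrow> real^2" where
  "rot_coords G v = (1 / sqrt (det G)) *\<^sub>R vector [- ((G *v v) $ 2), (G *v v) $ 1]"

definition rotation :: "('p, 'i) surface \<Rightarrow> 'p \<Rightarrow> 'i tangent_vector \<Rightarrow> 'i tangent_vector" where
  "rotation S p v =
     (\<lambda>i. if i \<in> charts_at S p then rot_coords (metric S i (chart_map S i p)) (v i) else 0)"


section \<open>Levi-Civita connection and Gaussian curvature\<close>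

definition partial_deriv :: "2 \<Rightarrow> (real^2 \<Rightarrow> real) \<Rightarrow> real^2 \<Rightarrow> real" where
  "partial_deriv a f x = frechet_derivative f (at x) (axis a 1)"

text \<open>\<open>christoffel G k a b\<close> is
  $\Gamma^k_{ab} = \frac12 G^{kl}(\partial_a G_{bl} + \partial_b G_{al} - \partial_l G_{ab})$.\<close>

definition christoffel :: "(real^2 \<Rightarrow> real^2^2) \<Rightarrow> 2 \<Rightarrow> 2 \<Rightarrow> 2 \<Rightarrow> real^2 \<Rightarrow> real" where
  "christoffel G k a b x =
     (\<Sum>l\<in>UNIV. matrix_inv (G x) $ k $ l *
        (partial_deriv a (\<lambda>y. G y $ b $ l) x + partial_deriv b (\<lambda>y. G y $ a $ l) x
         - partial_deriv l (\<lambda>y. G y $ a $ b) x)) / 2"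

text \<open>\<open>riemann G l a b c\<close> is the \<open>l\<close>-th component of $R(\partial_a,\partial_b)\partial_c$, where
  $R(X,Y) = \nabla_X\nabla_Y - \nabla_Y\nabla_X - \nabla_{[X,Y]}$, and the Gaussian curvature is
  $\langle R(\partial_1,\partial_2)\partial_2,\partial_1\rangle / \det G$.\<close>

definition riemann :: "(real^2 \<Rightarrow> real^2^2) \<Rightarrow> 2 \<Rightarrow> 2 \<Rightarrow> 2 \<Rightarrow> 2 \<Rightarrow> real^2 \<Rightarrow> real" where
  "riemann G l a b c x =
     partial_deriv a (christoffel G l b c) x - partial_deriv b (christoffel G l a c) x
     + (\<Sum>e\<in>UNIV. christoffel G l a e x * christoffel G e b c x
                  - christoffel G l b e x * christoffel G e a c x)"

definition gauss_curvature_coords :: "(real^2 \<Rightarrow> real^2^2) \<Rightarrow> real^2 \<Rightarrow> real" where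
  "gauss_curvature_coords G x =
     (\<Sum>l\<in>UNIV. G x $ 1 $ l * riemann G l 1 2 2 x) / det (G x)"

definition gauss_curvature :: "('p, 'i) surface \<Rightarrow> 'p \<Rightarrow> real" where
  "gauss_curvature S p =
     (let i = some_chart S p in gauss_curvature_coords (metric S i) (chart_map S i p))"

definition velocity :: "('p, 'i) surface \<Rightarrow> (real \<Rightarrow> 'p) \<Rightarrow> real \<Rightarrow> 'i tangent_vector" where
  "velocity S \<gamma> t =
     (\<lambda>i. if i \<in> charts_at S (\<gamma> t)
          then vector_derivative (\<lambda>\<tau>. chart_map S i (\<gamma> \<tau>)) (at t) else 0)"

text \<open>The covariant derivative along \<open>\<gamma>\<close> of a field \<open>v\<close> of tangent vectors along \<open>\<gamma>\<close>; its
  components are $\dot v^k + \Gamma^k_{ab}\,\dot\gamma^a v^b$.\<close>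

definition cov_deriv ::
  "('p, 'i) surface \<Rightarrow> (real \<Rightarrow> 'p) \<Rightarrow> (real \<Rightarrow> 'i tangent_vector) \<Rightarrow> real \<Rightarrow> 'i tangent_vector" where
  "cov_deriv S \<gamma> v t =
     (\<lambda>i. if i \<in> charts_at S (\<gamma> t)
          then vector_derivative (\<lambda>\<tau>. v \<tau> i) (at t)
               + (\<chi> k. \<Sum>a\<in>UNIV. \<Sum>b\<in>UNIV.
                    christoffel (metric S i) k a b (chart_map S i (\<gamma> t))
                    * velocity S \<gamma> t i $ a * v t i $ b)
          else 0)"


section \<open>The spinning disk\<close>

text \<open>Smooth maps \<open>(f, u)\<close> from an open set \<open>\<Omega>\<close> of a normed space into the unit tangent bundle.\<close>

definition smooth_unit_tangent_map ::
  "('p, 'i) surface \<Rightarrow> 'e::real_normed_vector set \<Rightarrow> ('e \<Rightarrow> 'p) \<Rightarrow> ('e \<Rightarrow> 'i tangent_vector) \<Rightarrow> bool"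
  where
  "smooth_unit_tangent_map S \<Omega> f u \<longleftrightarrow>
     open \<Omega> \<and> continuous_map (top_of_set \<Omega>) (points S) f \<and>
     (\<forall>x\<in>\<Omega>. u x \<in> unit_tangent_space S (f x)) \<and>
     (\<forall>i\<in>charts S. smooth_on (\<Omega> \<inter> f -` chart_dom S i) (\<lambda>x. chart_map S i (f x)) \<and>
                     smooth_on (\<Omega> \<inter> f -` chart_dom S i) (\<lambda>x. u x i))"

text \<open>Smoothness on a compact interval means smoothness on an open neighbourhood of it.\<close>

definition unit_tangent_curve ::
  "('p, 'i) surface \<Rightarrow> real \<Rightarrow> real \<Rightarrow> (real \<Rightarrow> 'p) \<Rightarrow> (real \<Rightarrow> 'i tangent_vector) \<Rightarrow> bool" where
  "unit_tangent_curve S a b \<gamma> u \<longleftrightarrow>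
     (\<exists>\<epsilon>>0. smooth_unit_tangent_map S {a - \<epsilon><..<b + \<epsilon>} \<gamma> u)"

definition axial_velocity ::
  "('p, 'i) surface \<Rightarrow> (real \<Rightarrow> 'p) \<Rightarrow> (real \<Rightarrow> 'i tangent_vector) \<Rightarrow> real \<Rightarrow> real" where
  "axial_velocity S \<gamma> u t = riem_inner S (\<gamma> t) (cov_deriv S \<gamma> u t) (rotation S (\<gamma> t) (u t))"

definition kinetic_energy ::
  "('p, 'i) surface \<Rightarrow> real \<Rightarrow> real \<Rightarrow> (real \<Rightarrow> 'p) \<Rightarrow> (real \<Rightarrow> 'i tangent_vector) \<Rightarrow> real \<Rightarrow> real" where
  "kinetic_energy S m I\<^sub>a \<gamma> u t =
     1/2 * m * (riem_norm S (\<gamma> t) (velocity S \<gamma> t))\<^sup>2 + 1/2 * I\<^sub>a * (axial_velocity S \<gamma> u t)\<^sup>2"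

text \<open>For curves in the unit tangent bundle \<open>axial_velocity\<close> squared is the squared norm of
  \<open>cov_deriv S \<gamma> u\<close>; see \<open>action_eq\<close> below.\<close>

definition action ::
  "('p, 'i) surface \<Rightarrow> real \<Rightarrow> real \<Rightarrow> real \<Rightarrow> real \<Rightarrow>
   (real \<Rightarrow> 'p) \<Rightarrow> (real \<Rightarrow> 'i tangent_vector) \<Rightarrow> real" where
  "action S m I\<^sub>a a b \<gamma> u = integral {a..b} (kinetic_energy S m I\<^sub>a \<gamma> u)"

definition variation ::
  "('p, 'i) surface \<Rightarrow> real \<Rightarrow> real \<Rightarrow> (real \<Rightarrow> 'p) \<Rightarrow> (real \<Rightarrow> 'i tangent_vector) \<Rightarrow>
   (real \<Rightarrow> real \<Rightarrow> 'p) \<Rightarrow> (real \<Rightarrow> real \<Rightarrow> 'i tangent_vector) \<Rightarrow> bool" where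
  "variation S a b \<gamma> u \<Gamma> U \<longleftrightarrow>
     (\<exists>\<epsilon>>0.
        smooth_unit_tangent_map S ({-\<epsilon><..<\<epsilon>} \<times> {a - \<epsilon><..<b + \<epsilon>})
          (\<lambda>(s, t). \<Gamma> s t) (\<lambda>(s, t). U s t) \<and>
        (\<forall>t\<in>{a..b}. \<Gamma> 0 t = \<gamma> t \<and> U 0 t = u t) \<and>
        (\<forall>s\<in>{-\<epsilon><..<\<epsilon>}. \<Gamma> s a = \<gamma> a \<and> U s a = u a \<and> \<Gamma> s b = \<gamma> b \<and> U s b = u b))"

definition motion ::
  "('p, 'i) surface \<Rightarrow> real \<Rightarrow> real \<Rightarrow> real \<Rightarrow> real \<Rightarrow>
   (real \<Rightarrow> 'p) \<Rightarrow> (real \<Rightarrow> 'i tangent_vector) \<Rightarrow> bool" where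
  "motion S m I\<^sub>a a b \<gamma> u \<longleftrightarrow>
     unit_tangent_curve S a b \<gamma> u \<and>
     (\<forall>\<Gamma> U. variation S a b \<gamma> u \<Gamma> U \<longrightarrow>
        ((\<lambda>s. action S m I\<^sub>a a b (\<Gamma> s) (U s)) has_real_derivative 0) (at 0))"


section \<open>Basic checks\<close>

lemma matrix_vector_2:
  fixes G :: "real^2^2"
  shows "(G *v v) $ 1 = G $ 1 $ 1 * v $ 1 + G $ 1 $ 2 * v $ 2"
    and "(G *v v) $ 2 = G $ 2 $ 1 * v $ 1 + G $ 2 $ 2 * v $ 2"
  by (simp_all add: matrix_vector_mult_def sum_2)

lemma inner_2: "(v::real^2) \<bullet> w = v $ 1 * w $ 1 + v $ 2 * w $ 2"
  by (simp add: inner_vec_def sum_2)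

lemma transpose_sym:
  assumes "transpose (G::real^2^2) = G"
  shows "G $ 2 $ 1 = G $ 1 $ 2"
  using arg_cong[OF assms, of "\<lambda>G. G $ 1 $ 2"] unfolding transpose_def by simp

lemma pos_def_det:
  fixes G :: "real^2^2"
  assumes "transpose G = G" and "\<And>v. v \<noteq> 0 \<Longrightarrow> 0 < v \<bullet> (G *v v)"
  shows "0 < det G"
proof -
  note s = transpose_sym[OF assms(1)]
  define x where "x = (vector [1, 0] :: real^2)"
  have "x \<noteq> 0" by (metis x_def vector_2(1) zero_index zero_neq_one)
  from assms(2)[OF this] have p: "0 < G $ 1 $ 1"
    unfolding inner_2 matrix_vector_2 x_def vector_2 by simp
  define y where "y = (vector [- G $ 1 $ 2, G $ 1 $ 1] :: real^2)"
  have "y \<noteq> 0" using p by (metis y_def vector_2(2) zero_index less_irrefl)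
  from assms(2)[OF this] have "0 < G $ 1 $ 1 * (G $ 1 $ 1 * G $ 2 $ 2 - G $ 1 $ 2 * G $ 1 $ 2)"
    unfolding inner_2 matrix_vector_2 y_def vector_2 s by (simp add: algebra_simps)
  with p have "0 < G $ 1 $ 1 * G $ 2 $ 2 - G $ 1 $ 2 * G $ 1 $ 2"
    by (rule_tac zero_less_mult_pos)
  then show ?thesis unfolding det_2 s .
qed

lemma rot_coords_nth:
  "rot_coords G v $ 1 = - (G *v v) $ 2 / sqrt (det G)"
  "rot_coords G v $ 2 = (G *v v) $ 1 / sqrt (det G)"
  by (simp_all add: rot_coords_def)

lemma rot_coords_orthogonal: "rot_coords G v \<bullet> (G *v v) = 0"
  by (simp add: inner_2 rot_coords_nth)

lemma rot_coords_scaled: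
  assumes "0 < det G"
  shows "sqrt (det G) * rot_coords G v $ 1 = - (G *v v) $ 2"
    and "sqrt (det G) * rot_coords G v $ 2 = (G *v v) $ 1"
  using assms by (simp_all add: rot_coords_nth)

lemma rot_coords_inner:
  assumes "transpose G = G" "0 < det G"
  shows "w \<bullet> (G *v rot_coords G v) = sqrt (det G) * (v $ 1 * w $ 2 - v $ 2 * w $ 1)"
proof -
  note s = transpose_sym[OF assms(1)]
  define r where "r = sqrt (det G)"
  have r: "r \<noteq> 0" "r * r = det G" using assms(2) by (auto simp: r_def)
  have "r * (w \<bullet> (G *v rot_coords G v)) =
      (G *v w) $ 1 * (r * rot_coords G v $ 1) + (G *v w) $ 2 * (r * rot_coords G v $ 2)"
    by (simp add: inner_2 matrix_vector_2 s algebra_simps)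
  also have "\<dots> = det G * (v $ 1 * w $ 2 - v $ 2 * w $ 1)"
    unfolding r_def rot_coords_scaled[OF assms(2)]
    by (simp add: matrix_vector_2 s det_2 algebra_simps)
  also have "\<dots> = r * (r * (v $ 1 * w $ 2 - v $ 2 * w $ 1))"
    by (simp add: r(2)[symmetric])
  finally show ?thesis using r by (simp add: r_def)
qed

lemma rot_coords_pythagoras:
  assumes "transpose G = G" "0 < det G"
  shows "(w \<bullet> (G *v v))\<^sup>2 + (w \<bullet> (G *v rot_coords G v))\<^sup>2 = (w \<bullet> (G *v w)) * (v \<bullet> (G *v v))"
proof -
  note s = transpose_sym[OF assms(1)]
  have "(w \<bullet> (G *v rot_coords G v))\<^sup>2 = det G * (v $ 1 * w $ 2 - v $ 2 * w $ 1)\<^sup>2"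
    using assms(2) by (simp add: rot_coords_inner[OF assms] power_mult_distrib)
  then show ?thesis
    by (simp add: inner_2 matrix_vector_2 s det_2 power2_eq_square algebra_simps)
qed

lemma rot_coords_isometric:
  assumes "transpose G = G" "0 < det G"
  shows "rot_coords G v \<bullet> (G *v rot_coords G v) = v \<bullet> (G *v v)"
proof -
  have "rot_coords G v \<bullet> (G *v rot_coords G v) =
      v $ 1 * (sqrt (det G) * rot_coords G v $ 2) - v $ 2 * (sqrt (det G) * rot_coords G v $ 1)"
    by (simp add: rot_coords_inner[OF assms] algebra_simps)
  also have "\<dots> = v \<bullet> (G *v v)"
    unfolding rot_coords_scaled[OF assms(2)] by (simp add: inner_2)
  finally show ?thesis .
qed

lemma rot_coords_oriented:
  "v $ 1 * rot_coords G v $ 2 - v $ 2 * rot_coords G v $ 1 = (v \<bullet> (G *v v)) / sqrt (det G)"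
  by (simp add: rot_coords_nth inner_2 add_divide_distrib)

lemma some_chart_in: "i \<in> charts_at S p \<Longrightarrow> some_chart S p \<in> charts_at S p"
  unfolding some_chart_def by (rule someI)

lemma smooth_on_differentiable: "smooth_on X f \<Longrightarrow> x \<in> X \<Longrightarrow> f differentiable (at x)"
  unfolding smooth_on_def by (metis higher_differentiable_on.simps(2))

lemma riem_inner_chart:
  assumes S: "oriented_riemannian_surface S" and i: "i \<in> charts_at S p"
    and v: "v \<in> tangent_space S p" and w: "w \<in> tangent_space S p"
  shows "riem_inner S p v w = v i \<bullet> (metric S i (chart_map S i p) *v w i)"
proof -
  define j where "j = some_chart S p"
  have j: "j \<in> charts_at S p" using i by (simp add: j_def some_chart_in)
  define x where "x = chart_map S i p"
  define D where "D = matrix (frechet_derivative (transition S i j) (at x))"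
  have x: "x \<in> chart_map S i ` (chart_dom S i \<inter> chart_dom S j)"
    using i j by (auto simp: x_def charts_at_def)
  have ij: "i \<in> charts S" "j \<in> charts S" using i j by (auto simp: charts_at_def)
  have sm: "smooth_on (chart_map S i ` (chart_dom S i \<inter> chart_dom S j)) (transition S i j)"
    using S ij by (auto simp: oriented_riemannian_surface_def smooth_oriented_surface_def)
  have lin: "linear (frechet_derivative (transition S i j) (at x))"
    using smooth_on_differentiable[OF sm x] by (rule linear_frechet_derivative)
  have D: "frechet_derivative (transition S i j) (at x) y = D *v y" for y
    unfolding D_def using lin by (simp add: matrix_works)
  have "homeomorphic_map (subtopology (points S) (chart_dom S i))
          (top_of_set (chart_image S i)) (chart_map S i)"
    and "openin (points S) (chart_dom S i)"
    using S ij by (auto simp: oriented_riemannian_surface_def smooth_oriented_surface_def)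
  then have "inj_on (chart_map S i) (chart_dom S i)"
    using homeomorphic_imp_injective_map openin_subset topspace_subtopology_subset by fastforce
  then have tr: "transition S i j x = chart_map S j p"
    using i by (simp add: transition_def x_def charts_at_def)
  have G: "metric S i x = transpose D ** metric S j (transition S i j x) ** D"
  proof -
    have "\<forall>i\<in>charts S. \<forall>j\<in>charts S. \<forall>x\<in>chart_map S i ` (chart_dom S i \<inter> chart_dom S j).
        (let D = matrix (frechet_derivative (transition S i j) (at x)) in
             metric S i x = transpose D ** metric S j (transition S i j x) ** D)"
      using S unfolding oriented_riemannian_surface_def riemannian_metric_def by (elim conjE)
    from this[rule_format, OF ij x] show ?thesis unfolding Let_def D_def .
  qed
  have "y j = D *v y i" if "y \<in> tangent_space S p" for y
  proof -
    have "\<forall>i\<in>charts_at S p. \<forall>j\<in>charts_at S p.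
        y j = frechet_derivative (transition S i j) (at (chart_map S i p)) (y i)"
      using that unfolding tangent_space_def mem_Collect_eq by (rule conjunct2)
    from this[rule_format, OF i j] show ?thesis unfolding D[symmetric] x_def .
  qed
  note vj = this[OF v] this[OF w]
  have "riem_inner S p v w = (D *v v i) \<bullet> (metric S j (transition S i j x) *v (D *v w i))"
    unfolding riem_inner_def Let_def j_def[symmetric] vj tr ..
  also have "\<dots> = v i \<bullet> (transpose D *v (metric S j (transition S i j x) *v (D *v w i)))"
    unfolding transpose_matrix_vector inner_commute[of "v i"] dot_lmul_matrix by (rule inner_commute)
  also have "\<dots> = v i \<bullet> (metric S i x *v w i)"
    unfolding G by (simp only: matrix_vector_mul_assoc matrix_mul_assoc)
  finally show ?thesis unfolding x_def .
qed

lemma christoffel_lower: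
  assumes "invertible (G x)"
  shows "(\<Sum>k\<in>UNIV. G x $ d $ k * christoffel G k a b x) =
    (partial_deriv a (\<lambda>y. G y $ b $ d) x + partial_deriv b (\<lambda>y. G y $ a $ d) x
         - partial_deriv d (\<lambda>y. G y $ a $ b) x) / 2"
proof -
  define T where "T = (\<chi> l. partial_deriv a (\<lambda>y. G y $ b $ l) x + partial_deriv b (\<lambda>y. G y $ a $ l) x
         - partial_deriv l (\<lambda>y. G y $ a $ b) x)"
  have c: "christoffel G k a b x = (matrix_inv (G x) *v T) $ k / 2" for k
    by (simp add: christoffel_def T_def matrix_vector_mult_def)
  have "(\<Sum>k\<in>UNIV. G x $ d $ k * christoffel G k a b x) = (G x *v (matrix_inv (G x) *v T)) $ d / 2"
    unfolding c by (simp add: matrix_vector_mult_def sum_2 field_simps)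
  moreover have "G x ** matrix_inv (G x) = mat 1"
    using assms unfolding invertible_def matrix_inv_def by (rule someI2_ex) simp
  then have "G x *v (matrix_inv (G x) *v T) = T" by (simp add: matrix_vector_mul_assoc)
  ultimately show ?thesis by (simp add: T_def)
qed

lemma partial_deriv_chain:
  fixes x :: "real \<Rightarrow> real^2"
  assumes "f differentiable (at (x t))" "(x has_vector_derivative x') (at t)"
  shows "((\<lambda>\<tau>. f (x \<tau>)) has_real_derivative
            partial_deriv 1 f (x t) * x' $ 1 + partial_deriv 2 f (x t) * x' $ 2) (at t)"
proof -
  let ?D = "frechet_derivative f (at (x t))"
  have D: "(f has_derivative ?D) (at (x t))" using assms(1) frechet_derivative_works by blast
  then have lin: "linear ?D" by (rule has_derivative_linear)
  have "x' = x' $ 1 *\<^sub>R axis 1 1 + x' $ 2 *\<^sub>R axis 2 1"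
    by (simp add: vec_eq_iff forall_2 axis_def)
  from arg_cong[OF this, of ?D]
  have "?D x' = x' $ 1 * ?D (axis 1 1) + x' $ 2 * ?D (axis 2 1)"
    by (simp only: linear_add[OF lin] linear_scale[OF lin] real_scaleR_def)
  moreover have "((f \<circ> x) has_vector_derivative ?D x') (at t)"
    unfolding has_vector_derivative_def using diff_chain_at[OF assms(2)[unfolded has_vector_derivative_def] D]
    by (simp add: o_def linear_scale[OF lin])
  ultimately show ?thesis
    by (simp add: has_real_derivative_iff_has_vector_derivative partial_deriv_def o_def mult.commute)
qed


lemma koszul_sum:
  fixes P :: "2 \<Rightarrow> 2 \<Rightarrow> 2 \<Rightarrow> real"
  shows "(\<Sum>d\<in>UNIV. \<Sum>a\<in>UNIV. \<Sum>b\<in>UNIV. y d * x a * y b * ((P a b d + P b a d - P d a b) / 2)) =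
    (\<Sum>a\<in>UNIV. \<Sum>b\<in>UNIV. \<Sum>d\<in>UNIV. P a b d * x a * y b * y d) / 2"
  unfolding sum_2 by (simp add: field_simps)

lemma cov_deriv_unit_orthogonal:
  assumes S: "oriented_riemannian_surface S" and u: "smooth_unit_tangent_map S T \<gamma> u" and t: "t \<in> T"
  shows "riem_inner S (\<gamma> t) (cov_deriv S \<gamma> u t) (u t) = 0"
proof -
  define i where "i = some_chart S (\<gamma> t)"
  have cont: "continuous_map (top_of_set T) (points S) \<gamma>" and T: "open T"
    and un: "\<And>\<tau>. \<tau> \<in> T \<Longrightarrow> u \<tau> \<in> unit_tangent_space S (\<gamma> \<tau>)"
    using u by (auto simp: smooth_unit_tangent_map_def)
  have "\<gamma> t \<in> topspace (points S)" using cont t by (auto simp: continuous_map_def Pi_iff)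
  then have "\<gamma> t \<in> (\<Union>i\<in>charts S. chart_dom S i)"
    using S unfolding oriented_riemannian_surface_def smooth_oriented_surface_def by metis
  then obtain j where "j \<in> charts_at S (\<gamma> t)" by (auto simp: charts_at_def)
  then have i: "i \<in> charts_at S (\<gamma> t)" unfolding i_def by (rule some_chart_in)
  then have ic: "i \<in> charts S" "\<gamma> t \<in> chart_dom S i" by (auto simp: charts_at_def)
  define N where "N = T \<inter> \<gamma> -` chart_dom S i"
  have "openin (points S) (chart_dom S i)"
    using S ic by (auto simp: oriented_riemannian_surface_def smooth_oriented_surface_def)
  then have "openin (top_of_set T) {\<tau> \<in> topspace (top_of_set T). \<gamma> \<tau> \<in> chart_dom S i}"
    using cont by (rule openin_continuous_map_preimage[rotated])
  moreover have "{\<tau> \<in> topspace (top_of_set T). \<gamma> \<tau> \<in> chart_dom S i} = N" by (auto simp: N_def)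
  ultimately have N: "open N" "t \<in> N"
    using T t ic by (auto simp: N_def openin_open_eq)
  define G where "G = metric S i"
  define x where "x = (\<lambda>\<tau>. chart_map S i (\<gamma> \<tau>))"
  define y where "y = (\<lambda>\<tau>. u \<tau> i)"
  have "smooth_on N x" "smooth_on N y"
    using u ic unfolding smooth_unit_tangent_map_def N_def x_def y_def by auto
  then have xy: "(x has_vector_derivative vector_derivative x (at t)) (at t)"
      "(y has_vector_derivative vector_derivative y (at t)) (at t)"
    using N by (auto simp: vector_derivative_works[symmetric] dest: smooth_on_differentiable)
  define x' where "x' = vector_derivative x (at t)"
  define y' where "y' = vector_derivative y (at t)"
  have y': "((\<lambda>\<tau>. y \<tau> $ k) has_real_derivative y' $ k) (at t)" for k
    using bounded_linear.has_vector_derivative[OF bounded_linear_vec_nth xy(2), of k]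
    by (simp add: has_real_derivative_iff_has_vector_derivative y'_def)
  have xi: "x t \<in> chart_image S i" using ic by (auto simp: x_def chart_image_def)
  have met: "smooth_on (chart_image S i) G" "transpose (G (x t)) = G (x t)"
    "\<And>v. v \<noteq> 0 \<Longrightarrow> 0 < v \<bullet> (G (x t) *v v)"
    using S ic xi unfolding oriented_riemannian_surface_def riemannian_metric_def G_def by auto
  note sym = transpose_sym[OF met(2)]
  have "0 < det (G (x t))" using pos_def_det met by blast
  then have inv: "invertible (G (x t))" by (simp add: invertible_det_nz)
  define P where "P = (\<lambda>a b l. partial_deriv a (\<lambda>y. G y $ b $ l) (x t))"
  obtain D where D: "(G has_derivative D) (at (x t))"
    using smooth_on_differentiable[OF met(1) xi] unfolding differentiable_def by blast
  have "(\<lambda>y. G y $ b $ l) differentiable (at (x t))" for b l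
    using bounded_linear.has_derivative[OF bounded_linear_vec_nth
        bounded_linear.has_derivative[OF bounded_linear_vec_nth D]]
    by (rule differentiableI)
  then have g': "((\<lambda>\<tau>. G (x \<tau>) $ b $ l) has_real_derivative P 1 b l * x' $ 1 + P 2 b l * x' $ 2) (at t)"
    for b l unfolding P_def x'_def by (rule partial_deriv_chain[OF _ xy(1)])
  have one: "y \<tau> $ 1 * (G (x \<tau>) $ 1 $ 1 * y \<tau> $ 1) + y \<tau> $ 1 * (G (x \<tau>) $ 1 $ 2 * y \<tau> $ 2)
      + y \<tau> $ 2 * (G (x \<tau>) $ 2 $ 1 * y \<tau> $ 1) + y \<tau> $ 2 * (G (x \<tau>) $ 2 $ 2 * y \<tau> $ 2) = 1"
    if "\<tau> \<in> N" for \<tau>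
  proof -
    have *: "u \<tau> \<in> tangent_space S (\<gamma> \<tau>)" "riem_norm S (\<gamma> \<tau>) (u \<tau>) = 1" "i \<in> charts_at S (\<gamma> \<tau>)"
      using un that ic by (auto simp: N_def unit_tangent_space_def charts_at_def)
    then have "riem_inner S (\<gamma> \<tau>) (u \<tau>) (u \<tau>) = 1" by (simp add: riem_norm_def)
    then have "y \<tau> \<bullet> (G (x \<tau>) *v y \<tau>) = 1"
      using riem_inner_chart[OF S *(3) *(1) *(1)] by (simp add: G_def x_def y_def)
    then show ?thesis by (simp add: inner_2 matrix_vector_2 algebra_simps)
  qed
  have const: "((\<lambda>\<tau>. y \<tau> $ 1 * (G (x \<tau>) $ 1 $ 1 * y \<tau> $ 1) + y \<tau> $ 1 * (G (x \<tau>) $ 1 $ 2 * y \<tau> $ 2)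
      + y \<tau> $ 2 * (G (x \<tau>) $ 2 $ 1 * y \<tau> $ 1) + y \<tau> $ 2 * (G (x \<tau>) $ 2 $ 2 * y \<tau> $ 2))
      has_real_derivative 0) (at t)"
  proof (rule has_field_derivative_transform_within_open)
    show "((\<lambda>_. 1) has_real_derivative 0) (at t)" by simp
  qed (use N one in auto)
  have m: "((\<lambda>\<tau>. y \<tau> $ b * (G (x \<tau>) $ b $ l * y \<tau> $ l)) has_real_derivative
      y t $ b * (G (x t) $ b $ l * y' $ l + (P 1 b l * x' $ 1 + P 2 b l * x' $ 2) * y t $ l)
      + y' $ b * (G (x t) $ b $ l * y t $ l)) (at t)" for b l
    by (rule DERIV_mult'[OF y' DERIV_mult'[OF g' y']])
  have z: "2 * (y' \<bullet> (G (x t) *v y t)) +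
      (\<Sum>a\<in>UNIV. \<Sum>b\<in>UNIV. \<Sum>d\<in>UNIV. P a b d * x' $ a * y t $ b * y t $ d) = 0"
    using DERIV_unique[OF DERIV_add[OF DERIV_add[OF DERIV_add[OF m[of 1 1] m[of 1 2]]
          m[of 2 1]] m[of 2 2]] const]
    unfolding inner_2 matrix_vector_2 sum_2 sym by (simp add: algebra_simps)
  define C where "C = (\<lambda>k a b. christoffel G k a b (x t))"
  have E: "(\<Sum>k\<in>UNIV. G (x t) $ d $ k * C k a b) = (P a b d + P b a d - P d a b) / 2" for a b d
    unfolding C_def P_def by (rule christoffel_lower) (rule inv)
  have "cov_deriv S \<gamma> u t i = y' + (\<chi> k. \<Sum>a\<in>UNIV. \<Sum>b\<in>UNIV. C k a b * x' $ a * y t $ b)"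
    using i by (simp add: cov_deriv_def velocity_def C_def G_def x'_def y'_def x_def y_def)
  then have "riem_inner S (\<gamma> t) (cov_deriv S \<gamma> u t) (u t) =
      (y' + (\<chi> k. \<Sum>a\<in>UNIV. \<Sum>b\<in>UNIV. C k a b * x' $ a * y t $ b)) \<bullet> (G (x t) *v y t)"
    by (simp add: riem_inner_def Let_def i_def[symmetric] G_def x_def y_def)
  also have "\<dots> = y' \<bullet> (G (x t) *v y t) +
      (\<Sum>d\<in>UNIV. \<Sum>a\<in>UNIV. \<Sum>b\<in>UNIV. y t $ d * x' $ a * y t $ b * (\<Sum>k\<in>UNIV. G (x t) $ d $ k * C k a b))"
    unfolding inner_add_left unfolding inner_2 matrix_vector_2 sum_2 sym vec_lambda_beta
    by (simp add: algebra_simps)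
  also have "(\<Sum>d\<in>UNIV. \<Sum>a\<in>UNIV. \<Sum>b\<in>UNIV.
        y t $ d * x' $ a * y t $ b * (\<Sum>k\<in>UNIV. G (x t) $ d $ k * C k a b)) =
      (\<Sum>a\<in>UNIV. \<Sum>b\<in>UNIV. \<Sum>d\<in>UNIV. P a b d * x' $ a * y t $ b * y t $ d) / 2"
    unfolding E by (rule koszul_sum)
  finally show ?thesis using z by linarith
qed

lemma axial_velocity_squared:
  assumes S: "oriented_riemannian_surface S" and u: "smooth_unit_tangent_map S T \<gamma> u" and t: "t \<in> T"
  shows "(axial_velocity S \<gamma> u t)\<^sup>2 = (riem_norm S (\<gamma> t) (cov_deriv S \<gamma> u t))\<^sup>2"
proof -
  define i where "i = some_chart S (\<gamma> t)"
  have "continuous_map (top_of_set T) (points S) \<gamma>"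
    using u by (auto simp: smooth_unit_tangent_map_def)
  then have "\<gamma> t \<in> topspace (points S)" using t by (auto simp: continuous_map_def Pi_iff)
  then have "\<gamma> t \<in> (\<Union>i\<in>charts S. chart_dom S i)"
    using S unfolding oriented_riemannian_surface_def smooth_oriented_surface_def by metis
  then obtain j where "j \<in> charts_at S (\<gamma> t)" by (auto simp: charts_at_def)
  then have i: "i \<in> charts_at S (\<gamma> t)" unfolding i_def by (rule some_chart_in)
  define G where "G = metric S i (chart_map S i (\<gamma> t))"
  have met: "transpose G = G" "\<And>v. v \<noteq> 0 \<Longrightarrow> 0 < v \<bullet> (G *v v)"
    using S i unfolding oriented_riemannian_surface_def riemannian_metric_def G_def charts_at_def
      chart_image_def by auto
  have det: "0 < det G" using pos_def_det met by blast
  have R: "riem_inner S (\<gamma> t) v w = v i \<bullet> (G *v w i)" for v w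
    by (simp add: riem_inner_def Let_def i_def[symmetric] G_def)
  define w where "w = cov_deriv S \<gamma> u t i"
  have o: "w \<bullet> (G *v u t i) = 0"
    using cov_deriv_unit_orthogonal[OF assms] by (simp add: R w_def)
  have "riem_norm S (\<gamma> t) (u t) = 1"
    using u t unfolding smooth_unit_tangent_map_def unit_tangent_space_def by blast
  then have one: "u t i \<bullet> (G *v u t i) = 1" by (simp add: riem_norm_def R)
  have pos: "0 \<le> w \<bullet> (G *v w)" using met(2)[of w] by (cases "w = 0") auto
  have ax: "axial_velocity S \<gamma> u t = w \<bullet> (G *v rot_coords G (u t i))"
    unfolding axial_velocity_def R w_def using i by (simp add: rotation_def G_def)
  have "(axial_velocity S \<gamma> u t)\<^sup>2 = w \<bullet> (G *v w)"
    using rot_coords_pythagoras[OF met(1) det, of w "u t i"] unfolding ax o one by simp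
  also have "\<dots> = (riem_norm S (\<gamma> t) (cov_deriv S \<gamma> u t))\<^sup>2"
    unfolding riem_norm_def R w_def[symmetric] using pos by simp
  finally show ?thesis .
qed

lemma action_eq:
  assumes "oriented_riemannian_surface S" and "unit_tangent_curve S a b \<gamma> u"
  shows "action S m I\<^sub>a a b \<gamma> u =
    1/2 * integral {a..b} (\<lambda>t. m * (riem_norm S (\<gamma> t) (velocity S \<gamma> t))\<^sup>2
                              + I\<^sub>a * (riem_norm S (\<gamma> t) (cov_deriv S \<gamma> u t))\<^sup>2)"
proof -
  obtain \<epsilon> where e: "\<epsilon> > 0" "smooth_unit_tangent_map S {a - \<epsilon><..<b + \<epsilon>} \<gamma> u"
    using assms(2) by (auto simp: unit_tangent_curve_def)
  have "kinetic_energy S m I\<^sub>a \<gamma> u t =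
      1/2 * (m * (riem_norm S (\<gamma> t) (velocity S \<gamma> t))\<^sup>2
             + I\<^sub>a * (riem_norm S (\<gamma> t) (cov_deriv S \<gamma> u t))\<^sup>2)" if "t \<in> {a..b}" for t
    using axial_velocity_squared[OF assms(1) e(2), of t] that e(1)
    by (simp add: kinetic_energy_def algebra_simps)
  then have "action S m I\<^sub>a a b \<gamma> u = integral {a..b} (\<lambda>t.
      1/2 * (m * (riem_norm S (\<gamma> t) (velocity S \<gamma> t))\<^sup>2
             + I\<^sub>a * (riem_norm S (\<gamma> t) (cov_deriv S \<gamma> u t))\<^sup>2))"
    unfolding action_def by (rule Henstock_Kurzweil_Integration.integral_cong)
  then show ?thesis by (simp only: integral_mult_right)
qed

end

theory Submission
  imports Defs
begin

text \<open>The disk is a charged particle in a magnetic field. In a chart, let \<open>e\<close> be the unit field in the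
  direction of the second coordinate. Writing \<open>u = cos \<theta> e + sin \<theta> J e\<close>, the axial angular velocity
  becomes $\omega = \dot\theta + \alpha(\dot\gamma)$, where $\alpha = \langle \nabla e, J e\rangle$ is the
  connection form of the frame (\<open>angular_coords_frame\<close>). The Lagrangian
  $\frac12 m|\dot\gamma|^2 + \frac12 I(\dot\theta + \alpha(\dot\gamma))^2$ does not contain \<open>\<theta>\<close>, so its
  conjugate momentum \<open>L = I \<omega>\<close> is conserved (\<open>axial_velocity_stationary\<close>), and the equation for the
  centre is that of a particle of charge \<open>L\<close> with vector potential \<open>\<alpha>\<close>:
  $m\,\langle D_t\dot\gamma, \cdot\rangle = L\,d\alpha(\cdot, \dot\gamma)$. Liouville's formula
  \<open>d\<alpha> = - K dA\<close> (\<open>frame_form_curl\<close>) turns this force into $L K J\dot\gamma$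
  (\<open>equation_of_motion_chart\<close>).

  It suffices to test with variations supported in a single chart: the centre is displaced in the
  coordinates by a bump function times a constant vector, and the direction is turned by a multiple
  of the same bump function. The angle \<open>\<theta>\<close> is never lifted: the direction is recorded by
  its two coefficients in the frame, and the variation rotates this pair. The energy of the varied
  curve can be computed in the chosen chart because the covariant derivative and the
  rotation of tangent vectors are again tangent vectors (\<open>cov_deriv_in\<close>, which rests on
  \<open>cov_coords_transition\<close>, and \<open>rotation_in\<close>). The same fact spreads the resulting equation from the
  components in one chart to an equation between tangent vectors. Continuity supplies the two end
  points of the time interval.\<close>

section \<open>Closure properties of smooth maps\<close>

lemma higher_differentiable_on_cong:
  assumes "open X" "higher_differentiable_on X f n" "\<And>x. x \<in> X \<Longrightarrow> f x = g x"
  shows "higher_differentiable_on X g n"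
  using assms(2,3)
proof (induction n arbitrary: f g)
  case 0
  then show ?case by (simp cong: continuous_on_cong)
next
  case (Suc n)
  have diff: "f differentiable (at x)" if "x \<in> X" for x using Suc.prems(1) that by simp
  have eq: "frechet_derivative f (at x) = frechet_derivative g (at x)" if "x \<in> X" for x
    by (rule frechet_derivative_transform_within_open[OF diff[OF that] assms(1) that Suc.prems(2)])
  have "g differentiable (at x)" if x: "x \<in> X" for x
  proof -
    obtain D where "(f has_derivative D) (at x)" using diff[OF x] by (auto simp: differentiable_def)
    then have "(g has_derivative D) (at x)"
      by (rule has_derivative_transform_within_open[OF _ assms(1) x Suc.prems(2)])
    then show ?thesis by (auto simp: differentiable_def)
  qed
  moreover have "higher_differentiable_on X (\<lambda>x. frechet_derivative g (at x) v) n" for v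
    by (rule Suc.IH[of "\<lambda>x. frechet_derivative f (at x) v"]) (use Suc.prems(1) eq in auto)
  ultimately show ?case by simp
qed

lemma higher_differentiable_on_SucI:
  assumes "open X" "\<And>x. x \<in> X \<Longrightarrow> (f has_derivative f' x) (at x)"
    and "\<And>v. higher_differentiable_on X (\<lambda>x. f' x v) n"
  shows "higher_differentiable_on X f (Suc n)"
proof -
  have "f' x = frechet_derivative f (at x)" if "x \<in> X" for x
    using frechet_derivative_at[OF assms(2)[OF that]] .
  then have "higher_differentiable_on X (\<lambda>x. frechet_derivative f (at x) v) n" for v
    by (intro higher_differentiable_on_cong[OF assms(1) assms(3)[of v]]) simp
  moreover have "f differentiable (at x)" if "x \<in> X" for x
    using assms(2)[OF that] by (auto simp: differentiable_def)
  ultimately show ?thesis by simp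
qed

lemma higher_differentiable_on_SucD:
  assumes "higher_differentiable_on X f (Suc n)"
  shows "x \<in> X \<Longrightarrow> (f has_derivative frechet_derivative f (at x)) (at x)"
    and "higher_differentiable_on X (\<lambda>x. frechet_derivative f (at x) v) n"
  using assms frechet_derivative_works by auto

lemma higher_differentiable_on_Suc_imp:
  "higher_differentiable_on X f (Suc n) \<Longrightarrow> higher_differentiable_on X f n"
proof (induction n arbitrary: f)
  case 0
  then have "\<forall>x\<in>X. isCont f x" by (auto intro: differentiable_imp_continuous_within)
  then show ?case by (simp add: continuous_at_imp_continuous_on)
next
  case (Suc n)
  have "higher_differentiable_on X (\<lambda>x. frechet_derivative f (at x) v) n" for v
    by (rule Suc.IH) (use Suc.prems in simp)
  with Suc.prems show ?case by simp
qed

lemma higher_differentiable_on_subset: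
  "higher_differentiable_on X f n \<Longrightarrow> Y \<subseteq> X \<Longrightarrow> higher_differentiable_on Y f n"
  by (induction n arbitrary: f) (auto intro: continuous_on_subset)

lemma higher_differentiable_on_local:
  "(\<And>x. x \<in> X \<Longrightarrow> \<exists>U. open U \<and> x \<in> U \<and> higher_differentiable_on U f n)
    \<Longrightarrow> higher_differentiable_on X f n"
proof (induction n arbitrary: f)
  case 0
  have "isCont f x" if "x \<in> X" for x
    using 0[OF that] by (auto simp: continuous_on_eq_continuous_at)
  then show ?case by (simp add: continuous_at_imp_continuous_on)
next
  case (Suc n)
  have "f differentiable (at x)" if "x \<in> X" for x
    using Suc.prems[OF that] by auto
  moreover have "higher_differentiable_on X (\<lambda>x. frechet_derivative f (at x) v) n" for v
    by (rule Suc.IH) (use Suc.prems in fastforce)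
  ultimately show ?case by simp
qed

lemma higher_differentiable_on_const: "open X \<Longrightarrow> higher_differentiable_on X (\<lambda>x. c) n"
  by (induction n arbitrary: c) (auto simp: frechet_derivative_const)

lemma higher_differentiable_on_linear:
  assumes "bounded_linear L" "open X" "higher_differentiable_on X f n"
  shows "higher_differentiable_on X (\<lambda>x. L (f x)) n"
  using assms(3)
proof (induction n arbitrary: f)
  case 0
  then show ?case using bounded_linear.continuous_on[OF assms(1)] by simp
next
  case (Suc n)
  show ?case
  proof (rule higher_differentiable_on_SucI[OF assms(2)])
    show "((\<lambda>x. L (f x)) has_derivative (\<lambda>v. L (frechet_derivative f (at x) v))) (at x)"
      if "x \<in> X" for x
      using bounded_linear.has_derivative[OF assms(1)
          higher_differentiable_on_SucD(1)[OF Suc.prems that]] .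
  qed (rule Suc.IH, rule higher_differentiable_on_SucD(2)[OF Suc.prems])
qed

lemma higher_differentiable_on_add:
  assumes "open X" "higher_differentiable_on X f n" "higher_differentiable_on X g n"
  shows "higher_differentiable_on X (\<lambda>x. f x + g x) n"
  using assms(2,3)
proof (induction n arbitrary: f g)
  case 0
  then show ?case by (simp add: continuous_on_add)
next
  case (Suc n)
  show ?case
  proof (rule higher_differentiable_on_SucI[OF assms(1)])
    show "((\<lambda>x. f x + g x) has_derivative
        (\<lambda>v. frechet_derivative f (at x) v + frechet_derivative g (at x) v)) (at x)"
      if "x \<in> X" for x
      by (intro has_derivative_add higher_differentiable_on_SucD(1)[OF Suc.prems(1) that]
          higher_differentiable_on_SucD(1)[OF Suc.prems(2) that])
  qed (rule Suc.IH; rule higher_differentiable_on_SucD(2)[OF Suc.prems(1)]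
       higher_differentiable_on_SucD(2)[OF Suc.prems(2)])
qed

lemma higher_differentiable_on_bilinear:
  assumes "bounded_bilinear B" "open X"
    and "higher_differentiable_on X f n" "higher_differentiable_on X g n"
  shows "higher_differentiable_on X (\<lambda>x. B (f x) (g x)) n"
  using assms(3,4)
proof (induction n arbitrary: f g)
  case 0
  then show ?case by (simp add: bounded_bilinear.continuous_on[OF assms(1)])
next
  case (Suc n)
  show ?case
  proof (rule higher_differentiable_on_SucI[OF assms(2)])
    show "((\<lambda>x. B (f x) (g x)) has_derivative
        (\<lambda>v. B (f x) (frechet_derivative g (at x) v) + B (frechet_derivative f (at x) v) (g x))) (at x)"
      if "x \<in> X" for x
      by (rule bounded_bilinear.FDERIV[OF assms(1)];
          rule higher_differentiable_on_SucD(1)[OF Suc.prems(1) that]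
            higher_differentiable_on_SucD(1)[OF Suc.prems(2) that])
    show "higher_differentiable_on X (\<lambda>x. B (f x) (frechet_derivative g (at x) v)
        + B (frechet_derivative f (at x) v) (g x)) n" for v
      by (intro higher_differentiable_on_add assms(2) Suc.IH higher_differentiable_on_Suc_imp[OF Suc.prems(1)]
          higher_differentiable_on_Suc_imp[OF Suc.prems(2)] higher_differentiable_on_SucD(2)[OF Suc.prems(1)]
          higher_differentiable_on_SucD(2)[OF Suc.prems(2)])
  qed
qed

lemma higher_differentiable_on_sum:
  assumes "open X" "\<And>i. i \<in> I \<Longrightarrow> higher_differentiable_on X (f i) n"
  shows "higher_differentiable_on X (\<lambda>x. \<Sum>i\<in>I. f i x) n"
  using assms(2)
  by (induction I rule: infinite_finite_induct)
     (auto intro!: higher_differentiable_on_const higher_differentiable_on_add assms(1))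

text \<open>The expansion of the inner derivative in a basis turns the chain rule into a finite sum of
  products, to which the induction hypothesis applies.\<close>

lemma higher_differentiable_on_compose:
  fixes f :: "'a::real_normed_vector \<Rightarrow> 'b::euclidean_space"
  assumes "open X" "open Y" "f ` X \<subseteq> Y"
    and "higher_differentiable_on X f n" "higher_differentiable_on Y g n"
  shows "higher_differentiable_on X (\<lambda>x. g (f x)) n"
  using assms(4,5)
proof (induction n arbitrary: g)
  case 0
  then show ?case using continuous_on_compose2[of Y g X f] assms(3) by simp
next
  case (Suc n)
  let ?f' = "\<lambda>x. frechet_derivative f (at x)" and ?g' = "\<lambda>y. frechet_derivative g (at y)"
  have fX: "f x \<in> Y" if "x \<in> X" for x using that assms(3) by blast
  show ?case
  proof (rule higher_differentiable_on_SucI[OF assms(1)])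
    fix x assume x: "x \<in> X"
    have g': "(g has_derivative ?g' (f x)) (at (f x))"
      by (rule higher_differentiable_on_SucD(1)[OF Suc.prems(2) fX[OF x]])
    have "((\<lambda>x. g (f x)) has_derivative (\<lambda>v. ?g' (f x) (?f' x v))) (at x)"
      using diff_chain_at[OF higher_differentiable_on_SucD(1)[OF Suc.prems(1) x] g']
      by (simp add: o_def)
    moreover have "?g' (f x) (?f' x v) = (\<Sum>b\<in>Basis. (?f' x v \<bullet> b) *\<^sub>R ?g' (f x) b)" for v
    proof -
      have lin: "linear (?g' (f x))" using g' by (rule has_derivative_linear)
      have "?g' (f x) (?f' x v) = ?g' (f x) (\<Sum>b\<in>Basis. (?f' x v \<bullet> b) *\<^sub>R b)"
        by (simp add: euclidean_representation)
      then show ?thesis by (simp add: linear_sum[OF lin] linear_scale[OF lin] o_def)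
    qed
    ultimately show "((\<lambda>x. g (f x)) has_derivative
        (\<lambda>v. \<Sum>b\<in>Basis. (?f' x v \<bullet> b) *\<^sub>R ?g' (f x) b)) (at x)" by simp
  next
    fix v
    have 1: "higher_differentiable_on X (\<lambda>x. ?f' x v \<bullet> b) n" for b
      by (rule higher_differentiable_on_linear[OF bounded_linear_inner_left assms(1)
            higher_differentiable_on_SucD(2)[OF Suc.prems(1)]])
    have 2: "higher_differentiable_on X (\<lambda>x. ?g' (f x) b) n" for b
      by (rule Suc.IH[OF higher_differentiable_on_Suc_imp[OF Suc.prems(1)]
            higher_differentiable_on_SucD(2)[OF Suc.prems(2)]])
    show "higher_differentiable_on X (\<lambda>x. \<Sum>b\<in>Basis. (?f' x v \<bullet> b) *\<^sub>R ?g' (f x) b) n"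
      by (intro higher_differentiable_on_sum assms(1)
          higher_differentiable_on_bilinear[OF bounded_bilinear_scaleR assms(1) 1 2])
  qed
qed

lemma smooth_on_cong:
  "open X \<Longrightarrow> smooth_on X f \<Longrightarrow> (\<And>x. x \<in> X \<Longrightarrow> f x = g x) \<Longrightarrow> smooth_on X g"
  unfolding smooth_on_def using higher_differentiable_on_cong by blast

lemma smooth_on_subset: "smooth_on X f \<Longrightarrow> Y \<subseteq> X \<Longrightarrow> smooth_on Y f"
  unfolding smooth_on_def using higher_differentiable_on_subset by blast

lemma smooth_on_local:
  assumes "\<And>x. x \<in> X \<Longrightarrow> \<exists>U. open U \<and> x \<in> U \<and> smooth_on U f"
  shows "smooth_on X f"
  unfolding smooth_on_def
  by (intro allI higher_differentiable_on_local) (use assms in \<open>auto simp: smooth_on_def\<close>)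

lemma smooth_on_const: "open X \<Longrightarrow> smooth_on X (\<lambda>x. c)"
  by (simp add: smooth_on_def higher_differentiable_on_const)

lemma smooth_on_linear:
  "bounded_linear L \<Longrightarrow> open X \<Longrightarrow> smooth_on X f \<Longrightarrow> smooth_on X (\<lambda>x. L (f x))"
  by (simp add: smooth_on_def higher_differentiable_on_linear)

lemma smooth_on_add:
  "open X \<Longrightarrow> smooth_on X f \<Longrightarrow> smooth_on X g \<Longrightarrow> smooth_on X (\<lambda>x. f x + g x)"
  by (simp add: smooth_on_def higher_differentiable_on_add)

lemma smooth_on_sum:
  "open X \<Longrightarrow> (\<And>i. i \<in> I \<Longrightarrow> smooth_on X (f i)) \<Longrightarrow> smooth_on X (\<lambda>x. \<Sum>i\<in>I. f i x)"
  by (simp add: smooth_on_def higher_differentiable_on_sum)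

lemma smooth_on_bilinear:
  "bounded_bilinear B \<Longrightarrow> open X \<Longrightarrow> smooth_on X f \<Longrightarrow> smooth_on X g \<Longrightarrow> smooth_on X (\<lambda>x. B (f x) (g x))"
  by (simp add: smooth_on_def higher_differentiable_on_bilinear)

lemmas smooth_on_mult = smooth_on_bilinear[OF bounded_bilinear_mult]
lemmas smooth_on_scaleR = smooth_on_bilinear[OF bounded_bilinear_scaleR]
lemmas smooth_on_inner = smooth_on_bilinear[OF bounded_bilinear_inner]
lemmas smooth_on_minus = smooth_on_linear[OF bounded_linear_minus[OF bounded_linear_ident]]

lemma smooth_on_diff:
  fixes f g :: "'a::real_normed_vector \<Rightarrow> 'b::real_normed_vector"
  shows "open X \<Longrightarrow> smooth_on X f \<Longrightarrow> smooth_on X g \<Longrightarrow> smooth_on X (\<lambda>x. f x - g x)"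
  using smooth_on_add[of X f "\<lambda>x. - g x"] smooth_on_minus[of X g] by simp

lemma smooth_on_compose:
  fixes f :: "'a::real_normed_vector \<Rightarrow> 'b::euclidean_space"
  shows "open X \<Longrightarrow> open Y \<Longrightarrow> f ` X \<subseteq> Y \<Longrightarrow> smooth_on X f \<Longrightarrow> smooth_on Y g \<Longrightarrow> smooth_on X (\<lambda>x. g (f x))"
  by (simp add: smooth_on_def higher_differentiable_on_compose)

lemma smooth_on_bounded_linear:
  fixes L :: "'a::real_normed_vector \<Rightarrow> 'b::real_normed_vector"
  assumes "bounded_linear L" "open X" shows "smooth_on X L"
  unfolding smooth_on_def
proof
  fix n show "higher_differentiable_on X L n"
  proof (cases n)
    case 0
    then show ?thesis using linear_continuous_on[OF assms(1)] by simp
  next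
    case (Suc m)
    show ?thesis unfolding Suc
      by (rule higher_differentiable_on_SucI[OF assms(2), where f' = "\<lambda>_. L"])
         (auto intro: bounded_linear_imp_has_derivative assms higher_differentiable_on_const)
  qed
qed

lemmas smooth_on_ident = smooth_on_bounded_linear[OF bounded_linear_ident]

lemma smooth_on_continuous: "smooth_on X f \<Longrightarrow> continuous_on X f"
  unfolding smooth_on_def by (metis higher_differentiable_on.simps(1))

lemma smooth_on_has_derivative:
  "smooth_on X f \<Longrightarrow> x \<in> X \<Longrightarrow> (f has_derivative frechet_derivative f (at x)) (at x)"
  using smooth_on_differentiable frechet_derivative_works by blast

lemma smooth_on_frechet_derivative:
  "smooth_on X f \<Longrightarrow> smooth_on X (\<lambda>x. frechet_derivative f (at x) v)"
  unfolding smooth_on_def by (metis higher_differentiable_on.simps(2))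

lemma frechet_derivative_basis_expansion:
  fixes f :: "'a::euclidean_space \<Rightarrow> 'b::real_normed_vector"
  assumes "f differentiable (at x)"
  shows "frechet_derivative f (at x) w = (\<Sum>b\<in>Basis. (w \<bullet> b) *\<^sub>R frechet_derivative f (at x) b)"
proof -
  have lin: "linear (frechet_derivative f (at x))" by (rule linear_frechet_derivative[OF assms])
  have "frechet_derivative f (at x) w = frechet_derivative f (at x) (\<Sum>b\<in>Basis. (w \<bullet> b) *\<^sub>R b)"
    by (simp add: euclidean_representation)
  then show ?thesis by (simp add: linear_sum[OF lin] linear_scale[OF lin])
qed

lemma smooth_on_frechet_derivative_compose:
  fixes f :: "'a::real_normed_vector \<Rightarrow> 'b::euclidean_space" and g :: "'b \<Rightarrow> 'c::real_normed_vector"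
  assumes "open X" "open Y" "f ` X \<subseteq> Y" "smooth_on X f" "smooth_on Y g" "smooth_on X w"
  shows "smooth_on X (\<lambda>x. frechet_derivative g (at (f x)) (w x))"
proof (rule smooth_on_cong[OF assms(1)])
  show "smooth_on X (\<lambda>x. \<Sum>b\<in>Basis. (w x \<bullet> b) *\<^sub>R frechet_derivative g (at (f x)) b)"
    by (intro smooth_on_sum smooth_on_scaleR smooth_on_inner smooth_on_const assms
        smooth_on_compose[OF assms(1-4)] smooth_on_frechet_derivative)
  show "(\<Sum>b\<in>Basis. (w x \<bullet> b) *\<^sub>R frechet_derivative g (at (f x)) b) =
      frechet_derivative g (at (f x)) (w x)" if "x \<in> X" for x
    by (rule frechet_derivative_basis_expansion[symmetric], rule smooth_on_differentiable[OF assms(5)])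
       (use that assms(3) in blast)
qed

lemma smooth_on_nth:
  "open X \<Longrightarrow> smooth_on X f \<Longrightarrow> smooth_on X (\<lambda>x. f x $ k)"
  by (rule smooth_on_linear[OF bounded_linear_vec_nth])

lemma smooth_on_vecI:
  fixes f :: "'a::real_normed_vector \<Rightarrow> real^'n"
  assumes "open X" "\<And>k. smooth_on X (\<lambda>x. f x $ k)"
  shows "smooth_on X f"
proof (rule smooth_on_cong[OF assms(1)])
  show "smooth_on X (\<lambda>x. \<Sum>k\<in>UNIV. (f x $ k) *\<^sub>R axis k 1)"
    by (intro smooth_on_sum smooth_on_scaleR smooth_on_const assms)
qed (simp add: basis_expansion scalar_mult_eq_scaleR[symmetric])

lemma smooth_on_Pair:
  assumes "open X" "smooth_on X f" "smooth_on X g"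
  shows "smooth_on X (\<lambda>x. (f x, g x))"
proof -
  have "smooth_on X (\<lambda>x. (f x, 0) + (0, g x))"
    by (intro smooth_on_add assms
        smooth_on_linear[OF bounded_linear_Pair[OF bounded_linear_ident bounded_linear_zero]]
        smooth_on_linear[OF bounded_linear_Pair[OF bounded_linear_zero bounded_linear_ident]])
  then show ?thesis by simp
qed

text \<open>A self-referential description of the derivative, such as $(1/x)' = -(1/x)^2$, bootstraps
  regularity.\<close>

lemma higher_differentiable_on_realI:
  fixes f :: "real \<Rightarrow> real"
  assumes "open X" "\<And>x. x \<in> X \<Longrightarrow> (f has_real_derivative f' x) (at x)" "higher_differentiable_on X f' n"
  shows "higher_differentiable_on X f (Suc n)"
proof (rule higher_differentiable_on_SucI[OF assms(1)])
  show "(f has_derivative (\<lambda>v. f' x * v)) (at x)" if "x \<in> X" for x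
    using assms(2)[OF that] by (simp add: has_field_derivative_def)
  show "higher_differentiable_on X (\<lambda>x. f' x * v) n" for v
    by (rule higher_differentiable_on_linear[OF bounded_linear_mult_left assms(1,3)])
qed

lemma smooth_on_inverse: "smooth_on {0<..} (inverse :: real \<Rightarrow> real)"
  unfolding smooth_on_def
proof
  fix n show "higher_differentiable_on {0<..} (inverse :: real \<Rightarrow> real) n"
  proof (induction n)
    case 0
    show ?case by (auto intro!: continuous_intros)
  next
    case (Suc n)
    show ?case
    proof (rule higher_differentiable_on_realI)
      show "(inverse has_real_derivative - (inverse x * inverse x)) (at x)" if "x \<in> {0<..}" for x :: real
        using that by (auto intro!: derivative_eq_intros)
      show "higher_differentiable_on {0<..} (\<lambda>x. - (inverse x * inverse x :: real)) n"
        by (intro higher_differentiable_on_linear[OF bounded_linear_minus[OF bounded_linear_ident]]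
            higher_differentiable_on_bilinear[OF bounded_bilinear_mult] Suc.IH) simp_all
    qed simp
  qed
qed

lemma smooth_on_sqrt: "smooth_on {0<..} sqrt"
  unfolding smooth_on_def
proof
  fix n show "higher_differentiable_on {0<..} sqrt n"
  proof (induction n)
    case 0
    show ?case by (auto intro!: continuous_intros)
  next
    case (Suc n)
    have I: "higher_differentiable_on {0<..} (inverse :: real \<Rightarrow> real) n"
      using smooth_on_inverse by (simp add: smooth_on_def)
    show ?case
    proof (rule higher_differentiable_on_realI)
      show "(sqrt has_real_derivative inverse (sqrt x) * (1/2)) (at x)" if "x \<in> {0<..}" for x :: real
        using that DERIV_real_sqrt[of x] by (simp add: mult.commute)
      show "higher_differentiable_on {0<..} (\<lambda>x. inverse (sqrt x) * (1/2)) n"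
        by (intro higher_differentiable_on_linear[OF bounded_linear_mult_left]
            higher_differentiable_on_compose[OF _ _ _ Suc.IH I]) auto
    qed simp
  qed
qed

lemma smooth_on_sin_cos: "smooth_on UNIV (sin :: real \<Rightarrow> real)" "smooth_on UNIV (cos :: real \<Rightarrow> real)"
proof -
  have "higher_differentiable_on UNIV (sin :: real \<Rightarrow> real) n \<and>
      higher_differentiable_on UNIV (cos :: real \<Rightarrow> real) n" for n
  proof (induction n)
    case 0
    show ?case by (auto intro!: continuous_intros)
  next
    case (Suc n)
    have "higher_differentiable_on UNIV (\<lambda>x. - sin x :: real) n"
      using Suc by (intro higher_differentiable_on_linear[OF bounded_linear_minus[OF bounded_linear_ident]]) auto
    then show ?case
      using Suc by (auto intro!: higher_differentiable_on_realI DERIV_sin DERIV_cos simp del: higher_differentiable_on.simps)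
  qed
  then show "smooth_on UNIV (sin :: real \<Rightarrow> real)" "smooth_on UNIV (cos :: real \<Rightarrow> real)"
    by (auto simp: smooth_on_def)
qed

lemma smooth_on_has_vector_derivative:
  assumes "smooth_on N x" "t \<in> N"
  shows "(x has_vector_derivative vector_derivative x (at t)) (at t)"
  using smooth_on_differentiable[OF assms] by (simp add: vector_derivative_works)

lemma smooth_on_vector_derivative:
  assumes "open N" "smooth_on N x"
  shows "smooth_on N (\<lambda>t. vector_derivative x (at t))"
proof (rule smooth_on_cong[OF assms(1) smooth_on_frechet_derivative[OF assms(2), of 1]])
  fix t assume "t \<in> N"
  from smooth_on_has_vector_derivative[OF assms(2) this]
  show "frechet_derivative x (at t) 1 = vector_derivative x (at t)"
    by (metis frechet_derivative_at has_vector_derivative_def scaleR_one)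
qed

section \<open>Mixed derivatives, bump functions and the lemma of du Bois-Reymond\<close>

text \<open>The mean value theorem, applied once in the direction \<open>v\<close> and once in the direction \<open>w\<close>.\<close>

lemma second_difference_mean_value:
  fixes f :: "'a::real_normed_vector \<Rightarrow> real"
  assumes f': "\<And>z. z \<in> ball x r \<Longrightarrow> (f has_derivative f' z) (at z)"
    and f'': "\<And>z. z \<in> ball x r \<Longrightarrow> ((\<lambda>z. f' z v) has_derivative A z) (at z)"
    and h: "0 < h" "h * (norm v + norm w) < r"
  shows "\<exists>z\<in>ball x r. f (x + h *\<^sub>R v + h *\<^sub>R w) - f (x + h *\<^sub>R v) - f (x + h *\<^sub>R w) + f x = h * h * A z w"
proof -
  have ball: "x + s *\<^sub>R v + t *\<^sub>R w \<in> ball x r" if "0 \<le> s" "s \<le> h" "0 \<le> t" "t \<le> h" for s t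
  proof -
    have "norm (s *\<^sub>R v + t *\<^sub>R w) \<le> s * norm v + t * norm w"
      using norm_triangle_ineq[of "s *\<^sub>R v" "t *\<^sub>R w"] that by simp
    also have "\<dots> \<le> h * norm v + h * norm w" using that by (intro add_mono mult_right_mono) auto
    finally have "norm (s *\<^sub>R v + t *\<^sub>R w) < r" using h by (simp add: algebra_simps)
    moreover have "dist x (x + y) = norm y" for y by (simp add: dist_norm)
    ultimately show ?thesis by (simp add: add.assoc)
  qed
  have line: "((\<lambda>s. g (p + s *\<^sub>R e)) has_real_derivative g' e) (at s)"
    if "(g has_derivative g') (at (p + s *\<^sub>R e))" for g :: "'a \<Rightarrow> real" and g' p e s
  proof -
    have "((\<lambda>s. p + s *\<^sub>R e) has_derivative (\<lambda>k. k *\<^sub>R e)) (at s)"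
      by (auto intro!: derivative_eq_intros)
    from diff_chain_at[OF this that]
    have "((\<lambda>s. g (p + s *\<^sub>R e)) has_derivative (\<lambda>k. g' (k *\<^sub>R e))) (at s)" by (simp add: o_def)
    moreover have "(\<lambda>k. g' (k *\<^sub>R e)) = (*) (g' e)"
      using linear_scale[OF has_derivative_linear[OF that]] by (auto simp: fun_eq_iff)
    ultimately show ?thesis by (simp add: has_field_derivative_def)
  qed
  define p where "p = x + h *\<^sub>R w"
  have p: "p + s *\<^sub>R v = x + s *\<^sub>R v + h *\<^sub>R w" for s by (simp add: p_def algebra_simps)
  have "\<exists>s>0. s < h \<and> (f (p + h *\<^sub>R v) - f (x + h *\<^sub>R v)) - (f (p + 0 *\<^sub>R v) - f (x + 0 *\<^sub>R v)) =
      (h - 0) * (f' (p + s *\<^sub>R v) v - f' (x + s *\<^sub>R v) v)"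
  proof (rule MVT2[OF h(1)])
    fix s assume s: "0 \<le> s" "s \<le> h"
    have "x + s *\<^sub>R v \<in> ball x r" using ball[of s 0] s h by simp
    moreover have "p + s *\<^sub>R v \<in> ball x r" unfolding p using ball[of s h] s h by simp
    ultimately show "((\<lambda>s. f (p + s *\<^sub>R v) - f (x + s *\<^sub>R v)) has_real_derivative
        f' (p + s *\<^sub>R v) v - f' (x + s *\<^sub>R v) v) (at s)"
      by (intro DERIV_diff line f')
  qed
  then obtain s where s: "0 < s" "s < h" and s_eq:
    "f (x + h *\<^sub>R v + h *\<^sub>R w) - f (x + h *\<^sub>R v) - f (x + h *\<^sub>R w) + f x =
      h * (f' (x + s *\<^sub>R v + h *\<^sub>R w) v - f' (x + s *\<^sub>R v) v)"
    unfolding p by (auto simp: algebra_simps)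
  have "\<exists>t>0. t < h \<and> f' (x + s *\<^sub>R v + h *\<^sub>R w) v - f' (x + s *\<^sub>R v + 0 *\<^sub>R w) v =
      (h - 0) * A (x + s *\<^sub>R v + t *\<^sub>R w) w"
  proof (rule MVT2[OF h(1)])
    fix t assume "0 \<le> t" "t \<le> h"
    then show "((\<lambda>t. f' (x + s *\<^sub>R v + t *\<^sub>R w) v) has_real_derivative A (x + s *\<^sub>R v + t *\<^sub>R w) w) (at t)"
      using s by (intro line[of "\<lambda>z. f' z v"] f'' ball) auto
  qed
  then obtain t where t: "0 < t" "t < h"
    "f' (x + s *\<^sub>R v + h *\<^sub>R w) v - f' (x + s *\<^sub>R v) v = h * A (x + s *\<^sub>R v + t *\<^sub>R w) w" by auto
  show ?thesis
    by (rule bexI[of _ "x + s *\<^sub>R v + t *\<^sub>R w"]) (use s_eq t s ball[of s t] in auto)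
qed

text \<open>Both iterated derivatives are limits of the same symmetric second difference quotient.\<close>

lemma frechet_derivative_commute_real:
  fixes f :: "'a::real_normed_vector \<Rightarrow> real"
  assumes X: "open X" "x \<in> X" and f: "smooth_on X f"
  shows "frechet_derivative (\<lambda>z. frechet_derivative f (at z) v) (at x) w =
    frechet_derivative (\<lambda>z. frechet_derivative f (at z) w) (at x) v"
proof (rule ccontr)
  define C where "C = (\<lambda>v w z. frechet_derivative (\<lambda>z. frechet_derivative f (at z) v) (at z) w)"
  assume "\<not> ?thesis"
  then have e: "\<bar>C v w x - C w v x\<bar> > 0" (is "?e > 0") by (simp add: C_def)
  have cont: "isCont (C v w) x" for v w
    using smooth_on_continuous[OF smooth_on_frechet_derivative[OF smooth_on_frechet_derivative[OF f]]] X
    unfolding C_def by (auto simp: continuous_on_eq_continuous_at)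
  have near: "\<exists>d>0. \<forall>z\<in>ball x d. \<bar>C v w z - C v w x\<bar> < ?e / 2" for v w
    using cont[of v w] e unfolding continuous_at_eps_delta
    by (metis dist_commute dist_real_def half_gt_zero mem_ball)
  obtain d1 where d1: "d1 > 0" "\<And>z. z \<in> ball x d1 \<Longrightarrow> \<bar>C v w z - C v w x\<bar> < ?e / 2" using near by blast
  obtain d2 where d2: "d2 > 0" "\<And>z. z \<in> ball x d2 \<Longrightarrow> \<bar>C w v z - C w v x\<bar> < ?e / 2" using near by blast
  obtain d3 where d3: "d3 > 0" "ball x d3 \<subseteq> X" using X openE by blast
  define r where "r = min d1 (min d2 d3)"
  have r: "r > 0" "ball x r \<subseteq> X" using d1 d2 d3 by (auto simp: r_def)
  define h where "h = r / (2 * (norm v + norm w + 1))"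
  have n: "norm v + norm w + 1 > 0" by (smt (verit) norm_ge_zero)
  have h: "0 < h" using r n by (simp add: h_def)
  have "h * (norm v + norm w) < h * (2 * (norm v + norm w + 1))"
    using h n by (intro mult_strict_left_mono) (auto intro: order_le_less_trans)
  also have "\<dots> = r" using n by (simp add: h_def)
  finally have h2: "h * (norm v + norm w) < r" .
  then have h2': "h * (norm w + norm v) < r" by (simp add: add.commute)
  have F: "(f has_derivative frechet_derivative f (at z)) (at z)" if "z \<in> ball x r" for z
    using smooth_on_has_derivative[OF f] r that by blast
  have F2: "((\<lambda>z. frechet_derivative f (at z) v) has_derivative (\<lambda>w. C v w z)) (at z)"
    if "z \<in> ball x r" for v z
    using smooth_on_has_derivative[OF smooth_on_frechet_derivative[OF f]] r that unfolding C_def by blast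
  obtain z1 where z1: "z1 \<in> ball x r"
    "f (x + h *\<^sub>R v + h *\<^sub>R w) - f (x + h *\<^sub>R v) - f (x + h *\<^sub>R w) + f x = h * h * C v w z1"
    using second_difference_mean_value[OF F F2 h h2] by blast
  obtain z2 where z2: "z2 \<in> ball x r"
    "f (x + h *\<^sub>R w + h *\<^sub>R v) - f (x + h *\<^sub>R w) - f (x + h *\<^sub>R v) + f x = h * h * C w v z2"
    using second_difference_mean_value[OF F F2 h h2'] by blast
  have "h * h * C v w z1 = h * h * C w v z2"
    using z1(2) z2(2) by (simp add: algebra_simps)
  then have "C v w z1 = C w v z2" using h by simp
  then have "?e \<le> \<bar>C v w z1 - C v w x\<bar> + \<bar>C w v z2 - C w v x\<bar>" by linarith
  then show False
    using d1(2)[of z1] d2(2)[of z2] z1(1) z2(1) by (simp add: r_def field_sum_of_halves)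
qed

text \<open>The family $x^{-k} e^{-1/x}$ (zero for $x \le 0$) is closed under differentiation up to
  linear combinations, so all its members are smooth at once.\<close>

definition flat :: "nat \<Rightarrow> real \<Rightarrow> real" where
  "flat k x = (if x \<le> 0 then 0 else inverse x ^ k * exp (- inverse x))"

lemma flat_over_self_tendsto: "((\<lambda>h. flat k h / h) \<longlongrightarrow> 0) (at 0)"
proof (rule filterlim_split_at)
  have "eventually (\<lambda>h::real. h < 0) (at_left 0)" by (simp add: eventually_at_filter)
  then have "eventually (\<lambda>h. flat k h / h = 0) (at_left 0)"
    by eventually_elim (simp add: flat_def)
  then show "((\<lambda>h. flat k h / h) \<longlongrightarrow> 0) (at_left 0)" by (rule tendsto_eventually)
  have "((\<lambda>h. inverse h ^ Suc k / exp (inverse h)) \<longlongrightarrow> (0::real)) (at_right 0)"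
    by (rule filterlim_compose[OF tendsto_power_div_exp_0 filterlim_inverse_at_top_right])
  moreover have "eventually (\<lambda>h::real. h > 0) (at_right 0)" by (simp add: eventually_at_filter)
  then have "eventually (\<lambda>h. inverse h ^ Suc k / exp (inverse h) = flat k h / h) (at_right 0)"
    by eventually_elim (simp add: flat_def exp_minus field_simps)
  ultimately show "((\<lambda>h. flat k h / h) \<longlongrightarrow> 0) (at_right 0)"
    by (rule Lim_transform_eventually)
qed

lemma flat_has_derivative:
  "(flat k has_real_derivative flat (k + 2) x - real k * flat (k + 1) x) (at x)"
proof -
  consider "x < 0" | "x = 0" | "x > 0" by linarith
  then show ?thesis
  proof cases
    case 1
    have "((\<lambda>_. 0) has_real_derivative 0) (at x)" by simp
    then have "(flat k has_real_derivative 0) (at x)"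
      by (rule has_field_derivative_transform_within_open[where S = "{..<0}"]) (use 1 in \<open>auto simp: flat_def\<close>)
    then show ?thesis using 1 by (simp add: flat_def)
  next
    case 2
    then show ?thesis using flat_over_self_tendsto[of k] by (simp add: DERIV_def flat_def)
  next
    case 3
    have 1: "((\<lambda>x. inverse x ^ k) has_real_derivative - real k * inverse x ^ (k + 1)) (at x)"
      by (rule DERIV_cong[OF DERIV_power[OF DERIV_inverse]], use 3 in simp, cases k) (simp_all add: algebra_simps)
    have 2: "((\<lambda>x. exp (- inverse x)) has_real_derivative exp (- inverse x) * inverse x ^ 2) (at x)"
      using 3 by (auto intro!: derivative_eq_intros simp: power2_eq_square)
    have "((\<lambda>x. inverse x ^ k * exp (- inverse x)) has_real_derivative
        flat (k + 2) x - real k * flat (k + 1) x) (at x)"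
      by (rule DERIV_cong[OF DERIV_mult[OF 1 2]]) (use 3 in \<open>simp add: flat_def power_add power2_eq_square\<close>)
    then show ?thesis
      by (rule has_field_derivative_transform_within_open[where S = "{0<..}"]) (use 3 in \<open>auto simp: flat_def\<close>)
  qed
qed

lemma smooth_on_flat: "smooth_on UNIV (flat k)"
proof -
  have "higher_differentiable_on UNIV (flat k) n" for n
  proof (induction n arbitrary: k)
    case 0
    show ?case using flat_has_derivative DERIV_isCont
      by (simp add: continuous_on_eq_continuous_at) blast
  next
    case (Suc n)
    show ?case
    proof (rule higher_differentiable_on_realI[OF _ flat_has_derivative])
      have "higher_differentiable_on UNIV (\<lambda>x. flat (k + 2) x + - real k * flat (k + 1) x) n"
        by (intro higher_differentiable_on_add
            higher_differentiable_on_linear[OF bounded_linear_mult_right] Suc.IH) simp_all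
      then show "higher_differentiable_on UNIV (\<lambda>x. flat (k + 2) x - real k * flat (k + 1) x) n" by simp
    qed simp
  qed
  then show ?thesis by (simp add: smooth_on_def)
qed

text \<open>The bump is \<open>flat 0\<close> composed with a parabola that is positive exactly on the given interval.\<close>

lemma smooth_bump:
  fixes c r :: real
  assumes "r > 0"
  obtains \<phi> :: "real \<Rightarrow> real" where "smooth_on UNIV \<phi>" "\<And>t. 0 \<le> \<phi> t" "0 < \<phi> c" "\<And>t. t \<notin> {c - r<..<c + r} \<Longrightarrow> \<phi> t = 0"
proof
  define \<phi> where "\<phi> t = flat 0 (r\<^sup>2 - (t - c)\<^sup>2)" for t
  have "smooth_on UNIV (\<lambda>t. r\<^sup>2 - (t - c) * (t - c))"
    by (intro smooth_on_diff smooth_on_mult smooth_on_const smooth_on_ident) auto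
  from smooth_on_compose[OF open_UNIV open_UNIV _ this smooth_on_flat[of 0]]
  show "smooth_on UNIV \<phi>" by (simp add: \<phi>_def[abs_def] power2_eq_square[of "t - c" for t])
  show "0 \<le> \<phi> t" for t by (simp add: \<phi>_def flat_def)
  show "0 < \<phi> c" using assms by (simp add: \<phi>_def flat_def not_le)
  show "\<phi> t = 0" if "t \<notin> {c - r<..<c + r}" for t
  proof -
    have "r \<le> \<bar>t - c\<bar>" using that by auto
    then have "r\<^sup>2 \<le> (t - c)\<^sup>2" using assms by (metis abs_of_pos abs_le_square_iff)
    then show ?thesis by (simp add: \<phi>_def flat_def)
  qed
qed

text \<open>The lemma of du Bois-Reymond. Integration by parts leaves $\int (F_1 - F_2')\,\phi = 0$ for all
  test functions, which a bump around a point with $F_1 \neq F_2'$ contradicts.\<close>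

lemma euler_lagrange_if_weak:
  fixes F1 F2 F2' :: "real \<Rightarrow> real"
  assumes F1: "continuous_on {a<..<b} F1" and F2': "continuous_on {a<..<b} F2'"
    and F2: "\<And>t. t \<in> {a<..<b} \<Longrightarrow> (F2 has_real_derivative F2' t) (at t)"
    and zero: "\<And>(\<phi> :: real \<Rightarrow> real) l r. smooth_on UNIV \<phi> \<Longrightarrow> a < l \<Longrightarrow> l < r \<Longrightarrow> r < b \<Longrightarrow>
      (\<And>\<tau>. \<tau> \<notin> {l<..<r} \<Longrightarrow> \<phi> \<tau> = 0) \<Longrightarrow>
      integral {l..r} (\<lambda>\<tau>. F1 \<tau> * \<phi> \<tau> + F2 \<tau> * vector_derivative \<phi> (at \<tau>)) = 0"
    and t: "t \<in> {a<..<b}"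
  shows "F1 t = F2' t"
proof (rule ccontr)
  define F where "F \<tau> = F1 \<tau> - F2' \<tau>" for \<tau>
  assume "F1 t \<noteq> F2' t"
  then have ne: "F t \<noteq> 0" by (simp add: F_def)
  (* The factor F t makes the value of H at t positive, whatever the sign of F t. *)
  define H where "H \<tau> = F t * F \<tau>" for \<tau>
  have Ht: "H t > 0" using ne by (simp add: H_def power2_eq_square[symmetric])
  have cF: "continuous_on {a<..<b} F" unfolding F_def[abs_def] by (intro continuous_intros F1 F2')
  then have "continuous_on {a<..<b} H" unfolding H_def by (intro continuous_intros)
  then obtain d where d: "d > 0" "\<And>\<tau>. \<tau> \<in> {a<..<b} \<Longrightarrow> dist \<tau> t < d \<Longrightarrow> dist (H \<tau>) (H t) < H t"
    using Ht t unfolding continuous_on_iff by metis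
  define r where "r = min (d / 2) (min ((t - a) / 2) ((b - t) / 2))"
  have r: "r > 0" "r < d" "a < t - r" "t + r < b" using d t by (auto simp: r_def min_def field_simps)
  define I where "I = {t - r..t + r}"
  have I: "I \<subseteq> {a<..<b}" using r by (auto simp: I_def)
  obtain \<phi> :: "real \<Rightarrow> real" where \<phi>: "smooth_on UNIV \<phi>" "\<And>t. 0 \<le> \<phi> t" "0 < \<phi> t"
    "\<And>\<tau>. \<tau> \<notin> {t - r<..<t + r} \<Longrightarrow> \<phi> \<tau> = 0"
    using smooth_bump[OF r(1)] by metis
  let ?\<phi>' = "\<lambda>\<tau>. vector_derivative \<phi> (at \<tau>)"
  have c\<phi>: "continuous_on I \<phi>" "continuous_on I ?\<phi>'"
    using smooth_on_continuous[OF \<phi>(1)] smooth_on_continuous[OF smooth_on_vector_derivative[OF open_UNIV \<phi>(1)]]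
    by (auto intro: continuous_on_subset)
  have cF2: "continuous_on I F2"
    using F2 I DERIV_isCont by (blast intro: continuous_at_imp_continuous_on)
  note c = c\<phi> cF2 continuous_on_subset[OF F1 I] continuous_on_subset[OF F2' I] continuous_on_subset[OF cF I]
  have cH: "continuous_on I (\<lambda>\<tau>. H \<tau> * \<phi> \<tau>)" unfolding H_def by (intro continuous_intros c)
  have pos: "0 \<le> H \<tau> * \<phi> \<tau>" if "\<tau> \<in> I" for \<tau>
  proof -
    have "dist \<tau> t < d" using r that by (auto simp: dist_real_def I_def)
    then have "H \<tau> > 0" using d(2)[of \<tau>] I that by (auto simp: dist_real_def)
    then show ?thesis using \<phi>(2) by simp
  qed
  have "integral I (\<lambda>\<tau>. F1 \<tau> * \<phi> \<tau> + F2 \<tau> * ?\<phi>' \<tau>) = 0"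
    unfolding I_def by (rule zero[OF \<phi>(1) r(3) _ r(4) \<phi>(4)]) (use r in auto)
  moreover have "(\<lambda>\<tau>. F1 \<tau> * \<phi> \<tau> + F2 \<tau> * ?\<phi>' \<tau>) integrable_on I"
    unfolding I_def by (rule integrable_continuous_interval, fold I_def) (intro continuous_intros c)
  ultimately have 1: "((\<lambda>\<tau>. F1 \<tau> * \<phi> \<tau> + F2 \<tau> * ?\<phi>' \<tau>) has_integral 0) I"
    by (metis integrable_integral)
  have "((\<lambda>\<tau>. F2' \<tau> * \<phi> \<tau> + F2 \<tau> * ?\<phi>' \<tau>) has_integral F2 (t + r) * \<phi> (t + r) - F2 (t - r) * \<phi> (t - r)) I"
    unfolding I_def
  proof (rule fundamental_theorem_of_calculus)
    fix \<tau> assume "\<tau> \<in> {t - r..t + r}"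
    then have A: "\<tau> \<in> {a<..<b}" using I by (auto simp: I_def)
    have B: "(\<phi> has_real_derivative ?\<phi>' \<tau>) (at \<tau>)"
      using smooth_on_has_vector_derivative[OF \<phi>(1)] by (simp add: has_real_derivative_iff_has_vector_derivative)
    have "((\<lambda>\<tau>. F2 \<tau> * \<phi> \<tau>) has_real_derivative F2' \<tau> * \<phi> \<tau> + F2 \<tau> * ?\<phi>' \<tau>) (at \<tau>)"
      by (rule DERIV_cong[OF DERIV_mult[OF F2[OF A] B]]) (simp add: mult.commute)
    then show "((\<lambda>\<tau>. F2 \<tau> * \<phi> \<tau>) has_vector_derivative F2' \<tau> * \<phi> \<tau> + F2 \<tau> * ?\<phi>' \<tau>) (at \<tau> within {t - r..t + r})"
      by (simp add: has_real_derivative_iff_has_vector_derivative has_vector_derivative_at_within)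
  qed (use r in simp)
  then have 2: "((\<lambda>\<tau>. F2' \<tau> * \<phi> \<tau> + F2 \<tau> * ?\<phi>' \<tau>) has_integral 0) I" by (simp add: \<phi>(4))
  from has_integral_mult_right[OF has_integral_diff[OF 1 2], of "F t"]
  have "((\<lambda>\<tau>. H \<tau> * \<phi> \<tau>) has_integral 0) (cbox (t - r) (t + r))"
    by (simp add: H_def F_def I_def algebra_simps)
  then have "H t * \<phi> t = 0"
    by (rule has_integral_0_cbox_imp_0[rotated 2]) (use cH pos r in \<open>auto simp: I_def\<close>)
  then show False using Ht \<phi>(3) by simp
qed

section \<open>Riemannian geometry in one coordinate patch\<close>

text \<open>Identities between partial derivatives are obtained below from the one-variable differentiation
  rules along coordinate lines.\<close>

lemma partial_deriv_line:
  assumes "f differentiable (at x)"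
  shows "((\<lambda>t. f (x + t *\<^sub>R axis c 1)) has_real_derivative partial_deriv c f x) (at 0)"
proof -
  have "((\<lambda>t. x + t *\<^sub>R axis c 1) has_vector_derivative axis c 1) (at 0)"
    by (auto intro!: derivative_eq_intros simp: has_vector_derivative_def)
  from partial_deriv_chain[OF _ this, of f] assms show ?thesis
    using exhaust_2[of c] by (auto simp: axis_def)
qed

lemma axis_2_nth: "axis 2 (1::real) $ (1::2) = 0" "axis 2 (1::real) $ (2::2) = 1"
  by (simp_all add: axis_def)

lemma smooth_on_partial_deriv: "smooth_on X f \<Longrightarrow> smooth_on X (partial_deriv c f)"
  unfolding partial_deriv_def[abs_def] by (rule smooth_on_frechet_derivative)

lemma partial_deriv_cong:
  assumes "open X" "x \<in> X" "f differentiable (at x)" "\<And>y. y \<in> X \<Longrightarrow> f y = g y"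
  shows "partial_deriv c f x = partial_deriv c g x"
  unfolding partial_deriv_def using frechet_derivative_transform_within_open[OF assms(3,1,2,4)] by simp

text \<open>The covariant derivative of a field \<open>y\<close> with ordinary derivative \<open>y'\<close> along a curve through
  \<open>x\<close> with velocity \<open>x'\<close>.\<close>

definition cov_coords ::
  "(real^2 \<Rightarrow> real^2^2) \<Rightarrow> real^2 \<Rightarrow> real^2 \<Rightarrow> real^2 \<Rightarrow> real^2 \<Rightarrow> real^2" where
  "cov_coords G x x' y y' =
     y' + (\<chi> k. \<Sum>a\<in>UNIV. \<Sum>b\<in>UNIV. christoffel G k a b x * x' $ a * y $ b)"

lemma cov_coords_nth:
  "cov_coords G x x' y y' $ k = y' $ k + christoffel G k 1 1 x * x' $ 1 * y $ 1
     + christoffel G k 1 2 x * x' $ 1 * y $ 2 + christoffel G k 2 1 x * x' $ 2 * y $ 1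
     + christoffel G k 2 2 x * x' $ 2 * y $ 2"
  by (simp add: cov_coords_def sum_2)

text \<open>This is $\langle D_t y, J y\rangle$, by \<open>rot_coords_inner\<close>.\<close>

definition angular_coords ::
  "(real^2 \<Rightarrow> real^2^2) \<Rightarrow> real^2 \<Rightarrow> real^2 \<Rightarrow> real^2 \<Rightarrow> real^2 \<Rightarrow> real" where
  "angular_coords G x x' y y' = sqrt (det (G x)) *
     (y $ 1 * cov_coords G x x' y y' $ 2 - y $ 2 * cov_coords G x x' y y' $ 1)"

text \<open>The components of the connection form $\langle \nabla_a e, J e\rangle$ of the frame
  \<open>e = \<partial>\<^sub>2 / |\<partial>\<^sub>2|\<close>.\<close>

definition frame_form :: "(real^2 \<Rightarrow> real^2^2) \<Rightarrow> 2 \<Rightarrow> real^2 \<Rightarrow> real" where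
  "frame_form G a x = - (sqrt (det (G x)) * christoffel G 1 a 2 x) / G x $ 2 $ 2"

definition unit_frame :: "(real^2 \<Rightarrow> real^2^2) \<Rightarrow> real^2 \<Rightarrow> real^2" where
  "unit_frame G x = (1 / sqrt (G x $ 2 $ 2)) *\<^sub>R axis 2 1"

locale riemannian_patch =
  fixes \<Omega> :: "(real^2) set" and G :: "real^2 \<Rightarrow> real^2^2"
  assumes open_patch: "open \<Omega>"
    and smooth_metric: "smooth_on \<Omega> G"
    and metric_transpose: "x \<in> \<Omega> \<Longrightarrow> transpose (G x) = G x"
    and metric_pos: "x \<in> \<Omega> \<Longrightarrow> v \<noteq> 0 \<Longrightarrow> 0 < v \<bullet> (G x *v v)"
begin

lemma metric_sym: "x \<in> \<Omega> \<Longrightarrow> G x $ a $ b = G x $ b $ a"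
  using arg_cong[OF metric_transpose[of x], of "\<lambda>M. M $ b $ a"] by (simp add: transpose_def)

lemma det_pos: "x \<in> \<Omega> \<Longrightarrow> 0 < det (G x)"
  using pos_def_det metric_transpose metric_pos by blast

lemma metric_22_pos: "x \<in> \<Omega> \<Longrightarrow> 0 < G x $ 2 $ 2"
  using metric_pos[of x "axis 2 1"]
  unfolding inner_2 matrix_vector_2 axis_2_nth axis_eq_0_iff by simp

lemma smooth_metric_nth: "smooth_on \<Omega> (\<lambda>x. G x $ a $ b)"
  by (intro smooth_on_nth open_patch smooth_metric)

lemma metric_differentiable: "x \<in> \<Omega> \<Longrightarrow> (\<lambda>x. G x $ a $ b) differentiable (at x)"
  using smooth_on_differentiable[OF smooth_metric_nth] .

lemma smooth_det: "smooth_on \<Omega> (\<lambda>x. det (G x))"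
  unfolding det_2 by (intro smooth_on_diff smooth_on_mult smooth_metric_nth open_patch)

lemma smooth_sqrt_det: "smooth_on \<Omega> (\<lambda>x. sqrt (det (G x)))"
  by (rule smooth_on_compose[OF open_patch _ _ smooth_det smooth_on_sqrt]) (use det_pos in auto)

lemma partial_metric_sym:
  "x \<in> \<Omega> \<Longrightarrow> partial_deriv c (\<lambda>y. G y $ a $ b) x = partial_deriv c (\<lambda>y. G y $ b $ a) x"
  by (rule partial_deriv_cong[OF open_patch _ metric_differentiable metric_sym])

text \<open>Lowering the upper index removes the inverse matrix, so that these two linear equations determine
  the Christoffel symbols by Cramer's rule.\<close>

lemma christoffel_first_kind:
  assumes "x \<in> \<Omega>"
  shows "G x $ d $ 1 * christoffel G 1 a b x + G x $ d $ 2 * christoffel G 2 a b x =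
    (partial_deriv a (\<lambda>y. G y $ b $ d) x + partial_deriv b (\<lambda>y. G y $ a $ d) x
         - partial_deriv d (\<lambda>y. G y $ a $ b) x) / 2"
proof -
  have "invertible (G x)" using det_pos[OF assms] by (simp add: invertible_det_nz)
  from christoffel_lower[where G = G and x = x, OF this, of d a b] show ?thesis by (simp add: sum_2)
qed

lemma christoffel_sym:
  assumes "x \<in> \<Omega>" shows "christoffel G k a b x = christoffel G k b a x"
  unfolding christoffel_def
  by (simp add: partial_metric_sym[OF assms, of _ a b] algebra_simps)

text \<open>Metric compatibility of the connection: the sum of two Christoffel symbols of the first kind.\<close>

lemma partial_metric:
  assumes "x \<in> \<Omega>"
  shows "partial_deriv c (\<lambda>y. G y $ a $ b) x =
    G x $ a $ 1 * christoffel G 1 c b x + G x $ a $ 2 * christoffel G 2 c b x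
    + G x $ b $ 1 * christoffel G 1 c a x + G x $ b $ 2 * christoffel G 2 c a x"
  using christoffel_first_kind[OF assms, of a c b] christoffel_first_kind[OF assms, of b c a]
    partial_metric_sym[OF assms, of _ a b] partial_metric_sym[OF assms, of _ a c]
    partial_metric_sym[OF assms, of _ b c] by simp

lemma smooth_christoffel: "smooth_on \<Omega> (christoffel G k a b)"
proof -
  define P where "P d x = (partial_deriv a (\<lambda>y. G y $ b $ d) x + partial_deriv b (\<lambda>y. G y $ a $ d) x
         - partial_deriv d (\<lambda>y. G y $ a $ b) x) * (1 / 2)" for d x
  have P: "smooth_on \<Omega> (P d)" for d
    unfolding P_def[abs_def]
    by (intro smooth_on_mult smooth_on_diff smooth_on_add smooth_on_partial_deriv smooth_on_const
        smooth_metric_nth open_patch)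
  have I: "smooth_on \<Omega> (\<lambda>x. inverse (det (G x)))"
    by (rule smooth_on_compose[OF open_patch _ _ smooth_det smooth_on_inverse]) (use det_pos in auto)
  have S: "smooth_on \<Omega> (\<lambda>x. (G x $ 2 $ 2 * P 1 x - G x $ 1 $ 2 * P 2 x) * inverse (det (G x)))"
    "smooth_on \<Omega> (\<lambda>x. (G x $ 1 $ 1 * P 2 x - G x $ 2 $ 1 * P 1 x) * inverse (det (G x)))"
    by (intro smooth_on_mult smooth_on_diff smooth_metric_nth open_patch P I)+
  have "(G x $ 2 $ 2 * P 1 x - G x $ 1 $ 2 * P 2 x) * inverse (det (G x)) = christoffel G 1 a b x"
    "(G x $ 1 $ 1 * P 2 x - G x $ 2 $ 1 * P 1 x) * inverse (det (G x)) = christoffel G 2 a b x"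
    if x: "x \<in> \<Omega>" for x
  proof -
    have p: "P d x = G x $ d $ 1 * christoffel G 1 a b x + G x $ d $ 2 * christoffel G 2 a b x" for d
      using christoffel_first_kind[OF x, of d a b] by (simp add: P_def)
    have "G x $ 2 $ 2 * P 1 x - G x $ 1 $ 2 * P 2 x = christoffel G 1 a b x * det (G x)"
      "G x $ 1 $ 1 * P 2 x - G x $ 2 $ 1 * P 1 x = christoffel G 2 a b x * det (G x)"
      unfolding p det_2 by (simp_all add: algebra_simps)
    then show "(G x $ 2 $ 2 * P 1 x - G x $ 1 $ 2 * P 2 x) * inverse (det (G x)) = christoffel G 1 a b x"
      "(G x $ 1 $ 1 * P 2 x - G x $ 2 $ 1 * P 1 x) * inverse (det (G x)) = christoffel G 2 a b x"
      using det_pos[OF x] by simp_all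
  qed
  with S have "smooth_on \<Omega> (christoffel G 1 a b)" "smooth_on \<Omega> (christoffel G 2 a b)"
    using smooth_on_cong[OF open_patch] by blast+
  then show ?thesis using exhaust_2[of k] by metis
qed

lemma smooth_frame_form: "smooth_on \<Omega> (frame_form G a)"
proof -
  have "smooth_on \<Omega> (\<lambda>x. inverse (G x $ 2 $ 2))"
    by (rule smooth_on_compose[OF open_patch _ _ smooth_metric_nth smooth_on_inverse])
       (use metric_22_pos in auto)
  then have "smooth_on \<Omega> (\<lambda>x. - (sqrt (det (G x)) * christoffel G 1 a 2 x) * inverse (G x $ 2 $ 2))"
    by (intro smooth_on_mult smooth_on_minus smooth_sqrt_det smooth_christoffel open_patch)
  then show ?thesis by (simp add: frame_form_def[abs_def] divide_inverse)
qed

lemma smooth_unit_frame: "smooth_on \<Omega> (unit_frame G)"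
proof -
  have "smooth_on \<Omega> (\<lambda>x. sqrt (G x $ 2 $ 2))"
    by (rule smooth_on_compose[OF open_patch _ _ smooth_metric_nth smooth_on_sqrt])
       (use metric_22_pos in auto)
  then have "smooth_on \<Omega> (\<lambda>x. inverse (sqrt (G x $ 2 $ 2)))"
    by (intro smooth_on_compose[OF open_patch _ _ _ smooth_on_inverse]) (use metric_22_pos in auto)
  then show ?thesis unfolding unit_frame_def[abs_def] divide_inverse mult_1
    by (intro smooth_on_scaleR smooth_on_const open_patch)
qed

lemma smooth_rot_coords:
  assumes "open X" "smooth_on X x" "smooth_on X y" "x ` X \<subseteq> \<Omega>"
  shows "smooth_on X (\<lambda>t. rot_coords (G (x t)) (y t))"
proof -
  have "smooth_on X (\<lambda>t. sqrt (det (G (x t))))"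
    by (rule smooth_on_compose[OF assms(1) open_patch assms(4,2) smooth_sqrt_det])
  then have I: "smooth_on X (\<lambda>t. inverse (sqrt (det (G (x t)))))"
    by (intro smooth_on_compose[OF assms(1) _ _ _ smooth_on_inverse])
       (use det_pos assms(4) in auto)
  have S: "smooth_on X (\<lambda>t. G (x t) $ a $ b)" for a b
    by (rule smooth_on_compose[OF assms(1) open_patch assms(4,2) smooth_metric_nth])
  have "smooth_on X (\<lambda>t. rot_coords (G (x t)) (y t) $ 1)" "smooth_on X (\<lambda>t. rot_coords (G (x t)) (y t) $ 2)"
    unfolding rot_coords_nth matrix_vector_2 divide_inverse
    by (intro smooth_on_mult smooth_on_minus smooth_on_add smooth_on_nth I S assms)+
  then have "smooth_on X (\<lambda>t. rot_coords (G (x t)) (y t) $ k)" for k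
    using exhaust_2[of k] by metis
  then show ?thesis by (rule smooth_on_vecI[OF assms(1)])
qed

lemma unit_frame_unit: "x \<in> \<Omega> \<Longrightarrow> unit_frame G x \<bullet> (G x *v unit_frame G x) = 1"
  using metric_22_pos[of x] unfolding unit_frame_def inner_2 matrix_vector_2 vector_scaleR_component axis_2_nth
  by simp

section \<open>The connection form is a potential of the curvature\<close>

text \<open>The logarithmic derivative of the area density is the trace of the connection.\<close>

lemma sqrt_det_has_derivative:
  assumes "x \<in> \<Omega>"
  shows "((\<lambda>t. sqrt (det (G (x + t *\<^sub>R axis c 1)))) has_real_derivative
    sqrt (det (G x)) * (christoffel G 1 c 1 x + christoffel G 2 c 2 x)) (at 0)"
proof -
  define g where "g a b t = G (x + t *\<^sub>R axis c 1) $ a $ b" for a b t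
  define P where "P a b = partial_deriv c (\<lambda>y. G y $ a $ b) x" for a b
  have dg: "(g a b has_real_derivative P a b) (at 0)" for a b
    unfolding g_def[abs_def] P_def
    by (rule partial_deriv_line[OF metric_differentiable[OF assms], of c a b])
  have g0: "g a b 0 = G x $ a $ b" for a b by (simp add: g_def)
  have pos: "0 < g 1 1 0 * g 2 2 0 - g 1 2 0 * g 2 1 0" using det_pos[OF assms] by (simp add: g0 det_2)
  have "((\<lambda>t. g 1 1 t * g 2 2 t - g 1 2 t * g 2 1 t) has_real_derivative
      2 * (christoffel G 1 c 1 x + christoffel G 2 c 2 x) * det (G x)) (at 0)"
    by (rule DERIV_cong[OF DERIV_diff[OF DERIV_mult[OF dg dg] DERIV_mult[OF dg dg]]])
       (simp add: g0 P_def partial_metric[OF assms] det_2 metric_sym[OF assms, of 2 1] algebra_simps)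
  from DERIV_chain2[OF DERIV_real_sqrt[OF pos] this]
  have "((\<lambda>t. sqrt (g 1 1 t * g 2 2 t - g 1 2 t * g 2 1 t)) has_real_derivative
      inverse (sqrt (det (G x))) / 2 * (2 * (christoffel G 1 c 1 x + christoffel G 2 c 2 x) * det (G x))) (at 0)"
    by (simp add: g0 det_2)
  then have A: "((\<lambda>t. sqrt (det (G (x + t *\<^sub>R axis c 1)))) has_real_derivative
      inverse (sqrt (det (G x))) / 2 * (2 * (christoffel G 1 c 1 x + christoffel G 2 c 2 x) * det (G x))) (at 0)"
    unfolding g_def det_2 .
  have B: "inverse (sqrt (det (G x))) * det (G x) = sqrt (det (G x))"
    using det_pos[OF assms] real_sqrt_mult_self[of "det (G x)"] by (simp add: field_simps)
  have C: "i / 2 * (2 * T * d) = i * d * T" for i T d :: real by simp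
  show ?thesis by (rule DERIV_cong[OF A]) (simp only: B C)
qed

lemma metric_line:
  "x \<in> \<Omega> \<Longrightarrow> ((\<lambda>t. G (x + t *\<^sub>R axis c 1) $ a $ b) has_real_derivative
    partial_deriv c (\<lambda>y. G y $ a $ b) x) (at 0)"
  by (rule partial_deriv_line[OF metric_differentiable])

lemma christoffel_line:
  "x \<in> \<Omega> \<Longrightarrow> ((\<lambda>t. christoffel G k a b (x + t *\<^sub>R axis c 1)) has_real_derivative
    partial_deriv c (christoffel G k a b) x) (at 0)"
  by (rule partial_deriv_line[OF smooth_on_differentiable[OF smooth_christoffel]])

lemma partial_deriv_eqI:
  assumes "smooth_on \<Omega> f" "x \<in> \<Omega>"
    and "((\<lambda>t. f (x + t *\<^sub>R axis c 1)) has_real_derivative D) (at 0)"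
  shows "partial_deriv c f x = D"
  using DERIV_unique[OF partial_deriv_line[OF smooth_on_differentiable[OF assms(1,2)]] assms(3)] .

text \<open>An instance of the skew-symmetry $\langle R(X,Y)Z, Z\rangle = 0$. By metric compatibility the
  first derivatives of $G_{22}$ are \<open>2 * h\<close>, and the identity says that its mixed second
  derivatives agree.\<close>

lemma riemann_skew:
  assumes x: "x \<in> \<Omega>"
  shows "G x $ 2 $ 1 * riemann G 1 1 2 2 x + G x $ 2 $ 2 * riemann G 2 1 2 2 x = 0"
proof -
  define h where "h a y = G y $ 2 $ 1 * christoffel G 1 a 2 y + G y $ 2 $ 2 * christoffel G 2 a 2 y" for a y
  have h: "smooth_on \<Omega> (h a)" for a unfolding h_def[abs_def]
    by (intro smooth_on_add smooth_on_mult smooth_metric_nth smooth_christoffel open_patch)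
  have h2: "partial_deriv a (\<lambda>y. G y $ 2 $ 2) y = 2 * h a y" if "y \<in> \<Omega>" for a y
    using partial_metric[OF that, of a 2 2] by (simp add: h_def)
  have dh: "partial_deriv c (h a) x =
      (partial_deriv c (\<lambda>y. G y $ 2 $ 1) x * christoffel G 1 a 2 x
        + partial_deriv c (christoffel G 1 a 2) x * G x $ 2 $ 1)
      + (partial_deriv c (\<lambda>y. G y $ 2 $ 2) x * christoffel G 2 a 2 x
        + partial_deriv c (christoffel G 2 a 2) x * G x $ 2 $ 2)" for a c
    using DERIV_add[OF DERIV_mult[OF metric_line[OF x, of c 2 1]
          christoffel_line[OF x, of 1 a 2 c]]
        DERIV_mult[OF metric_line[OF x, of c 2 2]
          christoffel_line[OF x, of 2 a 2 c]]]
    by (intro partial_deriv_eqI[OF h x]) (simp add: h_def)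
  have d2: "2 * partial_deriv c (h a) x = partial_deriv c (partial_deriv a (\<lambda>y. G y $ 2 $ 2)) x" for a c
  proof -
    have "partial_deriv c (partial_deriv a (\<lambda>y. G y $ 2 $ 2)) x = partial_deriv c (\<lambda>y. 2 * h a y) x"
      by (rule partial_deriv_cong[OF open_patch x smooth_on_differentiable[OF smooth_on_partial_deriv[OF smooth_metric_nth] x]])
         (simp add: h2)
    also have "\<dots> = 2 * partial_deriv c (h a) x"
      by (rule partial_deriv_eqI[OF _ x])
         (auto intro!: smooth_on_mult smooth_on_const open_patch h DERIV_cmult
            partial_deriv_line smooth_on_differentiable[OF h x])
    finally show ?thesis by simp
  qed
  have "partial_deriv 1 (h 2) x = partial_deriv 2 (h 1) x"
    using d2[of 1 2] d2[of 2 1] frechet_derivative_commute_real[OF open_patch x smooth_metric_nth]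
    unfolding partial_deriv_def by simp
  then show ?thesis
    unfolding dh partial_metric[OF x] riemann_def sum_2
      christoffel_sym[OF x, of _ 2 1] metric_sym[OF x, of 2 1]
    by (simp add: algebra_simps)
qed

text \<open>Liouville's formula. Differentiating $\sqrt{\det G}$ and $G_{22}$ by metric compatibility
  leaves $-\sqrt{\det G}\,R^1{}_{122}/G_{22}$, and skew-symmetry of the curvature identifies
  $R^1{}_{122}$ with $K\,G_{22}$.\<close>

lemma frame_form_curl:
  assumes x: "x \<in> \<Omega>"
  shows "partial_deriv 1 (frame_form G 2) x - partial_deriv 2 (frame_form G 1) x =
    - (sqrt (det (G x)) * gauss_curvature_coords G x)"
proof -
  define s where "s = sqrt (det (G x))"
  define H where "H = G x $ 2 $ 2"
  define F where "F = G x $ 1 $ 2"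
  define R where "R = riemann G 1 1 2 2 x"
  have H: "H \<noteq> 0" using metric_22_pos[OF x] by (simp add: H_def)
  then have HH: "H * H \<noteq> 0" by simp
  have d: "H * H * partial_deriv c (frame_form G a) x =
      (- (s * (christoffel G 1 c 1 x + christoffel G 2 c 2 x) * christoffel G 1 a 2 x
           + partial_deriv c (christoffel G 1 a 2) x * s)) * H
        - (- (s * christoffel G 1 a 2 x))
          * (2 * (F * christoffel G 1 c 2 x + H * christoffel G 2 c 2 x))" (is "_ = ?N") for a c
  proof -
    have nz: "G (x + 0 *\<^sub>R axis c 1) $ 2 $ 2 \<noteq> 0" using H by (simp add: H_def)
    from DERIV_divide[OF DERIV_minus[OF DERIV_mult[OF sqrt_det_has_derivative[OF x, of c]
            christoffel_line[OF x, of 1 a 2 c]]] metric_line[OF x, of c 2 2] nz]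
    have "partial_deriv c (frame_form G a) x = ?N / (H * H)"
      by (intro partial_deriv_eqI[OF smooth_frame_form x])
         (simp add: frame_form_def s_def H_def F_def partial_metric[OF x] metric_sym[OF x, of 2 1] algebra_simps)
    then show ?thesis by (simp only: times_divide_eq_right nonzero_mult_div_cancel_left[OF HH])
  qed
  have "R = partial_deriv 1 (christoffel G 1 2 2) x - partial_deriv 2 (christoffel G 1 1 2) x
      + (christoffel G 1 1 1 x * christoffel G 1 2 2 x - christoffel G 1 1 2 x * christoffel G 1 1 2 x
       + (christoffel G 1 1 2 x * christoffel G 2 2 2 x - christoffel G 1 2 2 x * christoffel G 2 1 2 x))"
    by (simp add: R_def riemann_def sum_2 christoffel_sym[OF x, of _ 2 1])
  then have "H * H * (partial_deriv 1 (frame_form G 2) x - partial_deriv 2 (frame_form G 1) x) = - (s * R * H)"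
    unfolding right_diff_distrib d christoffel_sym[OF x, of _ 2 1] by algebra
  then have "partial_deriv 1 (frame_form G 2) x - partial_deriv 2 (frame_form G 1) x = - (s * R * H) / (H * H)"
    by (simp only: nonzero_eq_divide_eq[OF HH] mult.commute[of _ "H * H"])
  then have "partial_deriv 1 (frame_form G 2) x - partial_deriv 2 (frame_form G 1) x = - (s * R / H)"
    using H by simp
  moreover have "R = H * gauss_curvature_coords G x"
  proof -
    define D where "D = det (G x)"
    have D: "D \<noteq> 0" "D = G x $ 1 $ 1 * H - F * F"
      using det_pos[OF x] by (auto simp: D_def H_def F_def det_2 metric_sym[OF x, of 2 1])
    have "gauss_curvature_coords G x * D = G x $ 1 $ 1 * R + F * riemann G 2 1 2 2 x"
      using D(1) by (simp add: gauss_curvature_coords_def sum_2 R_def F_def D_def)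
    moreover have "F * R + H * riemann G 2 1 2 2 x = 0"
      using riemann_skew[OF x] by (simp add: R_def F_def H_def metric_sym[OF x, of 2 1])
    ultimately have "D * (H * gauss_curvature_coords G x) = D * R"
      unfolding D(2) by algebra
    then show ?thesis using D(1) by simp
  qed
  ultimately show ?thesis using H by (simp add: s_def)
qed

section \<open>Covariant derivatives along curves in a patch\<close>

lemma metric_along_curve:
  assumes "x t \<in> \<Omega>" "(x has_vector_derivative x') (at t)"
  shows "((\<lambda>\<tau>. G (x \<tau>) $ a $ b) has_real_derivative
    partial_deriv 1 (\<lambda>y. G y $ a $ b) (x t) * x' $ 1 + partial_deriv 2 (\<lambda>y. G y $ a $ b) (x t) * x' $ 2) (at t)"
  by (rule partial_deriv_chain[OF metric_differentiable[OF assms(1)] assms(2)])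

lemma inner_along_curve:
  assumes x: "x t \<in> \<Omega>" "(x has_vector_derivative x') (at t)"
    and v: "(v has_vector_derivative v') (at t)" and w: "(w has_vector_derivative w') (at t)"
  shows "((\<lambda>\<tau>. v \<tau> \<bullet> (G (x \<tau>) *v w \<tau>)) has_real_derivative
    cov_coords G (x t) x' (v t) v' \<bullet> (G (x t) *v w t)
    + v t \<bullet> (G (x t) *v cov_coords G (x t) x' (w t) w')) (at t)"
proof -
  have nth: "((\<lambda>\<tau>. y \<tau> $ k) has_real_derivative y' $ k) (at t)"
    if "(y has_vector_derivative y') (at t)" for y :: "real \<Rightarrow> real^2" and y' k
    using bounded_linear.has_vector_derivative[OF bounded_linear_vec_nth that]
    by (simp add: has_real_derivative_iff_has_vector_derivative)
  note g = metric_along_curve[of x t x', OF x]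
  note m = DERIV_mult[OF nth[OF v] DERIV_add[OF DERIV_mult[OF g nth[OF w]] DERIV_mult[OF g nth[OF w]]]]
  show ?thesis
    unfolding inner_2 matrix_vector_2
    by (rule DERIV_cong[OF DERIV_add[OF m m]])
       (simp add: partial_metric[OF x(1)] christoffel_sym[OF x(1), of _ 2 1] metric_sym[OF x(1), of 2 1]
          cov_coords_nth algebra_simps)
qed

text \<open>The momentum \<open>G x'\<close> of a free particle changes by the force \<open>\<partial>G\<close> plus the lowered
  acceleration.\<close>

lemma lowered_acceleration:
  assumes x: "x t \<in> \<Omega>" "(x has_vector_derivative v t) (at t)" and v: "(v has_vector_derivative v') (at t)"
  shows "((\<lambda>\<tau>. (G (x \<tau>) *v v \<tau>) $ a) has_real_derivative
    (G (x t) *v cov_coords G (x t) (v t) (v t) v') $ a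
    + (\<Sum>b\<in>UNIV. \<Sum>c\<in>UNIV. partial_deriv a (\<lambda>y. G y $ b $ c) (x t) * v t $ b * v t $ c) / 2) (at t)"
proof -
  have nth: "((\<lambda>\<tau>. v \<tau> $ k) has_real_derivative v' $ k) (at t)" for k
    using bounded_linear.has_vector_derivative[OF bounded_linear_vec_nth v]
    by (simp add: has_real_derivative_iff_has_vector_derivative)
  note g = metric_along_curve[of x t "v t", OF x]
  have sum: "(G (x \<tau>) *v v \<tau>) $ a = G (x \<tau>) $ a $ 1 * v \<tau> $ 1 + G (x \<tau>) $ a $ 2 * v \<tau> $ 2" for \<tau>
    using exhaust_2[of a] by (auto simp: matrix_vector_2)
  have c: "(G (x t) *v w) $ a = G (x t) $ a $ 1 * w $ 1 + G (x t) $ a $ 2 * w $ 2" for w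
    using exhaust_2[of a] by (auto simp: matrix_vector_2)
  show ?thesis unfolding sum
    by (rule DERIV_cong[OF DERIV_add[OF DERIV_mult[OF g nth] DERIV_mult[OF g nth]]], unfold c)
       (simp add: partial_metric[OF x(1)] christoffel_sym[OF x(1), of _ 2 1] metric_sym[OF x(1), of 2 1]
          cov_coords_nth sum_2 christoffel_sym[OF x(1), of _ _ a] metric_sym[OF x(1), of _ a] algebra_simps)
qed

end

section \<open>Change of charts\<close>

lemma frechet_derivative_nth:
  assumes "f differentiable (at x)"
  shows "frechet_derivative (\<lambda>z. f z $ k) (at x) v = frechet_derivative f (at x) v $ k"
  using frechet_derivative_at[OF bounded_linear.has_derivative[OF bounded_linear_vec_nth
      assms[unfolded frechet_derivative_works], of k]] by (metis (no_types))

lemma frechet_derivative_commute: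
  fixes f :: "'a::real_normed_vector \<Rightarrow> real^'n"
  assumes X: "open X" "x \<in> X" and f: "smooth_on X f"
  shows "frechet_derivative (\<lambda>z. frechet_derivative f (at z) v) (at x) w =
    frechet_derivative (\<lambda>z. frechet_derivative f (at z) w) (at x) v"
proof -
  have nth: "frechet_derivative (\<lambda>z. frechet_derivative f (at z) v) (at x) w $ k =
      frechet_derivative (\<lambda>z. frechet_derivative (\<lambda>z. f z $ k) (at z) v) (at x) w" for v w k
  proof -
    have "frechet_derivative (\<lambda>z. frechet_derivative f (at z) v $ k) (at x) =
        frechet_derivative (\<lambda>z. frechet_derivative (\<lambda>z. f z $ k) (at z) v) (at x)"
      by (rule frechet_derivative_transform_within_open[OF _ X])
         (auto intro!: smooth_on_differentiable[OF smooth_on_nth[OF X(1) smooth_on_frechet_derivative[OF f]] X(2)]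
            frechet_derivative_nth[symmetric] smooth_on_differentiable[OF f])
    then show ?thesis
      using frechet_derivative_nth[OF smooth_on_differentiable[OF smooth_on_frechet_derivative[OF f] X(2)], of v k w]
      by simp
  qed
  show ?thesis
    by (simp only: vec_eq_iff nth)
       (intro allI frechet_derivative_commute_real[OF X smooth_on_nth[OF X(1) f]])
qed

lemma isCont_open_preimage:
  assumes "isCont f t" "open X" "f t \<in> X"
  shows "\<exists>U. open U \<and> t \<in> U \<and> (\<forall>\<tau>\<in>U. f \<tau> \<in> X)"
  using assms unfolding continuous_at_open by blast

text \<open>The product rule for $f'(x)\,y$. The second derivative is linear in the slot occupied by \<open>y\<close>
  because mixed derivatives commute.\<close>

lemma frechet_derivative_along_curve:
  fixes x y :: "real \<Rightarrow> real^2" and f :: "real^2 \<Rightarrow> real^2"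
  assumes X: "open X" "x t \<in> X" and f: "smooth_on X f"
    and x: "(x has_vector_derivative x') (at t)" and y: "(y has_vector_derivative y') (at t)"
  shows "((\<lambda>\<tau>. frechet_derivative f (at (x \<tau>)) (y \<tau>)) has_vector_derivative
    frechet_derivative f (at (x t)) y' + frechet_derivative (\<lambda>z. frechet_derivative f (at z) (y t)) (at (x t)) x') (at t)"
proof -
  let ?f' = "\<lambda>z. frechet_derivative f (at z)"
  define A where "A v w = frechet_derivative (\<lambda>z. ?f' z v) (at (x t)) w" for v w
  have A_sym: "A v w = A w v" for v w
    unfolding A_def by (rule frechet_derivative_commute[OF X f])
  have A_lin: "linear (A v)" for v
    unfolding A_def by (rule linear_frechet_derivative, rule smooth_on_differentiable[OF smooth_on_frechet_derivative[OF f] X(2)])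
  have A_sum: "A v w = (\<Sum>b\<in>Basis. (v \<bullet> b) *\<^sub>R A b w)" for v w
  proof -
    have "A v w = A w (\<Sum>b\<in>Basis. (v \<bullet> b) *\<^sub>R b)"
      by (subst A_sym) (simp add: euclidean_representation)
    also have "\<dots> = (\<Sum>b\<in>Basis. (v \<bullet> b) *\<^sub>R A b w)"
      by (simp add: linear_sum[OF A_lin] linear_scale[OF A_lin] A_sym[of w])
    finally show ?thesis .
  qed
  have d1: "((\<lambda>\<tau>. y \<tau> \<bullet> b) has_real_derivative y' \<bullet> b) (at t)" for b
    using bounded_linear.has_vector_derivative[OF bounded_linear_inner_left y, of b]
    by (simp add: has_real_derivative_iff_has_vector_derivative)
  have d2: "((\<lambda>\<tau>. ?f' (x \<tau>) b) has_vector_derivative A b x') (at t)" for b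
  proof -
    have "((\<lambda>z. ?f' z b) has_derivative A b) (at (x t))"
      unfolding A_def by (rule smooth_on_has_derivative[OF smooth_on_frechet_derivative[OF f] X(2)])
    from diff_chain_at[OF x[unfolded has_vector_derivative_def] this]
    show ?thesis by (simp add: o_def has_vector_derivative_def linear_scale[OF A_lin])
  qed
  have "((\<lambda>\<tau>. \<Sum>b\<in>Basis. (y \<tau> \<bullet> b) *\<^sub>R ?f' (x \<tau>) b) has_vector_derivative
      (\<Sum>b\<in>Basis. (y t \<bullet> b) *\<^sub>R A b x' + (y' \<bullet> b) *\<^sub>R ?f' (x t) b)) (at t)"
    by (rule has_vector_derivative_sum) (rule has_vector_derivative_scaleR[OF d1 d2])
  moreover have "(\<Sum>b\<in>Basis. (y t \<bullet> b) *\<^sub>R A b x' + (y' \<bullet> b) *\<^sub>R ?f' (x t) b) =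
      ?f' (x t) y' + A (y t) x'"
    unfolding frechet_derivative_basis_expansion[OF smooth_on_differentiable[OF f X(2)], of y'] A_sum[of "y t"]
    by (simp add: sum.distrib)
  ultimately have *: "((\<lambda>\<tau>. \<Sum>b\<in>Basis. (y \<tau> \<bullet> b) *\<^sub>R ?f' (x \<tau>) b) has_vector_derivative
      ?f' (x t) y' + A (y t) x') (at t)" by simp
  have "isCont x t" using x by (rule has_vector_derivative_continuous)
  then obtain U where U: "open U" "t \<in> U" "\<And>\<tau>. \<tau> \<in> U \<Longrightarrow> x \<tau> \<in> X"
    using isCont_open_preimage[of t x X] X by blast
  have "((\<lambda>\<tau>. ?f' (x \<tau>) (y \<tau>)) has_vector_derivative ?f' (x t) y' + A (y t) x') (at t)"
    by (rule has_vector_derivative_transform_within_open[OF * U(1,2)])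
       (rule frechet_derivative_basis_expansion[OF smooth_on_differentiable[OF f U(3)], symmetric])
  then show ?thesis unfolding A_def .
qed

definition tangent_vector_of :: "('p, 'i) surface \<Rightarrow> 'i \<Rightarrow> 'p \<Rightarrow> real^2 \<Rightarrow> 'i tangent_vector" where
  "tangent_vector_of S i p y = (\<lambda>j. if j \<in> charts_at S p
     then frechet_derivative (transition S i j) (at (chart_map S i p)) y else 0)"

locale oriented_surface =
  fixes S :: "('p, 'i) surface"
  assumes surface: "oriented_riemannian_surface S"
begin

abbreviation "jac i j \<equiv> \<lambda>x. frechet_derivative (transition S i j) (at x)"
abbreviation "overlap i j \<equiv> chart_map S i ` (chart_dom S i \<inter> chart_dom S j)"

lemma charts_atD: "i \<in> charts_at S p \<Longrightarrow> i \<in> charts S" "i \<in> charts_at S p \<Longrightarrow> p \<in> chart_dom S i"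
  by (auto simp: charts_at_def)

lemma charts_atI: "i \<in> charts S \<Longrightarrow> p \<in> chart_dom S i \<Longrightarrow> i \<in> charts_at S p"
  by (auto simp: charts_at_def)

lemma chart_exists: "p \<in> topspace (points S) \<Longrightarrow> \<exists>i. i \<in> charts_at S p"
proof -
  assume "p \<in> topspace (points S)"
  moreover have "topspace (points S) = (\<Union>i\<in>charts S. chart_dom S i)"
    using surface unfolding oriented_riemannian_surface_def smooth_oriented_surface_def by blast
  ultimately show ?thesis by (auto simp: charts_at_def)
qed

lemma some_chart_at: "p \<in> topspace (points S) \<Longrightarrow> some_chart S p \<in> charts_at S p"
  using chart_exists some_chart_in by metis

lemma chart_open: "i \<in> charts S \<Longrightarrow> openin (points S) (chart_dom S i)"
  using surface unfolding oriented_riemannian_surface_def smooth_oriented_surface_def by blast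

lemma chart_image_open: "i \<in> charts S \<Longrightarrow> open (chart_image S i)"
  using surface unfolding oriented_riemannian_surface_def smooth_oriented_surface_def by blast

lemma chart_homeomorphic: "i \<in> charts S \<Longrightarrow>
    homeomorphic_map (subtopology (points S) (chart_dom S i)) (top_of_set (chart_image S i)) (chart_map S i)"
  using surface unfolding oriented_riemannian_surface_def smooth_oriented_surface_def by blast

lemma chart_topspace: "i \<in> charts S \<Longrightarrow> topspace (subtopology (points S) (chart_dom S i)) = chart_dom S i"
  using openin_subset[OF chart_open] by (simp add: topspace_subtopology inf.absorb2)

lemma chart_inj: "i \<in> charts S \<Longrightarrow> inj_on (chart_map S i) (chart_dom S i)"
  using homeomorphic_imp_injective_map[OF chart_homeomorphic] chart_topspace by metis

lemma chart_map_open: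
  assumes "i \<in> charts S" "openin (points S) U"
  shows "open (chart_map S i ` (chart_dom S i \<inter> U))"
proof -
  have "openin (subtopology (points S) (chart_dom S i)) (chart_dom S i \<inter> U)"
    using assms(2) by (simp add: Int_commute openin_subtopology_Int)
  then have "openin (top_of_set (chart_image S i)) (chart_map S i ` (chart_dom S i \<inter> U))"
    using homeomorphic_imp_open_map[OF chart_homeomorphic[OF assms(1)]] by (simp add: open_map_def)
  then show ?thesis using openin_open_trans chart_image_open[OF assms(1)] by blast
qed

lemma overlap_open: "i \<in> charts S \<Longrightarrow> j \<in> charts S \<Longrightarrow> open (overlap i j)"
  by (rule chart_map_open[OF _ chart_open])

lemma transition_chart:
  "i \<in> charts S \<Longrightarrow> p \<in> chart_dom S i \<Longrightarrow> transition S i j (chart_map S i p) = chart_map S j p"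
  by (simp add: transition_def chart_inj)

lemma transition_smooth: "i \<in> charts S \<Longrightarrow> j \<in> charts S \<Longrightarrow> smooth_on (overlap i j) (transition S i j)"
  using surface unfolding oriented_riemannian_surface_def smooth_oriented_surface_def by blast

lemma overlapI: "i \<in> charts_at S p \<Longrightarrow> j \<in> charts_at S p \<Longrightarrow> chart_map S i p \<in> overlap i j"
  by (auto simp: charts_at_def)

lemma patch: "i \<in> charts S \<Longrightarrow> riemannian_patch (chart_image S i) (metric S i)"
  using surface chart_image_open unfolding oriented_riemannian_surface_def riemannian_metric_def
  by unfold_locales auto

lemma chart_imageI: "i \<in> charts_at S p \<Longrightarrow> chart_map S i p \<in> chart_image S i"
  by (auto simp: charts_at_def chart_image_def)

context
  fixes p :: 'p and i j :: 'i
  assumes i: "i \<in> charts_at S p" and j: "j \<in> charts_at S p"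
begin

lemma jac_has_derivative:
  "(transition S i j has_derivative jac i j (chart_map S i p)) (at (chart_map S i p))"
  by (rule smooth_on_has_derivative[OF transition_smooth overlapI]) (use i j charts_atD in auto)

lemma jac_linear: "linear (jac i j (chart_map S i p))"
  by (rule has_derivative_linear[OF jac_has_derivative])

lemma metric_transition:
  "v \<bullet> (metric S i (chart_map S i p) *v w) =
    jac i j (chart_map S i p) v \<bullet> (metric S j (chart_map S j p) *v jac i j (chart_map S i p) w)"
proof -
  define x where "x = chart_map S i p"
  define D where "D = matrix (jac i j x)"
  have D: "jac i j x y = D *v y" for y
    unfolding D_def using jac_linear by (simp add: matrix_works x_def)
  have "\<forall>i\<in>charts S. \<forall>j\<in>charts S. \<forall>x\<in>overlap i j.
        (let D = matrix (jac i j x) in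
             metric S i x = transpose D ** metric S j (transition S i j x) ** D)"
    using surface unfolding oriented_riemannian_surface_def riemannian_metric_def by (elim conjE)
  from this[rule_format, OF charts_atD(1)[OF i] charts_atD(1)[OF j] overlapI[OF i j]]
  have "metric S i x = transpose D ** metric S j (chart_map S j p) ** D"
    unfolding Let_def D_def x_def transition_chart[OF charts_atD[OF i]] .
  then have "v \<bullet> (metric S i x *v w) =
      v \<bullet> (transpose D *v (metric S j (chart_map S j p) *v (D *v w)))"
    by (simp only: matrix_vector_mul_assoc matrix_mul_assoc)
  also have "\<dots> = (D *v v) \<bullet> (metric S j (chart_map S j p) *v (D *v w))"
    unfolding transpose_matrix_vector inner_commute[of "v"] dot_lmul_matrix by (rule inner_commute)
  finally show ?thesis unfolding x_def[symmetric] D .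
qed

lemma jac_det_pos: "0 < det (matrix (jac i j (chart_map S i p)))"
  using surface charts_atD(1)[OF i] charts_atD(1)[OF j] overlapI[OF i j]
  unfolding oriented_riemannian_surface_def smooth_oriented_surface_def by blast

lemma tangent_space_jac:
  "v \<in> tangent_space S p \<Longrightarrow> v j = jac i j (chart_map S i p) (v i)"
  using i j unfolding tangent_space_def by blast

end

lemma jac_chain:
  assumes "i \<in> charts_at S p" "j \<in> charts_at S p" "k \<in> charts_at S p"
  shows "jac i k (chart_map S i p) v = jac j k (chart_map S j p) (jac i j (chart_map S i p) v)"
proof -
  define U where "U = chart_map S i ` (chart_dom S i \<inter> (chart_dom S j \<inter> chart_dom S k))"
  have U: "open U" "chart_map S i p \<in> U"
    unfolding U_def using assms charts_atD
    by (auto intro!: chart_map_open openin_Int chart_open)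
  have "(transition S j k \<circ> transition S i j has_derivative
      jac j k (chart_map S j p) \<circ> jac i j (chart_map S i p)) (at (chart_map S i p))"
    by (rule diff_chain_at[OF jac_has_derivative[OF assms(1,2)]])
       (use jac_has_derivative[OF assms(2,3)] transition_chart[OF charts_atD[OF assms(1)]] in simp)
  then have "(transition S i k has_derivative
      jac j k (chart_map S j p) \<circ> jac i j (chart_map S i p)) (at (chart_map S i p))"
  proof (rule has_derivative_transform_within_open[OF _ U])
    show "(transition S j k \<circ> transition S i j) x = transition S i k x" if "x \<in> U" for x
      using that assms charts_atD by (auto simp: U_def transition_chart)
  qed
  from has_derivative_unique[OF this jac_has_derivative[OF assms(1,3)]]
  show ?thesis by (metis comp_apply)
qed

lemma jac_refl:
  assumes "i \<in> charts_at S p"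
  shows "jac i i (chart_map S i p) v = v"
proof -
  have U: "open (overlap i i)" "chart_map S i p \<in> overlap i i"
    using assms charts_atD overlap_open overlapI by blast+
  have "((\<lambda>x. x) has_derivative (\<lambda>v. v)) (at (chart_map S i p))" by (rule has_derivative_ident)
  then have "(transition S i i has_derivative (\<lambda>v. v)) (at (chart_map S i p))"
    by (rule has_derivative_transform_within_open[OF _ U])
       (use assms charts_atD in \<open>auto simp: transition_chart\<close>)
  from has_derivative_unique[OF this jac_has_derivative[OF assms assms]] show ?thesis by metis
qed

lemma jac_inverse:
  assumes "i \<in> charts_at S p" "j \<in> charts_at S p"
  shows "jac i j (chart_map S i p) (jac j i (chart_map S j p) v) = v"
  using jac_chain[OF assms(2,1,2)] jac_refl[OF assms(2)] by metis

text \<open>The Jacobian is onto, so it is enough to test with its values.\<close>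

lemma metric_nondegenerate:
  assumes "i \<in> charts_at S p" "j \<in> charts_at S p"
    and "\<And>w. jac i j (chart_map S i p) w \<bullet> (metric S j (chart_map S j p) *v v) = 0"
  shows "v = 0"
proof (rule ccontr)
  assume "v \<noteq> 0"
  then have "0 < v \<bullet> (metric S j (chart_map S j p) *v v)"
    by (rule riemannian_patch.metric_pos[OF patch[OF charts_atD(1)[OF assms(2)]] chart_imageI[OF assms(2)]])
  moreover have "v \<bullet> (metric S j (chart_map S j p) *v v) = 0"
    using assms(3)[of "jac j i (chart_map S j p) v"] jac_inverse[OF assms(1,2)] by simp
  ultimately show False by simp
qed

lemma tangent_spaceI:
  assumes "\<And>i j. i \<in> charts_at S p \<Longrightarrow> j \<in> charts_at S p \<Longrightarrow> v j = jac i j (chart_map S i p) (v i)"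
    and "\<And>i. i \<notin> charts_at S p \<Longrightarrow> v i = 0"
  shows "v \<in> tangent_space S p"
  using assms unfolding tangent_space_def by blast

lemma tangent_vector_of_in: "i \<in> charts_at S p \<Longrightarrow> tangent_vector_of S i p y \<in> tangent_space S p"
  by (rule tangent_spaceI) (auto simp: tangent_vector_of_def intro: jac_chain)

lemma tangent_vector_of_self: "i \<in> charts_at S p \<Longrightarrow> tangent_vector_of S i p y i = y"
  by (simp add: tangent_vector_of_def jac_refl)

lemma tangent_space_eqI:
  assumes "i \<in> charts_at S p" "v \<in> tangent_space S p" "w \<in> tangent_space S p" "v i = w i"
  shows "v = w"
proof
  fix j show "v j = w j"
  proof (cases "j \<in> charts_at S p")
    case True
    then show ?thesis using tangent_space_jac[OF assms(1) True] assms by metis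
  next
    case False
    then show ?thesis using assms(2,3) by (simp add: tangent_space_def)
  qed
qed

lemma tangent_scale_in:
  assumes "v \<in> tangent_space S p" shows "tangent_scale c v \<in> tangent_space S p"
proof (rule tangent_spaceI)
  show "tangent_scale c v j = jac i j (chart_map S i p) (tangent_scale c v i)"
    if "i \<in> charts_at S p" "j \<in> charts_at S p" for i j
    using tangent_space_jac[OF that assms] by (simp add: tangent_scale_def linear_scale[OF jac_linear[OF that]])
qed (use assms in \<open>simp add: tangent_scale_def tangent_space_def\<close>)

section \<open>The rotation and the covariant derivative are tangent vectors\<close>

lemma rot_coords_patch_inner:
  assumes "i \<in> charts_at S p"
  shows "w \<bullet> (metric S i (chart_map S i p) *v rot_coords (metric S i (chart_map S i p)) v) =
    sqrt (det (metric S i (chart_map S i p))) * (v $ 1 * w $ 2 - v $ 2 * w $ 1)"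
proof -
  interpret riemannian_patch "chart_image S i" "metric S i" by (rule patch[OF charts_atD(1)[OF assms]])
  show ?thesis using rot_coords_inner metric_transpose det_pos chart_imageI[OF assms] by blast
qed

text \<open>\<open>J v\<close> is dual to the area form, and the area form is invariant because the Jacobian determinants
  of the transition maps are positive.\<close>

lemma rotation_in:
  assumes v: "v \<in> tangent_space S p"
  shows "rotation S p v \<in> tangent_space S p"
proof (rule tangent_spaceI)
  fix i j assume i: "i \<in> charts_at S p" and j: "j \<in> charts_at S p"
  define B where "B = jac i j (chart_map S i p)"
  define Gi where "Gi = metric S i (chart_map S i p)"
  define Gj where "Gj = metric S j (chart_map S j p)"
  define M where "M = matrix B"
  have lin: "linear B" unfolding B_def by (rule jac_linear[OF i j])
  have M: "B w = M *v w" for w unfolding M_def using lin by (simp add: matrix_works)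
  have Mpos: "0 < det M" unfolding M_def B_def by (rule jac_det_pos[OF i j])
  have G: "w \<bullet> (Gi *v z) = B w \<bullet> (Gj *v B z)" for w z
    unfolding B_def Gi_def Gj_def by (rule metric_transition[OF i j])
  have area: "B y $ 1 * B w $ 2 - B y $ 2 * B w $ 1 = det M * (y $ 1 * w $ 2 - y $ 2 * w $ 1)" for y w
    unfolding M by (simp add: matrix_vector_2 det_2 algebra_simps)
  have "Gi = transpose M ** Gj ** M"
  proof -
    have "w \<bullet> (Gi *v z) = w \<bullet> ((transpose M ** Gj ** M) *v z)" for w z
    proof -
      have "w \<bullet> ((transpose M ** Gj ** M) *v z) = w \<bullet> (transpose M *v (Gj *v (M *v z)))"
        by (simp only: matrix_vector_mul_assoc matrix_mul_assoc)
      also have "\<dots> = (M *v w) \<bullet> (Gj *v (M *v z))"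
        unfolding transpose_matrix_vector inner_commute[of w] dot_lmul_matrix by (rule inner_commute)
      finally show ?thesis using G M by simp
    qed
    then show ?thesis by (metis matrix_eq vector_eq_ldot)
  qed
  then have "det Gi = det Gj * (det M)\<^sup>2"
    by (simp add: det_mul det_transpose power2_eq_square)
  then have s: "sqrt (det Gi) = sqrt (det Gj) * det M"
    using Mpos by (simp add: real_sqrt_mult)
  define d where "d = rot_coords Gj (B (v i)) - B (rot_coords Gi (v i))"
  have "B w \<bullet> (Gj *v d) = 0" for w
  proof -
    have "B w \<bullet> (Gj *v rot_coords Gj (B (v i))) = sqrt (det Gj) * (B (v i) $ 1 * B w $ 2 - B (v i) $ 2 * B w $ 1)"
      unfolding Gj_def by (rule rot_coords_patch_inner[OF j])
    also have "\<dots> = sqrt (det Gi) * (v i $ 1 * w $ 2 - v i $ 2 * w $ 1)"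
      by (simp add: area s)
    also have "\<dots> = w \<bullet> (Gi *v rot_coords Gi (v i))"
      unfolding Gi_def by (rule rot_coords_patch_inner[OF i, symmetric])
    also have "\<dots> = B w \<bullet> (Gj *v B (rot_coords Gi (v i)))" by (rule G)
    finally show ?thesis by (simp add: d_def matrix_vector_mult_diff_distrib inner_diff_right)
  qed
  then have "d = 0" unfolding B_def Gj_def by (rule metric_nondegenerate[OF i j])
  then show "rotation S p v j = jac i j (chart_map S i p) (rotation S p v i)"
    using i j tangent_space_jac[OF i j v] by (simp add: rotation_def d_def Gi_def Gj_def B_def)
qed (simp add: rotation_def)

text \<open>The defect \<open>T\<close> of the transformation law of the Christoffel symbols is symmetric in its
  arguments, and metric compatibility in both charts makes \<open>\<langle>T(a,b),d\<rangle>\<close> skew in \<open>b,d\<close>. A form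
  that is symmetric in the first pair and skew in the second pair of arguments vanishes.\<close>

lemma cov_coords_transition:
  assumes i: "i \<in> charts_at S p" and j: "j \<in> charts_at S p"
  defines "x \<equiv> chart_map S i p"
  shows "jac i j x (cov_coords (metric S i) x a b 0) =
    cov_coords (metric S j) (chart_map S j p) (jac i j x a) (jac i j x b)
      (frechet_derivative (\<lambda>z. jac i j z b) (at x) a)"
proof -
  interpret I: riemannian_patch "chart_image S i" "metric S i" by (rule patch[OF charts_atD(1)[OF i]])
  interpret J: riemannian_patch "chart_image S j" "metric S j" by (rule patch[OF charts_atD(1)[OF j]])
  define B where "B = jac i j x"
  define y where "y = chart_map S j p"
  define A where "A b a = frechet_derivative (\<lambda>z. jac i j z b) (at x) a" for b a
  define T where "T a b = B (cov_coords (metric S i) x a b 0) - cov_coords (metric S j) y (B a) (B b) (A b a)" for a b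
  define tau where "tau a b d = T a b \<bullet> (metric S j y *v B d)" for a b d
  have ov: "open (overlap i j)" "x \<in> overlap i j"
    using overlap_open overlapI i j charts_atD unfolding x_def by blast+
  have sm: "smooth_on (overlap i j) (transition S i j)" using transition_smooth i j charts_atD by blast
  have xi: "x \<in> chart_image S i" and yj: "y \<in> chart_image S j"
    using chart_imageI i j by (auto simp: x_def y_def)
  have lin: "linear B" unfolding B_def x_def by (rule jac_linear[OF i j])
  have G: "w \<bullet> (metric S i x *v z) = B w \<bullet> (metric S j y *v B z)" for w z
    unfolding B_def x_def y_def by (rule metric_transition[OF i j])
  have A_sym: "A b a = A a b" for a b
    unfolding A_def by (rule frechet_derivative_commute[OF ov sm])
  have T_sym: "T a b = T b a" for a b
  proof -
    have "cov_coords (metric S i) x a b 0 = cov_coords (metric S i) x b a 0"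
      "cov_coords (metric S j) y (B a) (B b) (A b a) = cov_coords (metric S j) y (B b) (B a) (A a b)"
      by (simp_all add: vec_eq_iff cov_coords_nth A_sym[of a b] I.christoffel_sym[OF xi, of _ 2 1]
          J.christoffel_sym[OF yj, of _ 2 1] algebra_simps)
    then show ?thesis by (simp add: T_def)
  qed
  have skew: "tau a b d + tau a d b = 0" for a b d
  proof -
    define l where "l t = x + t *\<^sub>R a" for t
    define k where "k t = transition S i j (l t)" for t
    have l: "(l has_vector_derivative a) (at 0)" "l 0 = x"
      unfolding l_def[abs_def] by (auto intro!: derivative_eq_intros simp: has_vector_derivative_def)
    have k0: "k 0 = y" using transition_chart[OF charts_atD[OF i]] by (simp add: k_def l x_def y_def)
    have k: "(k has_vector_derivative B a) (at 0)"
    proof -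
      have "(transition S i j has_derivative B) (at (l 0))"
        unfolding l B_def x_def by (rule jac_has_derivative[OF i j])
      from diff_chain_at[OF l(1)[unfolded has_vector_derivative_def] this]
      show ?thesis by (simp add: o_def has_vector_derivative_def linear_scale[OF lin] k_def[abs_def])
    qed
    have field: "((\<lambda>t. jac i j (l t) e) has_vector_derivative A e a) (at 0)" for e
      using frechet_derivative_along_curve[OF ov(1) _ sm l(1), of "\<lambda>_. e" 0] ov(2) l(2)
        linear_0[OF lin] by (simp add: A_def B_def)
    have L: "((\<lambda>t. b \<bullet> (metric S i (l t) *v d)) has_real_derivative
        cov_coords (metric S i) x a b 0 \<bullet> (metric S i x *v d)
        + b \<bullet> (metric S i x *v cov_coords (metric S i) x a d 0)) (at 0)"
      using I.inner_along_curve[OF _ l(1), of "\<lambda>_. b" 0 "\<lambda>_. d" 0] xi l(2) by simp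
    have R: "((\<lambda>t. jac i j (l t) b \<bullet> (metric S j (k t) *v jac i j (l t) d)) has_real_derivative
        cov_coords (metric S j) y (B a) (B b) (A b a) \<bullet> (metric S j y *v B d)
        + B b \<bullet> (metric S j y *v cov_coords (metric S j) y (B a) (B d) (A d a))) (at 0)"
      using J.inner_along_curve[OF _ k field field] yj k0 l(2) by (simp add: B_def)
    have "isCont l 0" using l(1) by (rule has_vector_derivative_continuous)
    then obtain U where U: "open U" "0 \<in> U" "\<And>t. t \<in> U \<Longrightarrow> l t \<in> overlap i j"
      using isCont_open_preimage[of 0 l "overlap i j"] ov l(2) by blast
    have "((\<lambda>t. b \<bullet> (metric S i (l t) *v d)) has_real_derivative
        cov_coords (metric S j) y (B a) (B b) (A b a) \<bullet> (metric S j y *v B d)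
        + B b \<bullet> (metric S j y *v cov_coords (metric S j) y (B a) (B d) (A d a))) (at 0)"
    proof (rule has_field_derivative_transform_within_open[OF R U(1,2)])
      fix t assume "t \<in> U"
      then obtain q where q: "l t = chart_map S i q" "q \<in> chart_dom S i" "q \<in> chart_dom S j" using U(3) by blast
      then have "i \<in> charts_at S q" "j \<in> charts_at S q" using i j by (auto simp: charts_at_def)
      from metric_transition[OF this, of b d]
      show "jac i j (l t) b \<bullet> (metric S j (k t) *v jac i j (l t) d) = b \<bullet> (metric S i (l t) *v d)"
        using transition_chart[OF charts_atD(1)[OF i] q(2)] by (simp add: q(1) k_def)
    qed
    note eq = DERIV_unique[OF L this]
    define u where "u d = B (cov_coords (metric S i) x a d 0)" for d
    define w where "w d = cov_coords (metric S j) y (B a) (B d) (A d a)" for d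
    have eq: "u b \<bullet> (metric S j y *v B d) + B b \<bullet> (metric S j y *v u d) =
        w b \<bullet> (metric S j y *v B d) + B b \<bullet> (metric S j y *v w d)"
      using eq unfolding G u_def w_def .
    have sw: "v \<bullet> (metric S j y *v z) = z \<bullet> (metric S j y *v v)" for v z
      by (simp add: inner_2 matrix_vector_2 J.metric_sym[OF yj, of 2 1] algebra_simps)
    have T: "T a d = u d - w d" for d by (simp add: T_def u_def w_def)
    show ?thesis
      unfolding tau_def T inner_diff_left sw[of "u d"] sw[of "w d"] using eq by linarith
  qed
  have tau_sym: "tau a b d = tau b a d" for a b d unfolding tau_def T_sym[of a b] ..
  have tau_zero: "tau a b d = 0" for a b d
    using skew[of a b d] skew[of b d a] skew[of d a b] tau_sym[of a d b] tau_sym[of d b a] tau_sym[of b a d]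
    by linarith
  have "B w \<bullet> (metric S j y *v T a b) = 0" for w
    using tau_zero[of a b w] unfolding tau_def
    by (simp add: inner_2 matrix_vector_2 J.metric_sym[OF yj, of 2 1] algebra_simps)
  then have "T a b = 0" unfolding B_def x_def y_def by (rule metric_nondegenerate[OF i j])
  then show ?thesis unfolding T_def B_def y_def A_def by simp
qed

end

section \<open>Angular velocity with respect to a frame\<close>

lemma vec_nth_has_derivative:
  fixes y :: "real \<Rightarrow> real^2"
  assumes "(y has_vector_derivative y') (at t)"
  shows "((\<lambda>\<tau>. y \<tau> $ k) has_real_derivative y' $ k) (at t)"
  using bounded_linear.has_vector_derivative[OF bounded_linear_vec_nth assms]
  by (simp add: has_real_derivative_iff_has_vector_derivative)

context riemannian_patch
begin

lemma inner_pos: "x \<in> \<Omega> \<Longrightarrow> 0 \<le> v \<bullet> (G x *v v)"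
  using metric_pos[of x v] by (cases "v = 0") auto

lemma inner_sym: "x \<in> \<Omega> \<Longrightarrow> v \<bullet> (G x *v w) = w \<bullet> (G x *v v)"
  by (simp add: inner_2 matrix_vector_2 metric_sym[of x 2 1] algebra_simps)

lemma smooth_cov_coords:
  assumes "open N" "smooth_on N x" "x ` N \<subseteq> \<Omega>" "smooth_on N x'" "smooth_on N y" "smooth_on N y'"
  shows "smooth_on N (\<lambda>t. cov_coords G (x t) (x' t) (y t) (y' t))"
proof (rule smooth_on_vecI[OF assms(1)])
  have C: "smooth_on N (\<lambda>t. christoffel G k a b (x t))" for k a b
    by (rule smooth_on_compose[OF assms(1) open_patch assms(3,2) smooth_christoffel])
  show "smooth_on N (\<lambda>t. cov_coords G (x t) (x' t) (y t) (y' t) $ k)" for k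
    unfolding cov_coords_nth by (intro smooth_on_add smooth_on_mult smooth_on_nth C assms)
qed

lemma smooth_angular_coords:
  assumes "open N" "smooth_on N x" "x ` N \<subseteq> \<Omega>" "smooth_on N x'" "smooth_on N y" "smooth_on N y'"
  shows "smooth_on N (\<lambda>t. angular_coords G (x t) (x' t) (y t) (y' t))"
  unfolding angular_coords_def
  by (intro smooth_on_mult smooth_on_diff smooth_on_nth smooth_cov_coords assms
      smooth_on_compose[OF assms(1) open_patch assms(3,2) smooth_sqrt_det])

lemma smooth_inner:
  assumes "open N" "smooth_on N x" "x ` N \<subseteq> \<Omega>" "smooth_on N v" "smooth_on N w"
  shows "smooth_on N (\<lambda>t. v t \<bullet> (G (x t) *v w t))"
  unfolding inner_2 matrix_vector_2
  by (intro smooth_on_mult smooth_on_add smooth_on_nth[OF assms(1)] assms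
      smooth_on_compose[OF assms(1) open_patch assms(3,2) smooth_metric_nth])

abbreviation "frame \<equiv> unit_frame G"
abbreviation "coframe \<equiv> \<lambda>x. rot_coords (G x) (unit_frame G x)"

lemma smooth_coframe: "smooth_on \<Omega> coframe"
  by (rule smooth_rot_coords[OF open_patch smooth_on_ident[OF open_patch] smooth_unit_frame]) simp

lemma rot_inner:
  "x \<in> \<Omega> \<Longrightarrow> w \<bullet> (G x *v rot_coords (G x) v) = sqrt (det (G x)) * (v $ 1 * w $ 2 - v $ 2 * w $ 1)"
  by (rule rot_coords_inner[OF metric_transpose det_pos])

lemma coframe_unit: "x \<in> \<Omega> \<Longrightarrow> coframe x \<bullet> (G x *v coframe x) = 1"
  using rot_coords_isometric[OF metric_transpose det_pos] unit_frame_unit by metis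

lemma frame_coframe_orthogonal: "x \<in> \<Omega> \<Longrightarrow> frame x \<bullet> (G x *v coframe x) = 0"
  using inner_sym[of x "frame x"] rot_coords_orthogonal by simp

text \<open>The difference of both sides is orthogonal to \<open>e\<close> and to \<open>J e\<close>, hence has norm zero by
  \<open>rot_coords_pythagoras\<close>.\<close>

lemma frame_expansion:
  assumes x: "x \<in> \<Omega>"
  shows "(y \<bullet> (G x *v frame x)) *\<^sub>R frame x + (y \<bullet> (G x *v coframe x)) *\<^sub>R coframe x = y"
proof -
  define d where "d = (y \<bullet> (G x *v frame x)) *\<^sub>R frame x + (y \<bullet> (G x *v coframe x)) *\<^sub>R coframe x - y"
  have "d \<bullet> (G x *v frame x) = 0" "d \<bullet> (G x *v coframe x) = 0"
    using unit_frame_unit[OF x] coframe_unit[OF x] frame_coframe_orthogonal[OF x] inner_sym[OF x, of "coframe x" "frame x"]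
    by (simp_all add: d_def inner_diff_left inner_add_left)
  then have "d \<bullet> (G x *v d) = 0"
    using rot_coords_pythagoras[OF metric_transpose[OF x] det_pos[OF x], of d "frame x"] unit_frame_unit[OF x] by simp
  then have "d = 0" using metric_pos[OF x, of d] by fastforce
  then show ?thesis by (simp add: d_def)
qed

lemma frame_coefficients_unit:
  assumes "x \<in> \<Omega>"
  shows "(y \<bullet> (G x *v frame x))\<^sup>2 + (y \<bullet> (G x *v coframe x))\<^sup>2 = y \<bullet> (G x *v y)"
  using rot_coords_pythagoras[OF metric_transpose[OF assms] det_pos[OF assms], of y "frame x"]
    unit_frame_unit[OF assms] by simp

text \<open>For \<open>p = cos \<theta>\<close> and \<open>q = sin \<theta>\<close> the right-hand side is $\dot\theta + \alpha(\dot x)$.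
  Expanding $\langle D_t y, J y\rangle$ in the orthonormal frame leaves only the connection coefficient
  $\langle D_t e, J e\rangle = - \langle D_t (J e), e\rangle$.\<close>

lemma angular_coords_frame:
  assumes x: "x t \<in> \<Omega>" "(x has_vector_derivative x') (at t)"
    and p: "(p has_real_derivative p') (at t)" and q: "(q has_real_derivative q') (at t)"
    and y: "((\<lambda>\<tau>. p \<tau> *\<^sub>R frame (x \<tau>) + q \<tau> *\<^sub>R coframe (x \<tau>)) has_vector_derivative y') (at t)"
  shows "angular_coords G (x t) x' (p t *\<^sub>R frame (x t) + q t *\<^sub>R coframe (x t)) y' =
    p t * q' - q t * p' + ((p t)\<^sup>2 + (q t)\<^sup>2) *
      (frame_form G 1 (x t) * x' $ 1 + frame_form G 2 (x t) * x' $ 2)"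
proof -
  define e where "e \<tau> = frame (x \<tau>)" for \<tau>
  define f where "f \<tau> = coframe (x \<tau>)" for \<tau>
  have along: "((\<lambda>\<tau>. F (x \<tau>)) has_vector_derivative frechet_derivative F (at (x t)) x') (at t)"
    if "smooth_on \<Omega> F" for F :: "real^2 \<Rightarrow> real^2"
  proof -
    have F: "(F has_derivative frechet_derivative F (at (x t))) (at (x t))"
      by (rule smooth_on_has_derivative[OF that x(1)])
    from diff_chain_at[OF x(2)[unfolded has_vector_derivative_def] F]
    show ?thesis
      by (simp add: o_def has_vector_derivative_def linear_scale[OF has_derivative_linear[OF F]])
  qed
  obtain e' where e': "(e has_vector_derivative e') (at t)"
    unfolding e_def[abs_def] using along[OF smooth_unit_frame] by blast
  obtain f' where f': "(f has_vector_derivative f') (at t)"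
    unfolding f_def[abs_def] using along[OF smooth_coframe] by blast
  define De where "De = cov_coords G (x t) x' (e t) e'"
  define Df where "Df = cov_coords G (x t) x' (f t) f'"
  define g where "g v w = v \<bullet> (G (x t) *v w)" for v w
  have g_sym: "g v w = g w v" for v w unfolding g_def by (rule inner_sym[OF x(1)])
  have "isCont x t" using x(2) by (rule has_vector_derivative_continuous)
  then obtain U where U: "open U" "t \<in> U" "\<And>\<tau>. \<tau> \<in> U \<Longrightarrow> x \<tau> \<in> \<Omega>"
    using isCont_open_preimage[of t x \<Omega>] open_patch x(1) by blast
  have const: "g (cov_coords G (x t) x' (v t) v') (w t) + g (v t) (cov_coords G (x t) x' (w t) w') = 0"
    if "(v has_vector_derivative v') (at t)" "(w has_vector_derivative w') (at t)"
      "\<And>\<tau>. \<tau> \<in> U \<Longrightarrow> v \<tau> \<bullet> (G (x \<tau>) *v w \<tau>) = c" for v w v' w' c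
  proof -
    have "((\<lambda>_. c) has_real_derivative 0) (at t)" by simp
    then have "((\<lambda>\<tau>. v \<tau> \<bullet> (G (x \<tau>) *v w \<tau>)) has_real_derivative 0) (at t)"
      by (rule has_field_derivative_transform_within_open[OF _ U(1,2)]) (simp add: that(3))
    from DERIV_unique[OF inner_along_curve[OF x that(1,2)] this] show ?thesis by (simp add: g_def)
  qed
  have "g De (e t) = 0" "g Df (f t) = 0" and skew: "g De (f t) + g Df (e t) = 0"
    using const[OF e' e', of 1] const[OF f' f', of 1] const[OF e' f', of 0] U(3)
      unit_frame_unit coframe_unit frame_coframe_orthogonal
      g_sym[of "e t" De] g_sym[of "f t" Df] g_sym[of "e t" Df]
    by (auto simp: e_def f_def De_def Df_def)
  note orth = this
  define W where "W v w = sqrt (det (G (x t))) * (v $ 1 * w $ 2 - v $ 2 * w $ 1)" for v w :: "real^2"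
  have We: "W (e t) w = g w (f t)" for w
    unfolding W_def g_def e_def f_def by (rule rot_inner[OF x(1), symmetric])
  have Wf: "W (f t) w = - g w (e t)" for w
  proof -
    have "W (f t) w = (sqrt (det (G (x t))) * f t $ 1) * w $ 2 - (sqrt (det (G (x t))) * f t $ 2) * w $ 1"
      by (simp add: W_def algebra_simps)
    then show ?thesis
      unfolding f_def rot_coords_scaled[OF det_pos[OF x(1)]]
      by (simp add: g_def e_def inner_2 algebra_simps)
  qed
  have gef: "g (f t) (f t) = 1" "g (e t) (f t) = 0"
    using coframe_unit[OF x(1)] frame_coframe_orthogonal[OF x(1)] by (auto simp: g_def e_def f_def)
  have form: "W (e t) De = frame_form G 1 (x t) * x' $ 1 + frame_form G 2 (x t) * x' $ 2"
  proof -
    have e1: "e \<tau> $ 1 = 0" for \<tau> by (simp add: e_def unit_frame_def axis_2_nth)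
    have "((\<lambda>\<tau>. e \<tau> $ 1) has_real_derivative e' $ 1) (at t)" by (rule vec_nth_has_derivative[OF e'])
    moreover have "((\<lambda>\<tau>. e \<tau> $ 1) has_real_derivative 0) (at t)" unfolding e1 by simp
    ultimately have e'1: "e' $ 1 = 0" by (rule DERIV_unique)
    have e2: "e t $ 2 * e t $ 2 = 1 / G (x t) $ 2 $ 2"
      using metric_22_pos[OF x(1)] by (simp add: e_def unit_frame_def axis_2_nth)
    have "W (e t) De = - (sqrt (det (G (x t))) * (christoffel G 1 1 2 (x t) * x' $ 1
        + christoffel G 1 2 2 (x t) * x' $ 2)) * (e t $ 2 * e t $ 2)"
      by (simp add: W_def De_def cov_coords_nth e1 e'1 algebra_simps)
    also have "\<dots> = frame_form G 1 (x t) * x' $ 1 + frame_form G 2 (x t) * x' $ 2"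
      unfolding e2 frame_form_def by (simp add: algebra_simps add_divide_distrib)
    finally show ?thesis .
  qed
  have "((\<lambda>\<tau>. p \<tau> *\<^sub>R e \<tau> + q \<tau> *\<^sub>R f \<tau>) has_vector_derivative
      (p t *\<^sub>R e' + p' *\<^sub>R e t) + (q t *\<^sub>R f' + q' *\<^sub>R f t)) (at t)"
    by (intro has_vector_derivative_add has_vector_derivative_scaleR p q e' f')
  then have y': "y' = (p t *\<^sub>R e' + p' *\<^sub>R e t) + (q t *\<^sub>R f' + q' *\<^sub>R f t)"
    using vector_derivative_unique_at[OF y] by (simp add: e_def f_def)
  have Dy: "cov_coords G (x t) x' (p t *\<^sub>R e t + q t *\<^sub>R f t) y' =
      p' *\<^sub>R e t + q' *\<^sub>R f t + p t *\<^sub>R De + q t *\<^sub>R Df"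
    by (simp add: vec_eq_iff cov_coords_nth De_def Df_def y' algebra_simps)
  have "angular_coords G (x t) x' (p t *\<^sub>R e t + q t *\<^sub>R f t) y' =
      (p t * q' - q t * p') * W (e t) (f t) + (p t)\<^sup>2 * W (e t) De + p t * q t * (W (e t) Df + W (f t) De)
      + (q t)\<^sup>2 * W (f t) Df"
    unfolding angular_coords_def Dy W_def by (simp add: power2_eq_square algebra_simps)
  also have "\<dots> = p t * q' - q t * p' + ((p t)\<^sup>2 + (q t)\<^sup>2) * W (e t) De"
    using orth unfolding We Wf gef eq_neg_iff_add_eq_0[THEN iffD2, OF skew[unfolded add.commute[of "g De (f t)"]]]
    by (simp add: algebra_simps)
  finally show ?thesis unfolding form by (simp add: e_def f_def)
qed

end

section \<open>Curves and tangent fields on the surface\<close>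

definition smooth_surface_curve :: "('p, 'i) surface \<Rightarrow> real set \<Rightarrow> (real \<Rightarrow> 'p) \<Rightarrow> bool" where
  "smooth_surface_curve S T \<gamma> \<longleftrightarrow> open T \<and> continuous_map (top_of_set T) (points S) \<gamma> \<and>
     (\<forall>i\<in>charts S. smooth_on (T \<inter> \<gamma> -` chart_dom S i) (\<lambda>\<tau>. chart_map S i (\<gamma> \<tau>)))"

definition smooth_tangent_field ::
  "('p, 'i) surface \<Rightarrow> real set \<Rightarrow> (real \<Rightarrow> 'p) \<Rightarrow> (real \<Rightarrow> 'i tangent_vector) \<Rightarrow> bool" where
  "smooth_tangent_field S T \<gamma> v \<longleftrightarrow> (\<forall>\<tau>\<in>T. v \<tau> \<in> tangent_space S (\<gamma> \<tau>)) \<and>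
     (\<forall>i\<in>charts S. smooth_on (T \<inter> \<gamma> -` chart_dom S i) (\<lambda>\<tau>. v \<tau> i))"

lemma smooth_unit_tangent_mapD:
  assumes "smooth_unit_tangent_map S T \<gamma> u"
  shows "smooth_surface_curve S T \<gamma>" "smooth_tangent_field S T \<gamma> u"
  using assms unfolding smooth_unit_tangent_map_def smooth_surface_curve_def smooth_tangent_field_def
    unit_tangent_space_def by auto

context oriented_surface
begin

lemma chart_preimage_open:
  assumes "open T" "continuous_map (top_of_set T) (points S) f" "openin (points S) U"
  shows "open (T \<inter> f -` U)"
proof -
  have "openin (top_of_set T) {\<tau> \<in> topspace (top_of_set T). f \<tau> \<in> U}"
    by (rule openin_continuous_map_preimage[OF assms(2,3)])
  moreover have "{\<tau> \<in> topspace (top_of_set T). f \<tau> \<in> U} = T \<inter> f -` U" by auto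
  ultimately show ?thesis using assms(1) by (simp add: openin_open_eq)
qed

lemma continuous_map_in_topspace:
  assumes "continuous_map (top_of_set T) (points S) f" "t \<in> T"
  shows "f t \<in> topspace (points S)"
  using assms by (auto simp: continuous_map_def Pi_iff)

lemma velocity_chart:
  "i \<in> charts_at S (\<gamma> t) \<Longrightarrow> velocity S \<gamma> t i = vector_derivative (\<lambda>\<tau>. chart_map S i (\<gamma> \<tau>)) (at t)"
  by (simp add: velocity_def)

lemma cov_deriv_chart:
  "i \<in> charts_at S (\<gamma> t) \<Longrightarrow> cov_deriv S \<gamma> v t i =
    cov_coords (metric S i) (chart_map S i (\<gamma> t)) (velocity S \<gamma> t i) (v t i) (vector_derivative (\<lambda>\<tau>. v \<tau> i) (at t))"
  by (simp add: cov_deriv_def cov_coords_def)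

context
  fixes T \<gamma> assumes curve: "smooth_surface_curve S T \<gamma>"
begin

lemma curve_chart_open: "i \<in> charts S \<Longrightarrow> open (T \<inter> \<gamma> -` chart_dom S i)"
  using curve chart_preimage_open chart_open unfolding smooth_surface_curve_def by blast

lemma curve_chart_mem: "t \<in> T \<Longrightarrow> i \<in> charts_at S (\<gamma> t) \<Longrightarrow> t \<in> T \<inter> \<gamma> -` chart_dom S i"
  by (simp add: charts_at_def)

lemma curve_velocity:
  assumes "t \<in> T" "i \<in> charts_at S (\<gamma> t)"
  shows "((\<lambda>\<tau>. chart_map S i (\<gamma> \<tau>)) has_vector_derivative velocity S \<gamma> t i) (at t)"
  unfolding velocity_chart[where \<gamma> = \<gamma> and t = t, OF assms(2)]
  by (rule smooth_on_has_vector_derivative[OF _ curve_chart_mem[OF assms]])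
     (use curve charts_atD(1)[OF assms(2)] in \<open>auto simp: smooth_surface_curve_def\<close>)

lemma field_has_derivative:
  assumes "smooth_tangent_field S T \<gamma> v" "t \<in> T" "i \<in> charts_at S (\<gamma> t)"
  shows "((\<lambda>\<tau>. v \<tau> i) has_vector_derivative vector_derivative (\<lambda>\<tau>. v \<tau> i) (at t)) (at t)"
  by (rule smooth_on_has_vector_derivative[OF _ curve_chart_mem[OF assms(2,3)]])
     (use assms(1) charts_atD(1)[OF assms(3)] in \<open>auto simp: smooth_tangent_field_def\<close>)

lemma charts_overlap_open:
  assumes "t \<in> T" "i \<in> charts_at S (\<gamma> t)" "j \<in> charts_at S (\<gamma> t)"
  shows "open ((T \<inter> \<gamma> -` chart_dom S i) \<inter> (T \<inter> \<gamma> -` chart_dom S j))"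
    and "t \<in> (T \<inter> \<gamma> -` chart_dom S i) \<inter> (T \<inter> \<gamma> -` chart_dom S j)"
  using assms curve_chart_mem charts_atD by (auto intro!: open_Int curve_chart_open)

lemma velocity_field: "smooth_tangent_field S T \<gamma> (velocity S \<gamma>)"
  unfolding smooth_tangent_field_def
proof (intro conjI ballI)
  fix t assume t: "t \<in> T"
  show "velocity S \<gamma> t \<in> tangent_space S (\<gamma> t)"
  proof (rule tangent_spaceI)
    fix i j assume i: "i \<in> charts_at S (\<gamma> t)" and j: "j \<in> charts_at S (\<gamma> t)"
    note U = charts_overlap_open[OF t i j]
    from diff_chain_at[OF curve_velocity[OF t i, unfolded has_vector_derivative_def] jac_has_derivative[OF i j]]
    have "((\<lambda>\<tau>. transition S i j (chart_map S i (\<gamma> \<tau>))) has_vector_derivative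
        jac i j (chart_map S i (\<gamma> t)) (velocity S \<gamma> t i)) (at t)"
      by (simp add: o_def has_vector_derivative_def linear_scale[OF jac_linear[OF i j]])
    then have "((\<lambda>\<tau>. chart_map S j (\<gamma> \<tau>)) has_vector_derivative
        jac i j (chart_map S i (\<gamma> t)) (velocity S \<gamma> t i)) (at t)"
      by (rule has_vector_derivative_transform_within_open[OF _ U])
         (use transition_chart[OF charts_atD(1)[OF i]] in simp)
    then show "velocity S \<gamma> t j = jac i j (chart_map S i (\<gamma> t)) (velocity S \<gamma> t i)"
      unfolding velocity_chart[where \<gamma> = \<gamma> and t = t, OF j] by (rule vector_derivative_at)
  qed (simp add: velocity_def)
next
  fix i assume i: "i \<in> charts S"
  have "smooth_on (T \<inter> \<gamma> -` chart_dom S i) (\<lambda>t. vector_derivative (\<lambda>\<tau>. chart_map S i (\<gamma> \<tau>)) (at t))"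
    using curve i by (intro smooth_on_vector_derivative curve_chart_open) (auto simp: smooth_surface_curve_def)
  then show "smooth_on (T \<inter> \<gamma> -` chart_dom S i) (\<lambda>t. velocity S \<gamma> t i)"
    by (rule smooth_on_cong[OF curve_chart_open[OF i]]) (use i in \<open>auto simp: velocity_def charts_at_def\<close>)
qed

text \<open>The second derivatives of the transition map that appear in the derivative of the components
  are those in the transformation law of the Christoffel symbols.\<close>

lemma cov_deriv_in:
  assumes v: "smooth_tangent_field S T \<gamma> v" and t: "t \<in> T"
  shows "cov_deriv S \<gamma> v t \<in> tangent_space S (\<gamma> t)"
proof (rule tangent_spaceI)
  fix i j assume i: "i \<in> charts_at S (\<gamma> t)" and j: "j \<in> charts_at S (\<gamma> t)"
  note U = charts_overlap_open[OF t i j]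
  let ?x = "chart_map S i (\<gamma> t)" and ?v = "velocity S \<gamma> t i"
  let ?v' = "vector_derivative (\<lambda>\<tau>. v \<tau> i) (at t)"
  let ?A = "frechet_derivative (\<lambda>z. jac i j z (v t i)) (at ?x) ?v"
  have vt: "v \<tau> \<in> tangent_space S (\<gamma> \<tau>)" if "\<tau> \<in> T" for \<tau>
    using v that by (simp add: smooth_tangent_field_def)
  have "((\<lambda>\<tau>. jac i j (chart_map S i (\<gamma> \<tau>)) (v \<tau> i)) has_vector_derivative jac i j ?x ?v' + ?A) (at t)"
    by (rule frechet_derivative_along_curve[OF overlap_open _ transition_smooth curve_velocity[OF t i]
          field_has_derivative[OF v t i]])
       (use i j charts_atD overlapI in blast)+
  then have "((\<lambda>\<tau>. v \<tau> j) has_vector_derivative jac i j ?x ?v' + ?A) (at t)"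
  proof (rule has_vector_derivative_transform_within_open[OF _ U])
    fix \<tau> assume "\<tau> \<in> (T \<inter> \<gamma> -` chart_dom S i) \<inter> (T \<inter> \<gamma> -` chart_dom S j)"
    then have "i \<in> charts_at S (\<gamma> \<tau>)" "j \<in> charts_at S (\<gamma> \<tau>)" "\<tau> \<in> T"
      using i j by (auto simp: charts_at_def)
    then show "jac i j (chart_map S i (\<gamma> \<tau>)) (v \<tau> i) = v \<tau> j"
      using tangent_space_jac vt by metis
  qed
  then have vj: "vector_derivative (\<lambda>\<tau>. v \<tau> j) (at t) = jac i j ?x ?v' + ?A" by (rule vector_derivative_at)
  have split: "cov_coords G x a b b' = cov_coords G x a b 0 + b'" for G x a b b'
    by (simp add: cov_coords_def)
  have "velocity S \<gamma> t \<in> tangent_space S (\<gamma> t)"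
    using velocity_field t by (simp add: smooth_tangent_field_def)
  then have "cov_deriv S \<gamma> v t j = cov_coords (metric S j) (chart_map S j (\<gamma> t))
      (jac i j ?x ?v) (jac i j ?x (v t i)) (jac i j ?x ?v' + ?A)"
    unfolding cov_deriv_chart[where \<gamma> = \<gamma> and t = t, OF j] vj using tangent_space_jac[OF i j] vt[OF t] by simp
  also have "\<dots> = cov_coords (metric S j) (chart_map S j (\<gamma> t)) (jac i j ?x ?v) (jac i j ?x (v t i)) ?A + jac i j ?x ?v'"
    by (simp add: cov_coords_def)
  also have "\<dots> = jac i j ?x (cov_coords (metric S i) ?x ?v (v t i) 0 + ?v')"
    unfolding cov_coords_transition[OF i j, symmetric] linear_add[OF jac_linear[OF i j]] ..
  also have "\<dots> = jac i j ?x (cov_deriv S \<gamma> v t i)"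
    unfolding cov_deriv_chart[where \<gamma> = \<gamma> and t = t, OF i] by (simp add: cov_coords_def add.commute)
  finally show "cov_deriv S \<gamma> v t j = jac i j ?x (cov_deriv S \<gamma> v t i)" .
qed (simp add: cov_deriv_def)

end

lemma axial_velocity_chart:
  assumes u: "smooth_unit_tangent_map S T \<gamma> u" and t: "t \<in> T" and i: "i \<in> charts_at S (\<gamma> t)"
  shows "axial_velocity S \<gamma> u t = angular_coords (metric S i) (chart_map S i (\<gamma> t)) (velocity S \<gamma> t i)
    (u t i) (vector_derivative (\<lambda>\<tau>. u \<tau> i) (at t))"
proof -
  note c = smooth_unit_tangent_mapD[OF u]
  have ut: "u t \<in> tangent_space S (\<gamma> t)" using c(2) t by (simp add: smooth_tangent_field_def)
  have "axial_velocity S \<gamma> u t = cov_deriv S \<gamma> u t i \<bullet>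
      (metric S i (chart_map S i (\<gamma> t)) *v rotation S (\<gamma> t) (u t) i)"
    unfolding axial_velocity_def
    by (rule riem_inner_chart[OF surface i cov_deriv_in[OF c t] rotation_in[OF ut]])
  also have "rotation S (\<gamma> t) (u t) i = rot_coords (metric S i (chart_map S i (\<gamma> t))) (u t i)"
    using i by (simp add: rotation_def)
  finally show ?thesis
    unfolding rot_coords_patch_inner[OF i] angular_coords_def cov_deriv_chart[where \<gamma> = \<gamma> and t = t and v = u, OF i] .
qed

lemma riem_norm_squared_chart:
  assumes i: "i \<in> charts_at S p" and v: "v \<in> tangent_space S p"
  shows "(riem_norm S p v)\<^sup>2 = v i \<bullet> (metric S i (chart_map S i p) *v v i)"
  unfolding riem_norm_def riem_inner_chart[OF surface i v v]
  using riemannian_patch.inner_pos[OF patch[OF charts_atD(1)[OF i]] chart_imageI[OF i]] by simp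

lemma kinetic_energy_chart:
  assumes u: "smooth_unit_tangent_map S T \<gamma> u" and t: "t \<in> T" and i: "i \<in> charts_at S (\<gamma> t)"
  shows "kinetic_energy S m I\<^sub>a \<gamma> u t =
    1/2 * m * (velocity S \<gamma> t i \<bullet> (metric S i (chart_map S i (\<gamma> t)) *v velocity S \<gamma> t i)) +
    1/2 * I\<^sub>a * (angular_coords (metric S i) (chart_map S i (\<gamma> t)) (velocity S \<gamma> t i)
    (u t i) (vector_derivative (\<lambda>\<tau>. u \<tau> i) (at t)))\<^sup>2"
proof -
  note c = smooth_unit_tangent_mapD[OF u]
  have "velocity S \<gamma> t \<in> tangent_space S (\<gamma> t)"
    using velocity_field[OF c(1)] t by (simp add: smooth_tangent_field_def)
  then have "(riem_norm S (\<gamma> t) (velocity S \<gamma> t))\<^sup>2 =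
      velocity S \<gamma> t i \<bullet> (metric S i (chart_map S i (\<gamma> t)) *v velocity S \<gamma> t i)"
    by (rule riem_norm_squared_chart[OF i])
  then show ?thesis unfolding kinetic_energy_def axial_velocity_chart[OF assms] by simp
qed

lemma axial_velocity_energy_smooth:
  assumes u: "smooth_unit_tangent_map S T \<gamma> u" and i: "i \<in> charts S"
  shows "smooth_on (T \<inter> \<gamma> -` chart_dom S i) (axial_velocity S \<gamma> u)"
    and "smooth_on (T \<inter> \<gamma> -` chart_dom S i) (kinetic_energy S m I\<^sub>a \<gamma> u)"
proof -
  interpret riemannian_patch "chart_image S i" "metric S i" by (rule patch[OF i])
  note c = smooth_unit_tangent_mapD[OF u]
  define N where "N = T \<inter> \<gamma> -` chart_dom S i"
  have N: "open N" unfolding N_def by (rule curve_chart_open[OF c(1) i])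
  have at: "i \<in> charts_at S (\<gamma> t)" "t \<in> T" if "t \<in> N" for t
    using that i by (auto simp: N_def charts_at_def)
  have x: "smooth_on N (\<lambda>t. chart_map S i (\<gamma> t))" "(\<lambda>t. chart_map S i (\<gamma> t)) ` N \<subseteq> chart_image S i"
    using c(1) i at(1) chart_imageI by (auto simp: smooth_surface_curve_def N_def)
  have v: "smooth_on N (\<lambda>t. velocity S \<gamma> t i)" and y: "smooth_on N (\<lambda>t. u t i)"
    using velocity_field[OF c(1)] c(2) i by (auto simp: smooth_tangent_field_def N_def)
  have a: "smooth_on N (\<lambda>t. angular_coords (metric S i) (chart_map S i (\<gamma> t)) (velocity S \<gamma> t i)
    (u t i) (vector_derivative (\<lambda>\<tau>. u \<tau> i) (at t)))"
    by (intro smooth_angular_coords N x v y smooth_on_vector_derivative)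
  show "smooth_on (T \<inter> \<gamma> -` chart_dom S i) (axial_velocity S \<gamma> u)"
    unfolding N_def[symmetric]
    by (rule smooth_on_cong[OF N a]) (rule axial_velocity_chart[OF u at(2,1), symmetric])
  have k: "smooth_on N (\<lambda>t. 1/2 * m * (velocity S \<gamma> t i \<bullet> (metric S i (chart_map S i (\<gamma> t)) *v velocity S \<gamma> t i)) +
    1/2 * I\<^sub>a * (angular_coords (metric S i) (chart_map S i (\<gamma> t)) (velocity S \<gamma> t i)
    (u t i) (vector_derivative (\<lambda>\<tau>. u \<tau> i) (at t)))\<^sup>2)"
    unfolding power2_eq_square
    by (intro smooth_on_add smooth_on_mult smooth_on_const smooth_inner N x v a)
  show "smooth_on (T \<inter> \<gamma> -` chart_dom S i) (kinetic_energy S m I\<^sub>a \<gamma> u)"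
    unfolding N_def[symmetric]
    by (rule smooth_on_cong[OF N k]) (rule kinetic_energy_chart[OF u at(2,1), symmetric])
qed

lemma axial_velocity_energy_continuous:
  assumes u: "smooth_unit_tangent_map S T \<gamma> u"
  shows "continuous_on T (axial_velocity S \<gamma> u)" "continuous_on T (kinetic_energy S m I\<^sub>a \<gamma> u)"
proof -
  note c = smooth_unit_tangent_mapD(1)[OF u]
  have "isCont (axial_velocity S \<gamma> u) t \<and> isCont (kinetic_energy S m I\<^sub>a \<gamma> u) t" if t: "t \<in> T" for t
  proof -
    obtain i where i: "i \<in> charts_at S (\<gamma> t)"
      using chart_exists continuous_map_in_topspace[OF _ t] c unfolding smooth_surface_curve_def by metis
    have N: "open (T \<inter> \<gamma> -` chart_dom S i)" by (rule curve_chart_open[OF c charts_atD(1)[OF i]])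
    show ?thesis
      using smooth_on_continuous[OF axial_velocity_energy_smooth(1)[OF u charts_atD(1)[OF i]]]
        smooth_on_continuous[OF axial_velocity_energy_smooth(2)[OF u charts_atD(1)[OF i], of m I\<^sub>a]]
        continuous_on_eq_continuous_at[OF N] curve_chart_mem[OF c t i] by blast
  qed
  then show "continuous_on T (axial_velocity S \<gamma> u)" "continuous_on T (kinetic_energy S m I\<^sub>a \<gamma> u)"
    by (simp_all add: continuous_at_imp_continuous_on)
qed

end

section \<open>First variation of the energy density\<close>

text \<open>Joint smoothness supplies the continuity of the partial derivative in the parameter.\<close>

lemma leibniz_rule_smooth:
  fixes e :: "real \<times> real \<Rightarrow> real"
  assumes e: "smooth_on ({-\<epsilon><..<\<epsilon>} \<times> N) e" and "\<epsilon> > 0" and N: "{l..r} \<subseteq> N"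
    and D: "\<And>t. t \<in> {l..r} \<Longrightarrow> ((\<lambda>s. e (s, t)) has_real_derivative D t) (at 0)"
  shows "((\<lambda>s. integral {l..r} (\<lambda>t. e (s, t))) has_real_derivative integral {l..r} D) (at 0)"
proof -
  let ?U = "{-\<epsilon><..<\<epsilon>}"
  define e' where "e' s t = frechet_derivative e (at (s, t)) (1, 0)" for s t
  have d: "((\<lambda>s. e (s, t)) has_real_derivative e' s t) (at s)" if "s \<in> ?U" "t \<in> {l..r}" for s t
  proof -
    have E: "(e has_derivative frechet_derivative e (at (s, t))) (at (s, t))"
      by (rule smooth_on_has_derivative[OF e]) (use that N in auto)
    have "((\<lambda>s. (s, t)) has_derivative (\<lambda>k. (k, 0))) (at s)"
      by (auto intro!: derivative_eq_intros)
    from diff_chain_at[OF this E]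
    have "((\<lambda>s. e (s, t)) has_derivative (\<lambda>k. frechet_derivative e (at (s, t)) (k *\<^sub>R (1, 0)))) (at s)"
      by (simp add: o_def)
    then show ?thesis
      unfolding linear_scale[OF has_derivative_linear[OF E]]
      by (simp add: has_field_derivative_def e'_def mult.commute[of _ "frechet_derivative e (at (s, t)) (1, 0)"])
  qed
  have sub: "?U \<times> {l..r} \<subseteq> ?U \<times> N" using N by blast
  have c: "continuous_on (?U \<times> {l..r}) (\<lambda>(s, t). e' s t)"
    using continuous_on_subset[OF smooth_on_continuous[OF smooth_on_frechet_derivative[OF e]] sub]
    by (auto simp: e'_def case_prod_beta)
  have ce: "continuous_on (?U \<times> {l..r}) e"
    using continuous_on_subset[OF smooth_on_continuous[OF e] sub] .
  have "((\<lambda>s. integral (cbox l r) (\<lambda>t. e (s, t))) has_field_derivative integral (cbox l r) (e' 0)) (at 0 within ?U)"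
  proof (rule leibniz_rule_field_derivative)
    show "((\<lambda>s. e (s, t)) has_field_derivative e' s t) (at s within ?U)"
      if "s \<in> ?U" "t \<in> cbox l r" for s t
      using d that by (auto intro: has_field_derivative_at_within)
    show "(\<lambda>t. e (s, t)) integrable_on cbox l r" if "s \<in> ?U" for s
      by (rule integrable_continuous, rule continuous_on_compose2[OF ce])
         (use that in \<open>auto intro!: continuous_intros\<close>)
  qed (use c \<open>\<epsilon> > 0\<close> in auto)
  moreover have "at (0::real) within ?U = at 0" by (rule at_within_open) (use \<open>\<epsilon> > 0\<close> in auto)
  moreover have "integral {l..r} (e' 0) = integral {l..r} D"
    by (rule Henstock_Kurzweil_Integration.integral_cong)
       (use DERIV_unique[OF d D] \<open>\<epsilon> > 0\<close> in auto)
  ultimately show ?thesis by simp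
qed

context riemannian_patch
begin

lemma frame_combination_norm:
  assumes x: "x \<in> \<Omega>"
  shows "(p *\<^sub>R frame x + q *\<^sub>R coframe x) \<bullet> (G x *v (p *\<^sub>R frame x + q *\<^sub>R coframe x)) = p\<^sup>2 + q\<^sup>2"
proof -
  define g where "g v w = v \<bullet> (G x *v w)" for v w
  have "g (p *\<^sub>R frame x + q *\<^sub>R coframe x) (p *\<^sub>R frame x + q *\<^sub>R coframe x) =
      p * p * g (frame x) (frame x) + p * q * g (frame x) (coframe x) + q * p * g (coframe x) (frame x)
      + q * q * g (coframe x) (coframe x)"
    by (simp add: g_def matrix_vector_right_distrib scaleR_matrix_vector_assoc[symmetric]
        matrix_vector_mult_scaleR inner_add_left inner_add_right algebra_simps)
  moreover have "g (coframe x) (frame x) = 0" unfolding g_def by (rule rot_coords_orthogonal)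
  ultimately show ?thesis
    unfolding g_def using unit_frame_unit[OF x] coframe_unit[OF x] frame_coframe_orthogonal[OF x]
    by (simp add: power2_eq_square)
qed

text \<open>The energy density of the variation that displaces the centre by \<open>s \<phi> \<xi>\<close> and turns the disk
  by the angle \<open>s \<sigma> \<phi>\<close>; here \<open>f\<close> and \<open>g\<close> are the values of \<open>\<phi>\<close> and \<open>\<phi>'\<close>.\<close>

lemma energy_variation:
  fixes y v \<xi> :: "real^2" and m k W f g \<sigma> :: real
  assumes y: "y \<in> \<Omega>"
  defines "\<omega> \<equiv> W + (frame_form G 1 y * v $ 1 + frame_form G 2 y * v $ 2)"
  shows "((\<lambda>s. 1/2 * m * ((v + (s * g) *\<^sub>R \<xi>) \<bullet> (G (y + (s * f) *\<^sub>R \<xi>) *v (v + (s * g) *\<^sub>R \<xi>)))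
      + 1/2 * k * (W + s * (\<sigma> * g) + (frame_form G 1 (y + (s * f) *\<^sub>R \<xi>) * (v + (s * g) *\<^sub>R \<xi>) $ 1
          + frame_form G 2 (y + (s * f) *\<^sub>R \<xi>) * (v + (s * g) *\<^sub>R \<xi>) $ 2))\<^sup>2)
    has_real_derivative
      (m / 2 * (\<Sum>a\<in>UNIV. \<xi> $ a * (\<Sum>b\<in>UNIV. \<Sum>c\<in>UNIV. partial_deriv a (\<lambda>y. G y $ b $ c) y * v $ b * v $ c))
        + k * \<omega> * (\<Sum>a\<in>UNIV. \<xi> $ a * (\<Sum>b\<in>UNIV. partial_deriv a (frame_form G b) y * v $ b))) * f
      + (m * (\<xi> \<bullet> (G y *v v)) + k * \<omega> * (\<sigma> + (frame_form G 1 y * \<xi> $ 1 + frame_form G 2 y * \<xi> $ 2))) * g) (at 0)"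
proof -
  define X where "X s = y + (s * f) *\<^sub>R \<xi>" for s
  define V where "V s = v + (s * g) *\<^sub>R \<xi>" for s
  have X: "(X has_vector_derivative f *\<^sub>R \<xi>) (at 0)" "X 0 = y" and V0: "V 0 = v"
    by (auto intro!: derivative_eq_intros simp: X_def[abs_def] V_def has_vector_derivative_def)
  have V: "((\<lambda>s. V s $ c) has_real_derivative g * \<xi> $ c) (at 0)" for c
    unfolding V_def by (auto intro!: derivative_eq_intros)
  have Gd: "((\<lambda>s. G (X s) $ b $ c) has_real_derivative
      (partial_deriv 1 (\<lambda>y. G y $ b $ c) y * \<xi> $ 1 + partial_deriv 2 (\<lambda>y. G y $ b $ c) y * \<xi> $ 2) * f) (at 0)" for b c
    using metric_along_curve[OF _ X(1), of b c] y by (simp add: X(2) algebra_simps)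
  have Fd: "((\<lambda>s. frame_form G b (X s)) has_real_derivative
      (partial_deriv 1 (frame_form G b) y * \<xi> $ 1 + partial_deriv 2 (frame_form G b) y * \<xi> $ 2) * f) (at 0)" for b
    using partial_deriv_chain[OF _ X(1), of "frame_form G b"] smooth_on_differentiable[OF smooth_frame_form y]
    by (simp add: X(2) algebra_simps)
  note quad = DERIV_mult[OF V DERIV_add[OF DERIV_mult[OF Gd V] DERIV_mult[OF Gd V]]]
  have A: "((\<lambda>s. W + s * (\<sigma> * g) + (frame_form G 1 (X s) * V s $ 1 + frame_form G 2 (X s) * V s $ 2))
      has_real_derivative \<sigma> * g + ((\<Sum>a\<in>UNIV. \<xi> $ a * (\<Sum>b\<in>UNIV. partial_deriv a (frame_form G b) y * v $ b)) * f
        + (frame_form G 1 y * \<xi> $ 1 + frame_form G 2 y * \<xi> $ 2) * g)) (at 0)"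
    by (rule DERIV_cong[OF DERIV_add[OF DERIV_add[OF DERIV_const DERIV_cmult_right[OF DERIV_ident]]
          DERIV_add[OF DERIV_mult[OF Fd V] DERIV_mult[OF Fd V]]]])
       (simp add: X(2) V0 sum_2 algebra_simps)
  have Q: "((\<lambda>s. V s \<bullet> (G (X s) *v V s)) has_real_derivative
      (\<Sum>a\<in>UNIV. \<xi> $ a * (\<Sum>b\<in>UNIV. \<Sum>c\<in>UNIV. partial_deriv a (\<lambda>y. G y $ b $ c) y * v $ b * v $ c)) * f
      + 2 * (\<xi> \<bullet> (G y *v v)) * g) (at 0)"
    unfolding inner_2 matrix_vector_2
    by (rule DERIV_cong[OF DERIV_add[OF quad quad]])
       (simp add: X(2) V0 sum_2 metric_sym[OF y, of 2 1] algebra_simps)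
  have "((\<lambda>s. 1/2 * m * (V s \<bullet> (G (X s) *v V s))
      + 1/2 * k * (W + s * (\<sigma> * g) + (frame_form G 1 (X s) * V s $ 1 + frame_form G 2 (X s) * V s $ 2))\<^sup>2)
    has_real_derivative
      (m / 2 * (\<Sum>a\<in>UNIV. \<xi> $ a * (\<Sum>b\<in>UNIV. \<Sum>c\<in>UNIV. partial_deriv a (\<lambda>y. G y $ b $ c) y * v $ b * v $ c))
        + k * \<omega> * (\<Sum>a\<in>UNIV. \<xi> $ a * (\<Sum>b\<in>UNIV. partial_deriv a (frame_form G b) y * v $ b))) * f
      + (m * (\<xi> \<bullet> (G y *v v)) + k * \<omega> * (\<sigma> + (frame_form G 1 y * \<xi> $ 1 + frame_form G 2 y * \<xi> $ 2))) * g) (at 0)"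
    by (rule DERIV_cong[OF DERIV_add[OF DERIV_cmult[OF Q] DERIV_cmult[OF DERIV_power[OF A]]]])
       (simp add: X(2) V0 \<omega>_def algebra_simps)
  then show ?thesis unfolding X_def V_def .
qed

end

section \<open>Constructing smooth maps into the unit tangent bundle\<close>

context oriented_surface
begin

lemma smooth_unit_tangent_map_open_vimage:
  assumes "smooth_unit_tangent_map S \<Omega> F U" "openin (points S) D"
  shows "open (\<Omega> \<inter> F -` D)"
  using assms chart_preimage_open unfolding smooth_unit_tangent_map_def by blast

lemma smooth_unit_tangent_map_comp:
  fixes F :: "'e::euclidean_space \<Rightarrow> 'p" and g :: "'d::real_normed_vector \<Rightarrow> 'e"
  assumes F: "smooth_unit_tangent_map S \<Omega> F U" and A: "open A" and g: "smooth_on A g" "g ` A \<subseteq> \<Omega>"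
  shows "smooth_unit_tangent_map S A (\<lambda>z. F (g z)) (\<lambda>z. U (g z))"
  unfolding smooth_unit_tangent_map_def
proof (intro conjI ballI)
  have "continuous_map (top_of_set A) (top_of_set \<Omega>) g"
    using smooth_on_continuous[OF g(1)] g(2) by auto
  moreover have "continuous_map (top_of_set \<Omega>) (points S) F"
    using F by (simp add: smooth_unit_tangent_map_def)
  ultimately show c: "continuous_map (top_of_set A) (points S) (\<lambda>z. F (g z))"
    using continuous_map_compose[of "top_of_set A" "top_of_set \<Omega>" g "points S" F] by (simp add: o_def)
  show "U (g z) \<in> unit_tangent_space S (F (g z))" if "z \<in> A" for z
    using F g(2) that by (auto simp: smooth_unit_tangent_map_def)
  fix i assume i: "i \<in> charts S"
  have o: "open (A \<inter> (\<lambda>z. F (g z)) -` chart_dom S i)"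
    by (rule chart_preimage_open[OF A c chart_open[OF i]])
  have o2: "open (\<Omega> \<inter> F -` chart_dom S i)"
    by (rule smooth_unit_tangent_map_open_vimage[OF F chart_open[OF i]])
  have im: "g ` (A \<inter> (\<lambda>z. F (g z)) -` chart_dom S i) \<subseteq> \<Omega> \<inter> F -` chart_dom S i" using g(2) by auto
  have sg: "smooth_on (A \<inter> (\<lambda>z. F (g z)) -` chart_dom S i) g" using smooth_on_subset[OF g(1)] by blast
  show "smooth_on (A \<inter> (\<lambda>z. F (g z)) -` chart_dom S i) (\<lambda>z. chart_map S i (F (g z)))"
    "smooth_on (A \<inter> (\<lambda>z. F (g z)) -` chart_dom S i) (\<lambda>z. U (g z) i)"
    using F i smooth_on_compose[OF o o2 im sg, of "\<lambda>z. chart_map S i (F z)"]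
      smooth_on_compose[OF o o2 im sg, of "\<lambda>z. U z i"]
    by (auto simp: smooth_unit_tangent_map_def)
qed (rule A)

lemma smooth_unit_tangent_map_cong:
  assumes F: "smooth_unit_tangent_map S A F U" and eq: "\<And>z. z \<in> A \<Longrightarrow> F z = F' z" "\<And>z. z \<in> A \<Longrightarrow> U z = U' z"
  shows "smooth_unit_tangent_map S A F' U'"
  unfolding smooth_unit_tangent_map_def
proof (intro conjI ballI)
  show "open A" using F by (simp add: smooth_unit_tangent_map_def)
  show "continuous_map (top_of_set A) (points S) F'"
    using F eq(1) by (auto simp: smooth_unit_tangent_map_def intro: continuous_map_eq)
  show "U' z \<in> unit_tangent_space S (F' z)" if "z \<in> A" for z
    using F eq that by (metis smooth_unit_tangent_map_def)
  fix i assume i: "i \<in> charts S"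
  have s: "A \<inter> F' -` chart_dom S i = A \<inter> F -` chart_dom S i" using eq(1) by auto
  have o: "open (A \<inter> F -` chart_dom S i)"
    by (rule smooth_unit_tangent_map_open_vimage[OF F chart_open[OF i]])
  have "smooth_on (A \<inter> F -` chart_dom S i) (\<lambda>z. chart_map S i (F z))"
    "smooth_on (A \<inter> F -` chart_dom S i) (\<lambda>z. U z i)"
    using F i by (auto simp: smooth_unit_tangent_map_def)
  then show "smooth_on (A \<inter> F' -` chart_dom S i) (\<lambda>z. chart_map S i (F' z))"
    "smooth_on (A \<inter> F' -` chart_dom S i) (\<lambda>z. U' z i)"
    unfolding s by (auto intro: smooth_on_cong[OF o] simp: eq)
qed

lemma smooth_unit_tangent_map_Un:
  fixes A B :: "'e::real_normed_vector set"
  assumes A: "smooth_unit_tangent_map S A F U" and B: "smooth_unit_tangent_map S B F U"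
  shows "smooth_unit_tangent_map S (A \<union> B) F U"
  unfolding smooth_unit_tangent_map_def
proof (intro conjI ballI)
  show o: "open (A \<union> B)" using A B by (auto simp: smooth_unit_tangent_map_def)
  show "continuous_map (top_of_set (A \<union> B)) (points S) F"
    unfolding continuous_map
  proof (intro conjI allI impI)
    show "F ` topspace (top_of_set (A \<union> B)) \<subseteq> topspace (points S)"
      using A B by (auto simp: smooth_unit_tangent_map_def continuous_map)
    fix D assume "openin (points S) D"
    then have "open ((A \<inter> F -` D) \<union> (B \<inter> F -` D))"
      by (intro open_Un smooth_unit_tangent_map_open_vimage[OF A] smooth_unit_tangent_map_open_vimage[OF B])
    moreover have "{z \<in> topspace (top_of_set (A \<union> B)). F z \<in> D} = (A \<inter> F -` D) \<union> (B \<inter> F -` D)" by auto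
    ultimately show "openin (top_of_set (A \<union> B)) {z \<in> topspace (top_of_set (A \<union> B)). F z \<in> D}"
      using o by (simp add: openin_open_eq Int_Un_distrib2) blast
  qed
  show "U z \<in> unit_tangent_space S (F z)" if "z \<in> A \<union> B" for z
    using A B that by (auto simp: smooth_unit_tangent_map_def)
  fix i assume i: "i \<in> charts S"
  have oA: "open (A \<inter> F -` chart_dom S i)" and oB: "open (B \<inter> F -` chart_dom S i)"
    using smooth_unit_tangent_map_open_vimage[OF A chart_open[OF i]]
      smooth_unit_tangent_map_open_vimage[OF B chart_open[OF i]] by auto
  have loc: "smooth_on ((A \<union> B) \<inter> F -` chart_dom S i) h"
    if "smooth_on (A \<inter> F -` chart_dom S i) h" "smooth_on (B \<inter> F -` chart_dom S i) h" for h :: "'e \<Rightarrow> real^2"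
    by (rule smooth_on_local) (use that oA oB in blast)
  show "smooth_on ((A \<union> B) \<inter> F -` chart_dom S i) (\<lambda>z. chart_map S i (F z))"
    "smooth_on ((A \<union> B) \<inter> F -` chart_dom S i) (\<lambda>z. U z i)"
    using A B i by (auto simp: smooth_unit_tangent_map_def intro: loc)
qed

definition chart_inv :: "'i \<Rightarrow> real^2 \<Rightarrow> 'p" where
  "chart_inv i = inv_into (chart_dom S i) (chart_map S i)"

lemma chart_inv_image:
  assumes "y \<in> chart_image S i"
  shows "chart_inv i y \<in> chart_dom S i" "chart_map S i (chart_inv i y) = y"
  using assms unfolding chart_inv_def chart_image_def by (auto intro: inv_into_into f_inv_into_f)

lemma chart_inv_chart: "i \<in> charts S \<Longrightarrow> p \<in> chart_dom S i \<Longrightarrow> chart_inv i (chart_map S i p) = p"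
  by (simp add: chart_inv_def chart_inj)

text \<open>A map given by its components in the chart \<open>i\<close> has the components obtained by the transition map
  and its Jacobian in any other chart.\<close>

lemma smooth_unit_tangent_map_of_chart:
  fixes X Y :: "'e::real_normed_vector \<Rightarrow> real^2"
  assumes i: "i \<in> charts S" and A: "open A" and X: "smooth_on A X" "X ` A \<subseteq> chart_image S i"
    and Y: "smooth_on A Y" "\<And>z. z \<in> A \<Longrightarrow> Y z \<bullet> (metric S i (X z) *v Y z) = 1"
  shows "smooth_unit_tangent_map S A (\<lambda>z. chart_inv i (X z)) (\<lambda>z. tangent_vector_of S i (chart_inv i (X z)) (Y z))"
  unfolding smooth_unit_tangent_map_def
proof (intro conjI ballI)
  have inv: "chart_inv i (X z) \<in> chart_dom S i" "chart_map S i (chart_inv i (X z)) = X z" if "z \<in> A" for z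
    using chart_inv_image[of "X z" i] X(2) that by auto
  have at: "i \<in> charts_at S (chart_inv i (X z))" if "z \<in> A" for z
    using i inv(1)[OF that] by (rule charts_atI)
  have pre: "A \<inter> (\<lambda>z. chart_inv i (X z)) -` D = A \<inter> X -` (chart_map S i ` (chart_dom S i \<inter> D))" for D
  proof -
    have "chart_inv i (X z) \<in> D \<longleftrightarrow> X z \<in> chart_map S i ` (chart_dom S i \<inter> D)" if "z \<in> A" for z
    proof
      assume "chart_inv i (X z) \<in> D"
      then show "X z \<in> chart_map S i ` (chart_dom S i \<inter> D)"
        using inv[OF that] by (intro image_eqI[of _ _ "chart_inv i (X z)"]) auto
    next
      assume "X z \<in> chart_map S i ` (chart_dom S i \<inter> D)"
      then obtain q where "X z = chart_map S i q" "q \<in> chart_dom S i" "q \<in> D" by blast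
      then show "chart_inv i (X z) \<in> D" by (simp add: chart_inv_chart[OF i])
    qed
    then show ?thesis by blast
  qed
  have o: "open (A \<inter> (\<lambda>z. chart_inv i (X z)) -` D)" if "openin (points S) D" for D
    unfolding pre using continuous_open_preimage[OF smooth_on_continuous[OF X(1)] A chart_map_open[OF i that]] .
  show "continuous_map (top_of_set A) (points S) (\<lambda>z. chart_inv i (X z))"
    unfolding continuous_map
  proof (intro conjI allI impI)
    show "(\<lambda>z. chart_inv i (X z)) ` topspace (top_of_set A) \<subseteq> topspace (points S)"
      using inv(1) openin_subset[OF chart_open[OF i]] by auto
    fix D assume "openin (points S) D"
    from o[OF this] A
    have "openin (top_of_set A) (A \<inter> (\<lambda>z. chart_inv i (X z)) -` D)" by (simp add: openin_open_eq)
    moreover have "{z \<in> topspace (top_of_set A). chart_inv i (X z) \<in> D} = A \<inter> (\<lambda>z. chart_inv i (X z)) -` D" by auto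
    ultimately show "openin (top_of_set A) {z \<in> topspace (top_of_set A). chart_inv i (X z) \<in> D}" by simp
  qed
  show "tangent_vector_of S i (chart_inv i (X z)) (Y z) \<in> unit_tangent_space S (chart_inv i (X z))" if z: "z \<in> A" for z
  proof -
    let ?v = "tangent_vector_of S i (chart_inv i (X z)) (Y z)"
    have v: "?v \<in> tangent_space S (chart_inv i (X z))" by (rule tangent_vector_of_in[OF at[OF z]])
    have "riem_inner S (chart_inv i (X z)) ?v ?v = 1"
      unfolding riem_inner_chart[OF surface at[OF z] v v] tangent_vector_of_self[OF at[OF z]] inv(2)[OF z]
      by (rule Y(2)[OF z])
    then show ?thesis using v by (simp add: unit_tangent_space_def riem_norm_def)
  qed
  fix j assume j: "j \<in> charts S"
  let ?N = "A \<inter> (\<lambda>z. chart_inv i (X z)) -` chart_dom S j"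
  have N: "open ?N" by (rule o[OF chart_open[OF j]])
  have im: "X ` ?N \<subseteq> overlap i j" unfolding pre by auto
  have XN: "smooth_on ?N X" "smooth_on ?N Y" using X(1) Y(1) by (auto intro: smooth_on_subset)
  have sm: "smooth_on ?N (\<lambda>z. transition S i j (X z))"
    by (rule smooth_on_compose[OF N overlap_open[OF i j] im XN(1) transition_smooth[OF i j]])
  show "smooth_on ?N (\<lambda>z. chart_map S j (chart_inv i (X z)))"
    by (rule smooth_on_cong[OF N sm]) (use inv transition_chart[OF i] in \<open>metis IntD1\<close>)
  have sm: "smooth_on ?N (\<lambda>z. jac i j (X z) (Y z))"
    by (rule smooth_on_frechet_derivative_compose[OF N overlap_open[OF i j] im XN(1) transition_smooth[OF i j] XN(2)])
  show "smooth_on ?N (\<lambda>z. tangent_vector_of S i (chart_inv i (X z)) (Y z) j)"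
    by (rule smooth_on_cong[OF N sm]) (use inv j in \<open>auto simp: tangent_vector_of_def charts_at_def\<close>)
qed (rule A)

lemma kinetic_energy_cong:
  assumes "open N" "t \<in> N" "\<And>\<tau>. \<tau> \<in> N \<Longrightarrow> \<gamma> \<tau> = \<gamma>' \<tau>" "\<And>\<tau>. \<tau> \<in> N \<Longrightarrow> u \<tau> = u' \<tau>"
  shows "kinetic_energy S m I\<^sub>a \<gamma> u t = kinetic_energy S m I\<^sub>a \<gamma>' u' t"
proof -
  have vd: "vector_derivative f (at t) = vector_derivative g (at t)"
    if "\<And>\<tau>. \<tau> \<in> N \<Longrightarrow> f \<tau> = g \<tau>" for f g :: "real \<Rightarrow> real^2"
    by (rule vector_derivative_cong_eq) (use that assms(1,2) in \<open>auto simp: eventually_nhds\<close>)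
  have eq: "\<gamma> t = \<gamma>' t" "u t = u' t" using assms by auto
  have v: "velocity S \<gamma> t = velocity S \<gamma>' t"
    unfolding velocity_def eq using assms(3) by (intro ext if_cong vd) auto
  moreover have "cov_deriv S \<gamma> u t = cov_deriv S \<gamma>' u' t"
    unfolding cov_deriv_def eq v
    using vd[of "\<lambda>\<tau>. u \<tau> i" "\<lambda>\<tau>. u' \<tau> i" for i] assms(4) by (intro ext) simp
  ultimately show ?thesis by (simp add: kinetic_energy_def axial_velocity_def eq)
qed

end

lemma (in riemannian_patch) smooth_gauss_curvature: "smooth_on \<Omega> (gauss_curvature_coords G)"
proof -
  have R: "smooth_on \<Omega> (riemann G l a b c)" for l a b c
    unfolding riemann_def[abs_def]
    by (intro smooth_on_add smooth_on_diff smooth_on_sum smooth_on_mult smooth_on_partial_deriv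
        smooth_christoffel open_patch)
  have "smooth_on \<Omega> (\<lambda>x. inverse (det (G x)))"
    by (rule smooth_on_compose[OF open_patch _ _ smooth_det smooth_on_inverse]) (use det_pos in auto)
  then show ?thesis
    unfolding gauss_curvature_coords_def[abs_def] divide_inverse
    by (intro smooth_on_mult smooth_on_sum smooth_metric_nth R open_patch)
qed

section \<open>A segment of the motion in a chart\<close>

text \<open>A piece \<open>{l\<^sub>0..r\<^sub>0}\<close> of the time interval during which the curve stays in the chart \<open>i\<close>. The
  endpoints may be those of the whole interval; all smooth data live on the larger open set
  \<open>N\<close>.\<close>

locale chart_segment = oriented_surface S for S :: "('p, 'i) surface" +
  fixes a b \<epsilon>\<^sub>0 l\<^sub>0 r\<^sub>0 :: real and \<gamma> :: "real \<Rightarrow> 'p" and u :: "real \<Rightarrow> 'i tangent_vector" and i :: 'i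
  assumes eps0: "\<epsilon>\<^sub>0 > 0"
    and curve: "smooth_unit_tangent_map S {a - \<epsilon>\<^sub>0<..<b + \<epsilon>\<^sub>0} \<gamma> u"
    and chart: "i \<in> charts S"
    and segment: "a \<le> l\<^sub>0" "l\<^sub>0 < r\<^sub>0" "r\<^sub>0 \<le> b"
    and in_chart: "t \<in> {l\<^sub>0..r\<^sub>0} \<Longrightarrow> \<gamma> t \<in> chart_dom S i"
begin

abbreviation "G \<equiv> metric S i"

sublocale riemannian_patch "chart_image S i" G by (rule patch[OF chart])

definition N :: "real set" where "N = {a - \<epsilon>\<^sub>0<..<b + \<epsilon>\<^sub>0} \<inter> \<gamma> -` chart_dom S i"
definition pos :: "real \<Rightarrow> real^2" where "pos t = chart_map S i (\<gamma> t)"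
definition vel :: "real \<Rightarrow> real^2" where "vel t = velocity S \<gamma> t i"
text \<open>The cosine and the sine of the angle from the frame to the direction of the disk, and the derivative
  of this angle.\<close>

definition fcos :: "real \<Rightarrow> real" where "fcos t = u t i \<bullet> (G (pos t) *v frame (pos t))"
definition fsin :: "real \<Rightarrow> real" where "fsin t = u t i \<bullet> (G (pos t) *v coframe (pos t))"
definition spin :: "real \<Rightarrow> real" where
  "spin t = fcos t * vector_derivative fsin (at t) - fsin t * vector_derivative fcos (at t)"
definition form :: "real^2 \<Rightarrow> real^2 \<Rightarrow> real" where
  "form y w = frame_form G 1 y * w $ 1 + frame_form G 2 y * w $ 2"

lemmas curveD = smooth_unit_tangent_mapD[OF curve]

lemma N_open: "open N"
  unfolding N_def by (rule curve_chart_open[OF curveD(1) chart])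

lemma segment_subset: "{l\<^sub>0..r\<^sub>0} \<subseteq> N"
  using in_chart segment eps0 by (auto simp: N_def)

lemma N_time: "t \<in> N \<Longrightarrow> t \<in> {a - \<epsilon>\<^sub>0<..<b + \<epsilon>\<^sub>0}" by (simp add: N_def)
lemma N_chart: "t \<in> N \<Longrightarrow> i \<in> charts_at S (\<gamma> t)" using chart by (simp add: N_def charts_at_def)
lemma pos_in: "t \<in> N \<Longrightarrow> pos t \<in> chart_image S i" unfolding pos_def by (rule chart_imageI[OF N_chart])
lemma pos_image: "pos ` N \<subseteq> chart_image S i" using pos_in by blast

lemma pos_smooth: "smooth_on N pos"
  using curveD(1) chart unfolding smooth_surface_curve_def N_def pos_def[abs_def] by blast

lemma vel_smooth: "smooth_on N vel"
  using velocity_field[OF curveD(1)] chart unfolding smooth_tangent_field_def N_def vel_def[abs_def] by blast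

lemma pos_deriv: "t \<in> N \<Longrightarrow> (pos has_vector_derivative vel t) (at t)"
  using curve_velocity[OF curveD(1) N_time N_chart] unfolding pos_def[abs_def] vel_def by blast

lemma dir_smooth: "smooth_on N (\<lambda>t. u t i)"
  using curveD(2) chart unfolding smooth_tangent_field_def N_def by blast

lemma coefficients_smooth: "smooth_on N fcos" "smooth_on N fsin"
  unfolding fcos_def[abs_def] fsin_def[abs_def]
  by (intro smooth_inner[OF N_open pos_smooth pos_image dir_smooth]
      smooth_on_compose[OF N_open open_patch pos_image pos_smooth] smooth_unit_frame smooth_coframe)+

lemma coefficients_deriv:
  assumes "t \<in> N"
  shows "(fcos has_real_derivative vector_derivative fcos (at t)) (at t)"
    "(fsin has_real_derivative vector_derivative fsin (at t)) (at t)"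
  using smooth_on_has_vector_derivative[OF coefficients_smooth(1) assms]
    smooth_on_has_vector_derivative[OF coefficients_smooth(2) assms]
  by (simp_all add: has_real_derivative_iff_has_vector_derivative)

lemma spin_smooth: "smooth_on N spin"
  unfolding spin_def[abs_def]
  by (intro smooth_on_diff smooth_on_mult coefficients_smooth smooth_on_vector_derivative N_open)

lemma dir_frame:
  "t \<in> N \<Longrightarrow> fcos t *\<^sub>R frame (pos t) + fsin t *\<^sub>R coframe (pos t) = u t i"
  unfolding fcos_def fsin_def by (rule frame_expansion[OF pos_in])

lemma dir_in: "t \<in> N \<Longrightarrow> u t \<in> tangent_space S (\<gamma> t)"
  using curveD(2) N_time by (simp add: smooth_tangent_field_def)

lemma coefficients_unit:
  assumes "t \<in> N"
  shows "(fcos t)\<^sup>2 + (fsin t)\<^sup>2 = 1"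
proof -
  have "riem_norm S (\<gamma> t) (u t) = 1"
    using curve N_time[OF assms] unfolding smooth_unit_tangent_map_def unit_tangent_space_def by blast
  then have "u t i \<bullet> (G (pos t) *v u t i) = 1"
    using riem_norm_squared_chart[OF N_chart[OF assms] dir_in[OF assms]] by (simp add: pos_def)
  then show ?thesis
    unfolding fcos_def fsin_def frame_coefficients_unit[OF pos_in[OF assms]] .
qed

lemma axial_velocity_form:
  assumes "t \<in> N"
  shows "axial_velocity S \<gamma> u t = spin t + form (pos t) (vel t)"
proof -
  have "((\<lambda>\<tau>. u \<tau> i) has_vector_derivative vector_derivative (\<lambda>\<tau>. u \<tau> i) (at t)) (at t)"
    by (rule smooth_on_has_vector_derivative[OF dir_smooth assms])
  then have "((\<lambda>\<tau>. fcos \<tau> *\<^sub>R frame (pos \<tau>) + fsin \<tau> *\<^sub>R coframe (pos \<tau>))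
      has_vector_derivative vector_derivative (\<lambda>\<tau>. u \<tau> i) (at t)) (at t)"
    by (rule has_vector_derivative_transform_within_open[OF _ N_open assms]) (simp add: dir_frame)
  from angular_coords_frame[OF pos_in[OF assms] pos_deriv[OF assms] coefficients_deriv[OF assms] this]
  show ?thesis
    unfolding axial_velocity_chart[OF curve N_time[OF assms] N_chart[OF assms]]
      dir_frame[OF assms] coefficients_unit[OF assms]
    by (simp add: pos_def vel_def spin_def form_def)
qed

text \<open>Momentum and force conjugate to a displacement in the direction \<open>\<xi>\<close> combined with a turn of
  the disk at the rate \<open>\<sigma>\<close>.\<close>

definition momentum :: "real \<Rightarrow> real \<Rightarrow> real^2 \<Rightarrow> real \<Rightarrow> real \<Rightarrow> real" where
  "momentum m k \<xi> \<sigma> t = m * (\<xi> \<bullet> (G (pos t) *v vel t)) + k * axial_velocity S \<gamma> u t * (\<sigma> + form (pos t) \<xi>)"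

definition force :: "real \<Rightarrow> real \<Rightarrow> real^2 \<Rightarrow> real \<Rightarrow> real" where
  "force m k \<xi> t =
     m / 2 * (\<Sum>a\<in>UNIV. \<xi> $ a * (\<Sum>b\<in>UNIV. \<Sum>c\<in>UNIV. partial_deriv a (\<lambda>y. G y $ b $ c) (pos t) * vel t $ b * vel t $ c))
     + k * axial_velocity S \<gamma> u t * (\<Sum>a\<in>UNIV. \<xi> $ a * (\<Sum>b\<in>UNIV. partial_deriv a (frame_form G b) (pos t) * vel t $ b))"

lemma form_smooth: "smooth_on X y \<Longrightarrow> smooth_on X w \<Longrightarrow> open X \<Longrightarrow> y ` X \<subseteq> chart_image S i \<Longrightarrow> smooth_on X (\<lambda>z. form (y z) (w z))"
  for y w :: "'e::real_normed_vector \<Rightarrow> real^2"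
  unfolding form_def
  by (intro smooth_on_add smooth_on_mult smooth_on_nth smooth_on_compose[OF _ open_patch _ _ smooth_frame_form])

lemma axial_smooth: "smooth_on N (axial_velocity S \<gamma> u)"
  unfolding N_def by (rule axial_velocity_energy_smooth(1)[OF curve chart])

lemma momentum_smooth: "smooth_on N (momentum m k \<xi> \<sigma>)"
  unfolding momentum_def[abs_def]
  by (intro smooth_on_add smooth_on_mult smooth_on_const smooth_inner[OF N_open pos_smooth pos_image]
      vel_smooth axial_smooth form_smooth pos_smooth pos_image N_open)

lemma force_smooth: "smooth_on N (force m k \<xi>)"
  unfolding force_def[abs_def]
  by (intro smooth_on_add smooth_on_mult smooth_on_sum smooth_on_const N_open axial_smooth
      smooth_on_nth vel_smooth smooth_on_compose[OF N_open open_patch pos_image pos_smooth]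
      smooth_on_partial_deriv smooth_metric_nth smooth_frame_form)

end

section \<open>Variations supported in a chart\<close>

text \<open>The centre is displaced by \<open>s \<phi> \<xi>\<close> in the coordinates of the chart, and the disk is turned by the
  angle \<open>s \<sigma> \<phi>\<close> with respect to the frame.\<close>

locale chart_variation = chart_segment S a b \<epsilon>\<^sub>0 l\<^sub>0 r\<^sub>0 \<gamma> u i
  for S :: "('p, 'i) surface" and a b \<epsilon>\<^sub>0 l\<^sub>0 r\<^sub>0 \<gamma> u i +
  fixes \<phi> :: "real \<Rightarrow> real" and l r \<sigma> :: real and \<xi> :: "real^2"
  assumes bump_smooth: "smooth_on UNIV \<phi>"
    and support: "l\<^sub>0 < l" "l < r" "r < r\<^sub>0" "t \<notin> {l<..<r} \<Longrightarrow> \<phi> t = 0"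
begin

abbreviation "\<phi>' \<equiv> \<lambda>t. vector_derivative \<phi> (at t)"
abbreviation "J \<equiv> {l\<^sub>0<..<r\<^sub>0}"

definition X :: "real \<Rightarrow> real \<Rightarrow> real^2" where "X s t = pos t + (s * \<phi> t) *\<^sub>R \<xi>"
definition V :: "real \<Rightarrow> real \<Rightarrow> real^2" where "V s t = vel t + (s * \<phi>' t) *\<^sub>R \<xi>"
definition P :: "real \<Rightarrow> real \<Rightarrow> real" where
  "P s t = fcos t * cos (s * (\<sigma> * \<phi> t)) - fsin t * sin (s * (\<sigma> * \<phi> t))"
definition Q :: "real \<Rightarrow> real \<Rightarrow> real" where
  "Q s t = fcos t * sin (s * (\<sigma> * \<phi> t)) + fsin t * cos (s * (\<sigma> * \<phi> t))"
definition Y :: "real \<Rightarrow> real \<Rightarrow> real^2" where "Y s t = P s t *\<^sub>R frame (X s t) + Q s t *\<^sub>R coframe (X s t)"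
definition \<Gamma> :: "real \<Rightarrow> real \<Rightarrow> 'p" where "\<Gamma> s t = (if t \<in> J then chart_inv i (X s t) else \<gamma> t)"
definition U :: "real \<Rightarrow> real \<Rightarrow> 'i tangent_vector" where
  "U s t = (if t \<in> J then tangent_vector_of S i (\<Gamma> s t) (Y s t) else u t)"
definition density :: "real \<Rightarrow> real \<Rightarrow> real \<times> real \<Rightarrow> real" where
  "density m k z = (case z of (s, t) \<Rightarrow>
     1/2 * m * (V s t \<bullet> (G (X s t) *v V s t)) + 1/2 * k * (spin t + s * (\<sigma> * \<phi>' t) + form (X s t) (V s t))\<^sup>2)"

lemma J_N: "t \<in> J \<Longrightarrow> t \<in> N" using segment_subset by auto

lemma bump_deriv: "(\<phi> has_real_derivative \<phi>' t) (at t)"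
  using smooth_on_has_vector_derivative[OF bump_smooth] by (simp add: has_real_derivative_iff_has_vector_derivative)

lemma PQ_unit: "t \<in> N \<Longrightarrow> (P s t)\<^sup>2 + (Q s t)\<^sup>2 = 1"
proof -
  assume t: "t \<in> N"
  have "(P s t)\<^sup>2 + (Q s t)\<^sup>2 = ((fcos t)\<^sup>2 + (fsin t)\<^sup>2) * ((cos (s * (\<sigma> * \<phi> t)))\<^sup>2 + (sin (s * (\<sigma> * \<phi> t)))\<^sup>2)"
    unfolding P_def Q_def by algebra
  then show ?thesis using coefficients_unit[OF t] by simp
qed

text \<open>This covers both the unperturbed curve (\<open>s = 0\<close>) and the times outside the support of the bump,
  where the two clauses defining the variation have to agree.\<close>

lemma unvaried:
  assumes "s * \<phi> t = 0"
  shows "\<Gamma> s t = \<gamma> t" "U s t = u t"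
proof -
  have z: "X s t = pos t" "P s t = fcos t" "Q s t = fsin t"
    using assms by (auto simp: X_def P_def Q_def)
  show G: "\<Gamma> s t = \<gamma> t"
    using in_chart[of t] by (auto simp: \<Gamma>_def z pos_def chart_inv_chart[OF chart])
  show "U s t = u t"
  proof (cases "t \<in> J")
    case True
    note t = J_N[OF True]
    have "tangent_vector_of S i (\<gamma> t) (u t i) = u t"
      by (rule tangent_space_eqI[OF N_chart[OF t] tangent_vector_of_in[OF N_chart[OF t]] dir_in[OF t]])
         (rule tangent_vector_of_self[OF N_chart[OF t]])
    then show ?thesis using True by (simp add: U_def G Y_def z dir_frame[OF t])
  qed (auto simp: U_def)
qed

text \<open>The segment is compact in the open image of the chart and the bump is bounded, so small multiples of
  the displacement stay in the chart.\<close>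

lemma variation_radius:
  obtains \<epsilon> where "0 < \<epsilon>" "\<epsilon> \<le> \<epsilon>\<^sub>0" "\<And>s t. \<bar>s\<bar> < \<epsilon> \<Longrightarrow> t \<in> {l\<^sub>0..r\<^sub>0} \<Longrightarrow> X s t \<in> chart_image S i"
proof -
  have "compact (pos ` {l\<^sub>0..r\<^sub>0})"
    using continuous_on_subset[OF smooth_on_continuous[OF pos_smooth] segment_subset]
    by (rule compact_continuous_image) simp
  moreover have "pos ` {l\<^sub>0..r\<^sub>0} \<subseteq> chart_image S i" using pos_image segment_subset by blast
  ultimately obtain d where d: "d > 0" "(\<Union>y\<in>pos ` {l\<^sub>0..r\<^sub>0}. ball y d) \<subseteq> chart_image S i"
    using compact_subset_open_imp_ball_epsilon_subset open_patch by metis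
  have "compact (\<phi> ` {l\<^sub>0..r\<^sub>0})"
    by (rule compact_continuous_image[OF continuous_on_subset[OF smooth_on_continuous[OF bump_smooth]]]) auto
  then obtain M where M: "M > 0" "\<And>t. t \<in> {l\<^sub>0..r\<^sub>0} \<Longrightarrow> \<bar>\<phi> t\<bar> \<le> M"
    using compact_imp_bounded[of "\<phi> ` {l\<^sub>0..r\<^sub>0}"] unfolding bounded_pos by auto
  define e where "e = d / (M * (norm \<xi> + 1))"
  have n: "M * (norm \<xi> + 1) > 0" using M(1) by (simp add: add_nonneg_pos)
  show thesis
  proof (rule that[of "min \<epsilon>\<^sub>0 e"])
    show "0 < min \<epsilon>\<^sub>0 e" using eps0 d(1) n by (simp add: e_def)
    fix s t assume s: "\<bar>s\<bar> < min \<epsilon>\<^sub>0 e" and t: "t \<in> {l\<^sub>0..r\<^sub>0}"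
    have "norm ((s * \<phi> t) *\<^sub>R \<xi>) = \<bar>s\<bar> * (\<bar>\<phi> t\<bar> * norm \<xi>)" by (simp add: abs_mult)
    also have "\<dots> \<le> \<bar>s\<bar> * (M * (norm \<xi> + 1))"
      using M t by (intro mult_left_mono mult_mono) auto
    also have "\<dots> < e * (M * (norm \<xi> + 1))" using s n by (intro mult_strict_right_mono) auto
    also have "\<dots> = d"
      by (simp only: e_def times_divide_eq_left nonzero_mult_div_cancel_right[OF less_imp_neq[OF n, symmetric]])
    finally have "X s t \<in> ball (pos t) d" by (simp add: X_def dist_norm)
    then show "X s t \<in> chart_image S i" using d(2) t by blast
  qed simp
qed

context
  fixes \<epsilon> assumes eps: "0 < \<epsilon>" "\<epsilon> \<le> \<epsilon>\<^sub>0"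
    and X_in: "\<And>s t. \<bar>s\<bar> < \<epsilon> \<Longrightarrow> t \<in> {l\<^sub>0..r\<^sub>0} \<Longrightarrow> X s t \<in> chart_image S i"
begin

abbreviation "A \<equiv> {-\<epsilon><..<\<epsilon>} \<times> J"
abbreviation "T \<equiv> {a - \<epsilon><..<b + \<epsilon>}"

lemma A_open: "open A" by (intro open_Times) auto

lemma X_image: "(\<lambda>z. X (fst z) (snd z)) ` A \<subseteq> chart_image S i"
  by (auto intro!: X_in)

lemma smooth_time:
  fixes f :: "real \<Rightarrow> 'c::real_normed_vector"
  assumes "smooth_on N f" shows "smooth_on A (\<lambda>z. f (snd z))"
  by (rule smooth_on_compose[OF A_open N_open _ smooth_on_bounded_linear[OF bounded_linear_snd A_open] assms])
     (use J_N in auto)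

lemma smooth_param: "smooth_on A fst"
  by (rule smooth_on_bounded_linear[OF bounded_linear_fst A_open])

lemma smooth_bump_N: "smooth_on N \<phi>" "smooth_on N \<phi>'"
  using smooth_on_subset[OF bump_smooth] smooth_on_subset[OF smooth_on_vector_derivative[OF open_UNIV bump_smooth]]
  by auto

lemma X_smooth: "smooth_on A (\<lambda>z. X (fst z) (snd z))" and V_smooth: "smooth_on A (\<lambda>z. V (fst z) (snd z))"
  unfolding X_def V_def
  by (intro smooth_on_add smooth_on_scaleR smooth_on_mult smooth_on_const smooth_param smooth_time
      smooth_bump_N pos_smooth vel_smooth A_open)+

lemma PQ_smooth: "smooth_on A (\<lambda>z. P (fst z) (snd z))" "smooth_on A (\<lambda>z. Q (fst z) (snd z))"
proof -
  have "smooth_on A (\<lambda>z. fst z * (\<sigma> * \<phi> (snd z)))"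
    by (intro smooth_on_mult smooth_on_const smooth_param smooth_time smooth_bump_N A_open)
  from smooth_on_compose[OF A_open open_UNIV _ this smooth_on_sin_cos(1)]
    smooth_on_compose[OF A_open open_UNIV _ this smooth_on_sin_cos(2)]
  show "smooth_on A (\<lambda>z. P (fst z) (snd z))" "smooth_on A (\<lambda>z. Q (fst z) (snd z))"
    unfolding P_def Q_def
    by (auto intro!: smooth_on_add smooth_on_diff smooth_on_mult smooth_time coefficients_smooth A_open)
qed

lemma Y_smooth: "smooth_on A (\<lambda>z. Y (fst z) (snd z))"
  unfolding Y_def
  by (intro smooth_on_add smooth_on_scaleR PQ_smooth A_open
      smooth_on_compose[OF A_open open_patch X_image X_smooth smooth_unit_frame]
      smooth_on_compose[OF A_open open_patch X_image X_smooth smooth_coframe])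

lemma density_smooth: "smooth_on A (density m k)"
proof -
  have "smooth_on A (\<lambda>z. 1/2 * m * (V (fst z) (snd z) \<bullet> (G (X (fst z) (snd z)) *v V (fst z) (snd z)))
      + 1/2 * k * (spin (snd z) + fst z * (\<sigma> * \<phi>' (snd z)) + form (X (fst z) (snd z)) (V (fst z) (snd z)))\<^sup>2)"
    unfolding power2_eq_square
    by (intro smooth_on_add smooth_on_mult smooth_on_const A_open smooth_param smooth_time smooth_bump_N
        spin_smooth form_smooth smooth_inner X_smooth V_smooth X_image)
  then show ?thesis by (simp add: density_def[abs_def] case_prod_beta)
qed

text \<open>Over the segment the map is prescribed in the chart; away from the support of the bump it is the
  original curve. These two open sets of times cover the domain.\<close>

lemma varied_smooth:
  "smooth_unit_tangent_map S ({-\<epsilon><..<\<epsilon>} \<times> T) (\<lambda>(s, t). \<Gamma> s t) (\<lambda>(s, t). U s t)"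
proof -
  let ?B = "{-\<epsilon><..<\<epsilon>} \<times> (T - {l..r})"
  have "smooth_unit_tangent_map S A (\<lambda>z. chart_inv i (X (fst z) (snd z)))
      (\<lambda>z. tangent_vector_of S i (chart_inv i (X (fst z) (snd z))) (Y (fst z) (snd z)))"
  proof (rule smooth_unit_tangent_map_of_chart[OF chart A_open X_smooth X_image Y_smooth])
    fix z assume "z \<in> A"
    then have "X (fst z) (snd z) \<in> chart_image S i" "snd z \<in> N" using X_image J_N by auto
    then show "Y (fst z) (snd z) \<bullet> (G (X (fst z) (snd z)) *v Y (fst z) (snd z)) = 1"
      by (simp add: Y_def frame_combination_norm PQ_unit)
  qed
  then have 1: "smooth_unit_tangent_map S A (\<lambda>(s, t). \<Gamma> s t) (\<lambda>(s, t). U s t)"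
    by (rule smooth_unit_tangent_map_cong) (auto simp: \<Gamma>_def U_def)
  have B: "open ?B" by (intro open_Times open_Diff) auto
  have "smooth_unit_tangent_map S ?B (\<lambda>z. \<gamma> (snd z)) (\<lambda>z. u (snd z))"
    by (rule smooth_unit_tangent_map_comp[OF curve B smooth_on_bounded_linear[OF bounded_linear_snd B]])
       (use eps in auto)
  then have 2: "smooth_unit_tangent_map S ?B (\<lambda>(s, t). \<Gamma> s t) (\<lambda>(s, t). U s t)"
    by (rule smooth_unit_tangent_map_cong) (use unvaried support(4) in \<open>auto simp: not_le not_less\<close>)
  have "A \<union> ?B = {-\<epsilon><..<\<epsilon>} \<times> T" using support segment eps(1) by auto
  then show ?thesis using smooth_unit_tangent_map_Un[OF 1 2] by simp
qed

lemma varied_variation: "variation S a b \<gamma> u \<Gamma> U"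
  unfolding variation_def
proof (intro exI[of _ \<epsilon>] conjI ballI)
  have "\<phi> a = 0" "\<phi> b = 0" using support segment by (auto intro!: support(4))
  then show "\<Gamma> s a = \<gamma> a" "U s a = u a" "\<Gamma> s b = \<gamma> b" "U s b = u b" for s
    using unvaried[of s a] unvaried[of s b] by auto
  show "\<Gamma> 0 t = \<gamma> t" "U 0 t = u t" for t using unvaried[of 0 t] by auto
qed (use eps varied_smooth in auto)

lemma varied_curve_smooth:
  assumes "\<bar>s\<bar> < \<epsilon>"
  shows "smooth_unit_tangent_map S T (\<Gamma> s) (U s)"
proof -
  have "smooth_on T (\<lambda>t. (s, t))"
    by (intro smooth_on_Pair smooth_on_const smooth_on_ident) auto
  moreover have "(\<lambda>t. (s, t)) ` T \<subseteq> {-\<epsilon><..<\<epsilon>} \<times> T" using assms by auto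
  ultimately show ?thesis
    using smooth_unit_tangent_map_comp[OF varied_smooth, of T "\<lambda>t. (s, t)"] by simp
qed

text \<open>Turning the pair of coefficients by an angle adds the derivative of this angle to
  $p\dot q - q\dot p$.\<close>

lemma varied_energy:
  assumes s: "\<bar>s\<bar> < \<epsilon>" and t: "t \<in> J"
  shows "kinetic_energy S m k (\<Gamma> s) (U s) t = density m k (s, t)"
proof -
  note tN = J_N[OF t]
  have tT: "t \<in> T" using t segment eps by auto
  have X: "X s \<tau> \<in> chart_image S i" if "\<tau> \<in> J" for \<tau> using X_in[OF s] that by simp
  have GX: "\<Gamma> s \<tau> \<in> chart_dom S i" "chart_map S i (\<Gamma> s \<tau>) = X s \<tau>" if "\<tau> \<in> J" for \<tau>
    using chart_inv_image[OF X[OF that]] that by (auto simp: \<Gamma>_def)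
  have at: "i \<in> charts_at S (\<Gamma> s \<tau>)" if "\<tau> \<in> J" for \<tau> using charts_atI[OF chart GX(1)[OF that]] .
  have UY: "U s \<tau> i = Y s \<tau>" if "\<tau> \<in> J" for \<tau>
    using tangent_vector_of_self[OF at[OF that]] that by (simp add: U_def)
  have Jo: "open J" by simp
  have sc: "((\<lambda>t. s * \<phi> t) has_real_derivative s * \<phi>' t) (at t)"
    by (rule DERIV_cmult[OF bump_deriv])
  have "((\<lambda>t. (s * \<phi> t) *\<^sub>R \<xi>) has_vector_derivative (s * \<phi>' t) *\<^sub>R \<xi>) (at t)"
    using has_vector_derivative_scaleR[OF sc has_vector_derivative_const[of \<xi>]] by simp
  from has_vector_derivative_add[OF pos_deriv[OF tN] this]
  have Xd: "(X s has_vector_derivative V s t) (at t)" by (simp add: X_def[abs_def] V_def)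
  then have "((\<lambda>\<tau>. chart_map S i (\<Gamma> s \<tau>)) has_vector_derivative V s t) (at t)"
    by (rule has_vector_derivative_transform_within_open[OF _ Jo t]) (simp add: GX(2))
  then have vel: "velocity S (\<Gamma> s) t i = V s t"
    unfolding velocity_chart[where \<gamma> = "\<Gamma> s" and t = t, OF at[OF t]] by (rule vector_derivative_at)
  define y' where "y' = vector_derivative (\<lambda>\<tau>. U s \<tau> i) (at t)"
  note cs = smooth_unit_tangent_mapD[OF varied_curve_smooth[OF s]]
  have "((\<lambda>\<tau>. U s \<tau> i) has_vector_derivative y') (at t)"
    unfolding y'_def by (rule field_has_derivative[OF cs tT at[OF t]])
  then have Yd: "((\<lambda>\<tau>. P s \<tau> *\<^sub>R frame (X s \<tau>) + Q s \<tau> *\<^sub>R coframe (X s \<tau>)) has_vector_derivative y') (at t)"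
    by (rule has_vector_derivative_transform_within_open[OF _ Jo t]) (simp add: UY Y_def)
  define th where "th = s * (\<sigma> * \<phi> t)"
  define th' where "th' = s * (\<sigma> * \<phi>' t)"
  define c' where "c' = vector_derivative fcos (at t)"
  define s' where "s' = vector_derivative fsin (at t)"
  have thd: "((\<lambda>t. s * (\<sigma> * \<phi> t)) has_real_derivative th') (at t)"
    unfolding th'_def by (intro DERIV_cmult bump_deriv)
  note cd = coefficients_deriv(1)[OF tN, folded c'_def] and sd = coefficients_deriv(2)[OF tN, folded s'_def]
  note cosd = DERIV_chain2[OF DERIV_cos thd] and sind = DERIV_chain2[OF DERIV_sin thd]
  have Pd: "(P s has_real_derivative c' * cos th - fcos t * sin th * th' - s' * sin th - fsin t * cos th * th') (at t)"
    unfolding P_def[abs_def]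
    by (rule DERIV_cong[OF DERIV_diff[OF DERIV_mult[OF cd cosd] DERIV_mult[OF sd sind]]])
       (simp add: th_def algebra_simps)
  have Qd: "(Q s has_real_derivative c' * sin th + fcos t * cos th * th' + s' * cos th - fsin t * sin th * th') (at t)"
    unfolding Q_def[abs_def]
    by (rule DERIV_cong[OF DERIV_add[OF DERIV_mult[OF cd sind] DERIV_mult[OF sd cosd]]])
       (simp add: th_def algebra_simps)
  have "P s t * (c' * sin th + fcos t * cos th * th' + s' * cos th - fsin t * sin th * th')
      - Q s t * (c' * cos th - fcos t * sin th * th' - s' * sin th - fsin t * cos th * th') =
      ((cos th)\<^sup>2 + (sin th)\<^sup>2) * (fcos t * s' - fsin t * c' + ((fcos t)\<^sup>2 + (fsin t)\<^sup>2) * th')"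
    unfolding P_def Q_def th_def[symmetric] by algebra
  also have "\<dots> = spin t + th'" by (simp add: coefficients_unit[OF tN] spin_def c'_def s'_def)
  finally have W: "P s t * (c' * sin th + fcos t * cos th * th' + s' * cos th - fsin t * sin th * th')
      - Q s t * (c' * cos th - fcos t * sin th * th' - s' * sin th - fsin t * cos th * th') = spin t + th'" .
  have "angular_coords G (X s t) (V s t) (Y s t) y' = spin t + th' + form (X s t) (V s t)"
    using angular_coords_frame[OF X[OF t] Xd Pd Qd Yd] unfolding W PQ_unit[OF tN] by (simp add: Y_def form_def)
  then show ?thesis
    unfolding kinetic_energy_chart[OF varied_curve_smooth[OF s] tT at[OF t]] vel GX(2)[OF t] UY[OF t]
      y'_def[symmetric] density_def th'_def by simp
qed

lemma unvaried_energy: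
  assumes "t \<in> {a..b}" "t \<notin> {l..r}"
  shows "kinetic_energy S m k (\<Gamma> s) (U s) t = kinetic_energy S m k \<gamma> u t"
proof (rule kinetic_energy_cong[of "T - {l..r}"])
  show "open (T - {l..r})" by (intro open_Diff) auto
qed (use assms eps unvaried support(4) in auto)

lemma energy_continuous: "continuous_on {a..b} (kinetic_energy S m k \<gamma> u)"
  by (rule continuous_on_subset[OF axial_velocity_energy_continuous(2)[OF curve]]) (use eps0 in auto)

text \<open>Only the integral over the support of the bump depends on the parameter.\<close>

lemma varied_action:
  assumes s: "\<bar>s\<bar> < \<epsilon>"
  shows "action S m k a b (\<Gamma> s) (U s) = integral {a..b} (kinetic_energy S m k \<gamma> u)
    - integral {l..r} (kinetic_energy S m k \<gamma> u) + integral {l..r} (\<lambda>t. density m k (s, t))"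
proof -
  let ?K = "kinetic_energy S m k \<gamma> u" and ?e = "\<lambda>t. density m k (s, t)"
  have lr: "{l..r} \<subseteq> J" "{l..r} \<subseteq> {a..b}" using support segment by auto
  have "continuous_on {l..r} ?e"
    by (rule continuous_on_compose2[OF smooth_on_continuous[OF density_smooth, of m k]])
       (use s lr in \<open>auto intro!: continuous_intros\<close>)
  then have e: "(?e has_integral integral {l..r} ?e) {l..r}"
    using integrable_continuous_interval integrable_integral by blast
  have K: "(?K has_integral integral {l..r} ?K) {l..r}" "(?K has_integral integral {a..b} ?K) {a..b}"
    using integrable_continuous_interval integrable_integral energy_continuous
      continuous_on_subset[OF energy_continuous lr(2)] by blast+
  let ?h = "\<lambda>t. if t \<in> {l..r} then ?e t - ?K t else 0"
  have "((\<lambda>t. ?e t - ?K t) has_integral integral {l..r} ?e - integral {l..r} ?K) {l..r}"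
    by (rule has_integral_diff[OF e K(1)])
  then have "(?h has_integral integral {l..r} ?e - integral {l..r} ?K) {l..r}"
    by (rule has_integral_eq[rotated]) simp
  then have "(?h has_integral integral {l..r} ?e - integral {l..r} ?K) {a..b}"
    by (rule has_integral_on_superset[OF _ _ lr(2)]) auto
  from has_integral_add[OF K(2) this]
  have "((\<lambda>t. ?K t + ?h t) has_integral integral {a..b} ?K + (integral {l..r} ?e - integral {l..r} ?K)) {a..b}" .
  then have "(kinetic_energy S m k (\<Gamma> s) (U s) has_integral
      integral {a..b} ?K + (integral {l..r} ?e - integral {l..r} ?K)) {a..b}"
  proof (rule has_integral_eq[rotated])
    fix t assume t: "t \<in> {a..b}"
    show "?K t + ?h t = kinetic_energy S m k (\<Gamma> s) (U s) t"
    proof (cases "t \<in> {l..r}")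
      case True
      then have "t \<in> J" using lr by blast
      from varied_energy[OF s this] True show ?thesis by simp
    qed (auto simp: unvaried_energy[OF t])
  qed
  then show ?thesis unfolding action_def by (simp add: integral_unique)
qed

lemma density_derivative:
  assumes "t \<in> N"
  shows "((\<lambda>s. density m k (s, t)) has_real_derivative
    force m k \<xi> t * \<phi> t + momentum m k \<xi> \<sigma> t * \<phi>' t) (at 0)"
  using energy_variation[OF pos_in[OF assms], of m "vel t" "\<phi>' t" \<xi> "\<phi> t" k "spin t" \<sigma>]
  unfolding density_def X_def V_def force_def momentum_def axial_velocity_form[OF assms] form_def by simp

lemma action_derivative:
  "((\<lambda>s. action S m k a b (\<Gamma> s) (U s)) has_real_derivative
    integral {l..r} (\<lambda>t. force m k \<xi> t * \<phi> t + momentum m k \<xi> \<sigma> t * \<phi>' t)) (at 0)"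
proof -
  have lr: "{l..r} \<subseteq> J" using support by auto
  have "((\<lambda>s. integral {l..r} (\<lambda>t. density m k (s, t))) has_real_derivative
      integral {l..r} (\<lambda>t. force m k \<xi> t * \<phi> t + momentum m k \<xi> \<sigma> t * \<phi>' t)) (at 0)"
    by (rule leibniz_rule_smooth[OF density_smooth eps(1) lr])
       (use lr J_N in \<open>blast intro: density_derivative\<close>)
  from DERIV_add[OF DERIV_const this]
  have "((\<lambda>s. (integral {a..b} (kinetic_energy S m k \<gamma> u) - integral {l..r} (kinetic_energy S m k \<gamma> u))
      + integral {l..r} (\<lambda>t. density m k (s, t))) has_real_derivative
      integral {l..r} (\<lambda>t. force m k \<xi> t * \<phi> t + momentum m k \<xi> \<sigma> t * \<phi>' t)) (at 0)" by simp
  then show ?thesis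
    by (rule has_field_derivative_transform_within_open[where S = "{-\<epsilon><..<\<epsilon>}"])
       (use eps varied_action in auto)
qed

end

lemma weak_equation:
  assumes "motion S m k a b \<gamma> u"
  shows "integral {l..r} (\<lambda>t. force m k \<xi> t * \<phi> t + momentum m k \<xi> \<sigma> t * \<phi>' t) = 0"
proof -
  obtain \<epsilon> where \<epsilon>: "0 < \<epsilon>" "\<epsilon> \<le> \<epsilon>\<^sub>0" "\<And>s t. \<bar>s\<bar> < \<epsilon> \<Longrightarrow> t \<in> {l\<^sub>0..r\<^sub>0} \<Longrightarrow> X s t \<in> chart_image S i"
    using variation_radius by metis
  have "((\<lambda>s. action S m k a b (\<Gamma> s) (U s)) has_real_derivative 0) (at 0)"
    using assms varied_variation[OF \<epsilon>] by (simp add: motion_def)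
  with action_derivative[OF \<epsilon>] show ?thesis by (rule DERIV_unique)
qed

end

section \<open>The Euler-Lagrange equations\<close>

context chart_segment
begin

lemma euler_lagrange:
  assumes "motion S m k a b \<gamma> u" and t: "t \<in> {l\<^sub>0<..<r\<^sub>0}"
  shows "(momentum m k \<xi> \<sigma> has_real_derivative force m k \<xi> t) (at t)"
proof -
  have sub: "{l\<^sub>0<..<r\<^sub>0} \<subseteq> N" using segment_subset by auto
  have d: "(momentum m k \<xi> \<sigma> has_real_derivative vector_derivative (momentum m k \<xi> \<sigma>) (at t)) (at t)"
    if "t \<in> {l\<^sub>0<..<r\<^sub>0}" for t
    using smooth_on_has_vector_derivative[OF momentum_smooth] sub that
    by (auto simp: has_real_derivative_iff_has_vector_derivative)
  have "force m k \<xi> t = vector_derivative (momentum m k \<xi> \<sigma>) (at t)"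
  proof (rule euler_lagrange_if_weak[OF _ _ d _ t])
    show "continuous_on {l\<^sub>0<..<r\<^sub>0} (force m k \<xi>)"
      by (rule continuous_on_subset[OF smooth_on_continuous[OF force_smooth] sub])
    show "continuous_on {l\<^sub>0<..<r\<^sub>0} (\<lambda>t. vector_derivative (momentum m k \<xi> \<sigma>) (at t))"
      by (rule continuous_on_subset[OF smooth_on_continuous[OF smooth_on_vector_derivative[OF N_open momentum_smooth]] sub])
  next
    fix \<phi> :: "real \<Rightarrow> real" and l r
    assume *: "smooth_on UNIV \<phi>" "l\<^sub>0 < l" "l < r" "r < r\<^sub>0" "\<And>\<tau>. \<tau> \<notin> {l<..<r} \<Longrightarrow> \<phi> \<tau> = 0"
    interpret chart_variation S a b \<epsilon>\<^sub>0 l\<^sub>0 r\<^sub>0 \<gamma> u i \<phi> l r \<sigma> \<xi>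
      by unfold_locales (use * in auto)
    show "integral {l..r} (\<lambda>\<tau>. force m k \<xi> \<tau> * \<phi> \<tau> + momentum m k \<xi> \<sigma> \<tau> * vector_derivative \<phi> (at \<tau>)) = 0"
      by (rule weak_equation[OF assms(1)])
  qed
  then show ?thesis using d[OF t] by simp
qed

text \<open>The equation of the pure turn, \<open>\<xi> = 0\<close> and \<open>\<sigma> = 1\<close>: its momentum is the axial angular momentum
  and its force vanishes.\<close>

lemma axial_velocity_stationary:
  assumes "motion S m k a b \<gamma> u" "k \<noteq> 0" "t \<in> {l\<^sub>0<..<r\<^sub>0}"
  shows "(axial_velocity S \<gamma> u has_real_derivative 0) (at t)"
proof -
  have "(momentum m k 0 1 has_real_derivative 0) (at t)"
    using euler_lagrange[OF assms(1,3), of 0 1] by (simp add: force_def)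
  then have "((\<lambda>t. inverse k * (k * axial_velocity S \<gamma> u t)) has_real_derivative inverse k * 0) (at t)"
    by (intro DERIV_cmult) (simp add: momentum_def[abs_def] form_def)
  then show ?thesis using assms(2) by (simp add: mult.assoc[symmetric])
qed

text \<open>In the equations of the two coordinate displacements the connection form acts as a vector
  potential. Since the angular momentum is constant, the terms that contain it combine to
  \<open>L\<close> times the curl of the connection form.\<close>

lemma equation_of_motion_chart:
  assumes mot: "motion S m k a b \<gamma> u" "k \<noteq> 0" and t: "t \<in> {l\<^sub>0<..<r\<^sub>0}"
  shows "m *\<^sub>R cov_coords G (pos t) (vel t) (vel t) (vector_derivative vel (at t)) =
    (k * axial_velocity S \<gamma> u t * gauss_curvature_coords G (pos t)) *\<^sub>R rot_coords (G (pos t)) (vel t)"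
proof -
  have tN: "t \<in> N" using t segment_subset by auto
  note x = pos_in[OF tN]
  define D where "D = cov_coords G (pos t) (vel t) (vel t) (vector_derivative vel (at t))"
  define w where "w = axial_velocity S \<gamma> u t"
  define F where "F a c = partial_deriv a (frame_form G c) (pos t)" for a c
  have vd: "(vel has_vector_derivative vector_derivative vel (at t)) (at t)"
    by (rule smooth_on_has_vector_derivative[OF vel_smooth tN])
  have eq: "m * (G (pos t) *v D) $ c = k * w * ((F c 1 - F 1 c) * vel t $ 1 + (F c 2 - F 2 c) * vel t $ 2)" for c
  proof -
    have ax: "axis c 1 \<bullet> z = z $ c" "form y (axis c 1) = frame_form G c y" for z y :: "real^2"
      using exhaust_2[of c] by (auto simp: inner_2 form_def axis_def)
    have f: "((\<lambda>\<tau>. frame_form G c (pos \<tau>)) has_real_derivative F 1 c * vel t $ 1 + F 2 c * vel t $ 2) (at t)"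
      unfolding F_def
      by (rule partial_deriv_chain[OF smooth_on_differentiable[OF smooth_frame_form x] pos_deriv[OF tN]])
    have A: "((\<lambda>\<tau>. m * (G (pos \<tau>) *v vel \<tau>) $ c + k * axial_velocity S \<gamma> u \<tau> * frame_form G c (pos \<tau>))
        has_real_derivative m * ((G (pos t) *v D) $ c
          + (\<Sum>b\<in>UNIV. \<Sum>d\<in>UNIV. partial_deriv c (\<lambda>y. G y $ b $ d) (pos t) * vel t $ b * vel t $ d) / 2)
        + (k * 0 * frame_form G c (pos t) + (F 1 c * vel t $ 1 + F 2 c * vel t $ 2) * (k * axial_velocity S \<gamma> u t))) (at t)"
      unfolding D_def
      by (intro DERIV_add DERIV_cmult DERIV_mult lowered_acceleration x pos_deriv[OF tN] vd f
          axial_velocity_stationary[OF mot t])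
    have B: "((\<lambda>\<tau>. m * (G (pos \<tau>) *v vel \<tau>) $ c + k * axial_velocity S \<gamma> u \<tau> * frame_form G c (pos \<tau>))
        has_real_derivative force m k (axis c 1) t) (at t)"
      using euler_lagrange[OF mot(1) t, of "axis c 1" 0] unfolding momentum_def[abs_def] ax add_0 .
    have "force m k (axis c 1) t = m / 2 *
        (\<Sum>b\<in>UNIV. \<Sum>d\<in>UNIV. partial_deriv c (\<lambda>y. G y $ b $ d) (pos t) * vel t $ b * vel t $ d)
        + k * w * (F c 1 * vel t $ 1 + F c 2 * vel t $ 2)"
      using exhaust_2[of c] by (auto simp: force_def w_def F_def axis_def sum_2)
    then show ?thesis
      using DERIV_unique[OF A B] unfolding w_def[symmetric] by (simp add: algebra_simps)
  qed
  have curl: "F 1 2 - F 2 1 = - (sqrt (det (G (pos t))) * gauss_curvature_coords G (pos t))"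
    unfolding F_def by (rule frame_form_curl[OF x])
  (* The metric is definite, so it is enough that d has norm zero. *)
  define d where "d = m *\<^sub>R D - (k * w * gauss_curvature_coords G (pos t)) *\<^sub>R rot_coords (G (pos t)) (vel t)"
  have "d \<bullet> (G (pos t) *v d) = 0"
  proof -
    have "d \<bullet> (G (pos t) *v (m *\<^sub>R D)) = d $ 1 * (m * (G (pos t) *v D) $ 1) + d $ 2 * (m * (G (pos t) *v D) $ 2)"
      by (simp add: inner_2 matrix_vector_mult_scaleR)
    also have "\<dots> = k * w * (F 1 2 - F 2 1) * (d $ 1 * vel t $ 2 - d $ 2 * vel t $ 1)"
      unfolding eq by (simp add: algebra_simps)
    also have "\<dots> = k * w * gauss_curvature_coords G (pos t) * (d \<bullet> (G (pos t) *v rot_coords (G (pos t)) (vel t)))"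
      unfolding curl rot_inner[OF x] by (simp add: algebra_simps)
    finally show ?thesis
      by (subst (2) d_def) (simp add: matrix_vector_mult_diff_distrib matrix_vector_mult_scaleR inner_diff_right)
  qed
  then have "d = 0" using metric_pos[OF x, of d] by fastforce
  then show ?thesis by (simp add: d_def D_def w_def)
qed

text \<open>Continuity extends the equation to the end points of the segment.\<close>

lemma equation_of_motion_chart_closed:
  assumes mot: "motion S m k a b \<gamma> u" "k \<noteq> 0" and t: "t \<in> {l\<^sub>0..r\<^sub>0}"
  shows "m *\<^sub>R cov_coords G (pos t) (vel t) (vel t) (vector_derivative vel (at t)) =
    (k * axial_velocity S \<gamma> u t * gauss_curvature_coords G (pos t)) *\<^sub>R rot_coords (G (pos t)) (vel t)"
proof -
  define d where "d t = m *\<^sub>R cov_coords G (pos t) (vel t) (vel t) (vector_derivative vel (at t))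
    - (k * axial_velocity S \<gamma> u t * gauss_curvature_coords G (pos t)) *\<^sub>R rot_coords (G (pos t)) (vel t)" for t
  have "smooth_on N d"
    unfolding d_def[abs_def]
    by (intro smooth_on_diff smooth_on_scaleR smooth_on_mult smooth_on_const N_open smooth_cov_coords
        smooth_rot_coords pos_smooth pos_image vel_smooth smooth_on_vector_derivative axial_smooth
        smooth_on_compose[OF N_open open_patch pos_image pos_smooth smooth_gauss_curvature])
  moreover have cl: "closure {l\<^sub>0<..<r\<^sub>0} = {l\<^sub>0..r\<^sub>0}" using segment by simp
  ultimately have "continuous_on (closure {l\<^sub>0<..<r\<^sub>0}) d"
    using smooth_on_continuous continuous_on_subset segment_subset by metis
  then have "d t = 0"
    by (rule continuous_constant_on_closure[where a = 0])
       (use t cl equation_of_motion_chart[OF mot] in \<open>auto simp: d_def\<close>)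
  then show ?thesis by (simp add: d_def)
qed

end

section \<open>The equation of motion of the disk\<close>

theorem theorem2:
  fixes S :: "('p, 'i) surface" and m I\<^sub>a a b :: real
    and \<gamma> :: "real \<Rightarrow> 'p" and u :: "real \<Rightarrow> 'i tangent_vector"
  assumes "oriented_riemannian_surface S"
    and "m > 0" and "I\<^sub>a > 0" and "a < b"
    and "motion S m I\<^sub>a a b \<gamma> u"
  defines "L \<equiv> \<lambda>t. I\<^sub>a * axial_velocity S \<gamma> u t"
  shows "L constant_on {a..b} \<and>
    (\<forall>t\<in>{a..b}.
       tangent_scale m (cov_deriv S \<gamma> (velocity S \<gamma>) t) =
       tangent_scale (L t * gauss_curvature S (\<gamma> t)) (rotation S (\<gamma> t) (velocity S \<gamma> t)))"
proof -
  interpret oriented_surface S by unfold_locales (rule assms(1))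
  obtain \<epsilon> where \<epsilon>: "\<epsilon> > 0" and curve: "smooth_unit_tangent_map S {a - \<epsilon><..<b + \<epsilon>} \<gamma> u"
    using assms(5) unfolding motion_def unit_tangent_curve_def by blast
  note c = smooth_unit_tangent_mapD(1)[OF curve]
  (* The segment is a neighbourhood of t in {a..b}; at the two ends of the interval it is one-sided. *)
  have segment: "\<exists>l r. chart_segment S a b \<epsilon> l r \<gamma> u (some_chart S (\<gamma> t)) \<and> t \<in> {l..r} \<and> (a < t \<longrightarrow> l < t) \<and> (t < b \<longrightarrow> t < r)"
    if t: "t \<in> {a..b}" for t
  proof -
    let ?i = "some_chart S (\<gamma> t)"
    have tT: "t \<in> {a - \<epsilon><..<b + \<epsilon>}" using t \<epsilon> by auto
    have i: "?i \<in> charts_at S (\<gamma> t)"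
      using some_chart_at continuous_map_in_topspace[OF _ tT] c unfolding smooth_surface_curve_def by blast
    obtain d where d: "d > 0" "cball t d \<subseteq> {a - \<epsilon><..<b + \<epsilon>} \<inter> \<gamma> -` chart_dom S ?i"
      using curve_chart_open[OF c charts_atD(1)[OF i]] curve_chart_mem[OF c tT i] open_contains_cball by metis
    have "chart_segment S a b \<epsilon> (max a (t - d)) (min b (t + d)) \<gamma> u ?i"
      by unfold_locales (use \<epsilon> curve charts_atD(1)[OF i] d t \<open>a < b\<close> in \<open>auto simp: cball_eq_atLeastAtMost\<close>)
    moreover have "t \<in> {max a (t - d)..min b (t + d)}" using t d by auto
    moreover have "(a < t \<longrightarrow> max a (t - d) < t) \<and> (t < b \<longrightarrow> t < min b (t + d))" using d by auto
    ultimately show ?thesis by blast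
  qed
  have "axial_velocity S \<gamma> u t = axial_velocity S \<gamma> u a" if "t \<in> {a..b}" for t
  proof (rule DERIV_isconst2[OF \<open>a < b\<close>])
    show "continuous_on {a..b} (axial_velocity S \<gamma> u)"
      by (rule continuous_on_subset[OF axial_velocity_energy_continuous(1)[OF curve]]) (use \<epsilon> in auto)
    fix t assume "a < t" "t < b"
    with segment[of t] obtain l r where "chart_segment S a b \<epsilon> l r \<gamma> u (some_chart S (\<gamma> t))" "t \<in> {l<..<r}" by auto
    then show "(axial_velocity S \<gamma> u has_real_derivative 0) (at t)"
      using chart_segment.axial_velocity_stationary assms(3,5) by (metis less_irrefl)
  qed (use that in auto)
  then have "L constant_on {a..b}" unfolding constant_on_def L_def by metis
  moreover have "tangent_scale m (cov_deriv S \<gamma> (velocity S \<gamma>) t) =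
      tangent_scale (L t * gauss_curvature S (\<gamma> t)) (rotation S (\<gamma> t) (velocity S \<gamma> t))"
    if t: "t \<in> {a..b}" for t
  proof -
    let ?i = "some_chart S (\<gamma> t)"
    obtain l r where "chart_segment S a b \<epsilon> l r \<gamma> u ?i" and tlr: "t \<in> {l..r}" using segment[OF t] by blast
    then interpret chart_segment S a b \<epsilon> l r \<gamma> u ?i by simp
    have tN: "t \<in> N" using segment_subset tlr by blast
    note i = N_chart[OF tN] and v = velocity_field[OF c]
    have vt: "velocity S \<gamma> t \<in> tangent_space S (\<gamma> t)"
      using v N_time[OF tN] by (simp add: smooth_tangent_field_def)
    show ?thesis
    proof (rule tangent_space_eqI[OF i])
      have "cov_deriv S \<gamma> (velocity S \<gamma>) t ?i = cov_coords G (pos t) (vel t) (vel t) (vector_derivative vel (at t))"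
        unfolding pos_def vel_def[abs_def] by (rule cov_deriv_chart[where \<gamma> = \<gamma> and t = t, OF i])
      moreover have "rotation S (\<gamma> t) (velocity S \<gamma> t) ?i = rot_coords (G (pos t)) (vel t)"
        using i by (simp add: rotation_def pos_def vel_def)
      moreover have "gauss_curvature S (\<gamma> t) = gauss_curvature_coords G (pos t)"
        by (simp add: gauss_curvature_def pos_def Let_def)
      moreover have "m *\<^sub>R cov_coords G (pos t) (vel t) (vel t) (vector_derivative vel (at t)) =
          (I\<^sub>a * axial_velocity S \<gamma> u t * gauss_curvature_coords G (pos t)) *\<^sub>R rot_coords (G (pos t)) (vel t)"
        by (rule equation_of_motion_chart_closed[OF assms(5) _ tlr]) (use assms(3) in simp)
      ultimately show "tangent_scale m (cov_deriv S \<gamma> (velocity S \<gamma>) t) ?i =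
          tangent_scale (L t * gauss_curvature S (\<gamma> t)) (rotation S (\<gamma> t) (velocity S \<gamma> t)) ?i"
        unfolding tangent_scale_def L_def by simp
    qed (intro tangent_scale_in cov_deriv_in[OF c v N_time[OF tN]] rotation_in[OF vt])+
  qed
  ultimately show ?thesis by blast
qed

end
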